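(* Assume Conditions (C1), (C2), (C3). Then for every $\epsilon>0$ satisfying Conditions (C4) and (C5), $$\frac{r_\epsilon(M_o\mid Y)}{\sum_{M:\,|M|\le n^\alpha} r_\epsilon(M\mid Y)}\xrightarrow{\ \mathbb P_y\ }1$$ as $n\to\infty$ (with $p$ fixed or $p=p_n\to\infty$).
   Context: Multivariate linear regression setting. $q\ge1$ response dimension, $n$ sample size, $p=p_n$ number of predictors (quantities may depend on $n$). $X$ is a fixed real $p\times n$ design matrix; for $M\subseteq\{1,\dots,p\}$, $X_{M\cdot}$ is the $|M|\times n$ row-submatrix indexed by $M$ and $H_{(M)}$ the orthogonal projection onto its row space. True model: fixed $M_o$, fixed $q\times|M_o|$ matrix $B^0$, fixed positive definite $q\times q$ matrix $A^0$, $V^0:=A^0A^{0\top}$, $Y=B^0X_{M_o\cdot}+A^0U$ with $U$ having i.i.d. $N(0,1)$ entries; $\mathbb{P}_y$ is probability under this law. $\underline\lambda_v,\bar\lambda_v$: smallest/largest eigenvalues of $V^0$. $\widehat\Sigma_{(M)}:=Y(I_n-H_{(M)})Y^\top$; $S^{-1/2}$ symmetric inverse square root; $\|\cdot\|_F$ Frobenius norm. $\widehat B_{\cdot M}:=YX_{M\cdot}^\top(X_{M\cdot}X_{M\cdot}^\top)^{-1}$. The $h$-function: for a $q\times|M|$ matrix $B$, $h_\epsilon(B):=\mathbf 1\{\tfrac12\|\widehat\Sigma_{(M)}^{-1/2}(BX_{M\cdot}-B_{\min}X)\|_F^2\ge\epsilon\}\cdot\mathbf 1\{|M|<n-q\}$,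 where $B_{\min}$ minimizes $\|\widehat\Sigma_{(M)}^{-1/2}(BX_{M\cdot}-B'X)\|_F^2$ over $q\times p$ matrices $B'$ with at most $|M|-1$ nonzero columns. GF distribution: given $Y$, $B_{\cdot M}$ is a random $q\times|M|$ matrix with density proportional to $\det\big(I_q+\widehat\Sigma_{(M)}^{-1}(B-\widehat B_{\cdot M})(X_{M\cdot}X_{M\cdot}^\top)(B-\widehat B_{\cdot M})^\top\big)^{-n/2}$; $\mathbb E$ is expectation under it. GF model probabilities: for $M$ with $X_{M\cdot}$ of full row rank and $|M|<n-q$, $$r_\epsilon(M\mid Y):=\Gamma_q\Big(\tfrac{n-|M|}{2}\Big)\pi^{q|M|/2}\big(\det\widehat\Sigma_{(M)}\big)^{-\frac{n-|M|-q}{2}}\,\mathbb E\big(h_\epsilon(B_{\cdot M})\big),$$ and $r_\epsilon(M\mid Y):=0$ otherwise; $\Gamma_q$ is the multivariate gamma function. Conditions: (C1) $q$ fixed and $0<\underline\lambda_v<\bar\lambda_v<\infty$. (C2) For a fixed $\alpha\in(0,1)$, $\log p=o(n^{1-\alpha})$. (C3) $X_{M_o\cdot}X_{M_o\cdot}^\top$ nonsingular. (C4) $|M_o|<n^\alpha$ and for large $n$, $\frac{1}{36q(n-|M_o|)}\|(V^0)^{-1/2}(B^0X_{M_o\cdot}-\widetilde B_{\min}X)\|_F^2>\epsilon$, where $\widetilde B_{\min}$ minimizes $\|(V^0)^{-1/2}(B^0X_{M_o\cdot}-BX)\|_F^2$ over $q\times p$ matrices $B$ with at most $|M_o|-1$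 nonzero columns. (C5) For every $M\not\subseteq M_o$ with $|M|\le n^\alpha$, for large $n$, $\frac{9}{\underline\lambda_v(n-|M|)}\|B^0X_{M_o\cdot}(H_{(M)}-H_{(M\setminus\{j^*\})})\|_F^2<\epsilon$, where $j^*\in M$ minimizes $\|B^0X_{M_o\cdot}(H_{(M)}-H_{(M\setminus\{j\})})\|_F^2$ over $j\in M$. *)

theory Defs
  imports "HOL-Probability.Probability" "HOL-Library.Landau_Symbols"
    "Jordan_Normal_Form.Determinant" "Jordan_Normal_Form.DL_Rank"
    "Jordan_Normal_Form.DL_Submatrix" "Jordan_Normal_Form.Char_Poly"
begin

definition fro2 :: "real mat \<Rightarrow> real" where
  "fro2 A = (\<Sum>i<dim_row A. \<Sum>j<dim_col A. (A $$ (i, j))\<^sup>2)"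

definition rows_sub :: "real mat \<Rightarrow> nat set \<Rightarrow> real mat" where
  "rows_sub X M = submatrix X M {0..<dim_col X}"

definition mat_inv :: "real mat \<Rightarrow> real mat" where
  "mat_inv A = (THE B. B \<in> carrier_mat (dim_row A) (dim_row A) \<and> inverts_mat A B \<and> inverts_mat B A)"

definition pos_def_mat :: "real mat \<Rightarrow> bool" where
  "pos_def_mat A \<longleftrightarrow> A \<in> carrier_mat (dim_row A) (dim_row A) \<and> transpose_mat A = A \<and>
     (\<forall>x \<in> carrier_vec (dim_row A). x \<noteq> 0\<^sub>v (dim_row A) \<longrightarrow> 0 < x \<bullet> (A *\<^sub>v x))"

definition inv_sqrt :: "real mat \<Rightarrow> real mat" where
  "inv_sqrt S = (THE R. R \<in> carrier_mat (dim_row S) (dim_row S) \<and> pos_def_mat R \<and> R * R = mat_inv S)"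

definition row_proj :: "real mat \<Rightarrow> real mat" where
  "row_proj Z = (THE P. P \<in> carrier_mat (dim_col Z) (dim_col Z) \<and> transpose_mat P = P \<and> P * P = P \<and>
     (\<forall>v \<in> carrier_vec (dim_col Z).
        (\<exists>w \<in> carrier_vec (dim_col Z). v = P *\<^sub>v w) \<longleftrightarrow>
        (\<exists>u \<in> carrier_vec (dim_row Z). v = transpose_mat Z *\<^sub>v u)))"

definition H_proj :: "real mat \<Rightarrow> nat set \<Rightarrow> real mat" where
  "H_proj X M = row_proj (rows_sub X M)"

definition Sigma_hat :: "real mat \<Rightarrow> real mat \<Rightarrow> nat set \<Rightarrow> real mat" where
  "Sigma_hat Y X M = Y * (1\<^sub>m (dim_col X) - H_proj X M) * transpose_mat Y"

definition nz_cols :: "real mat \<Rightarrow> nat" where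
  "nz_cols B = card {j. j < dim_col B \<and> (\<exists>i < dim_row B. B $$ (i, j) \<noteq> 0)}"

text \<open>Minimum over q x p matrices B' with at most k nonzero columns of
  ||W (C - B' X)||_F^2 (this is the value attained at the minimiser B_min).\<close>
definition min_sparse_fit :: "real mat \<Rightarrow> real mat \<Rightarrow> real mat \<Rightarrow> nat \<Rightarrow> real" where
  "min_sparse_fit W C X k = Inf {fro2 (W * (C - B' * X)) | B'.
      B' \<in> carrier_mat (dim_row C) (dim_row X) \<and> nz_cols B' \<le> k}"

definition h_eps :: "real \<Rightarrow> real mat \<Rightarrow> real mat \<Rightarrow> nat set \<Rightarrow> real mat \<Rightarrow> real" where
  "h_eps \<epsilon> Y X M B =
     (if 1/2 * min_sparse_fit (inv_sqrt (Sigma_hat Y X M)) (B * rows_sub X M) X (card M - 1) \<ge> \<epsilon>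
         \<and> real (card M) < real (dim_col X) - real (dim_row Y) then 1 else 0)"

definition B_hat :: "real mat \<Rightarrow> real mat \<Rightarrow> nat set \<Rightarrow> real mat" where
  "B_hat Y X M = Y * transpose_mat (rows_sub X M) * mat_inv (rows_sub X M * transpose_mat (rows_sub X M))"

definition gf_dens :: "real mat \<Rightarrow> real mat \<Rightarrow> nat set \<Rightarrow> real mat \<Rightarrow> real" where
  "gf_dens Y X M B =
     det (1\<^sub>m (dim_row Y) + mat_inv (Sigma_hat Y X M) * (B - B_hat Y X M)
          * (rows_sub X M * transpose_mat (rows_sub X M)) * transpose_mat (B - B_hat Y X M))
     powr (- (real (dim_col X) / 2))"

definition mat_lebesgue :: "nat \<Rightarrow> nat \<Rightarrow> (nat \<times> nat \<Rightarrow> real) measure" where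
  "mat_lebesgue q m = PiM ({0..<q} \<times> {0..<m}) (\<lambda>_. lborel)"

definition gf_expect :: "real mat \<Rightarrow> real mat \<Rightarrow> nat set \<Rightarrow> (real mat \<Rightarrow> real) \<Rightarrow> real" where
  "gf_expect Y X M f =
     (let q = dim_row Y; m = card M;
          L = mat_lebesgue q m in
      (\<integral>b. f (mat q m b) * gf_dens Y X M (mat q m b) \<partial>L) /
      (\<integral>b. gf_dens Y X M (mat q m b) \<partial>L))"

definition mgamma :: "nat \<Rightarrow> real \<Rightarrow> real" where
  "mgamma q a = pi powr (real q * (real q - 1) / 4) * (\<Prod>j = 1..q. Gamma (a + (1 - real j) / 2))"

definition r_eps :: "real \<Rightarrow> real mat \<Rightarrow> real mat \<Rightarrow> nat set \<Rightarrow> real" where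
  "r_eps \<epsilon> Y X M =
     (let q = dim_row Y; n = dim_col X; m = card M; XM = rows_sub X M in
      if vec_space.rank m XM = m \<and> real m < real n - real q then
        mgamma q ((real n - real m) / 2) * pi powr (real q * real m / 2)
        * det (Sigma_hat Y X M) powr (- ((real n - real m - real q) / 2))
        * gf_expect Y X M (h_eps \<epsilon> Y X M)
      else 0)"

definition lam_min :: "real mat \<Rightarrow> real" where
  "lam_min V = Min {k. eigenvalue V k}"
definition lam_max :: "real mat \<Rightarrow> real" where
  "lam_max V = Max {k. eigenvalue V k}"

definition gauss_mat_measure :: "nat \<Rightarrow> nat \<Rightarrow> (nat \<times> nat \<Rightarrow> real) measure" where
  "gauss_mat_measure q n = PiM ({0..<q} \<times> {0..<n}) (\<lambda>_. density lborel std_normal_density)"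

definition resp :: "real mat \<Rightarrow> real mat \<Rightarrow> nat set \<Rightarrow> real mat \<Rightarrow> (nat \<times> nat \<Rightarrow> real) \<Rightarrow> real mat" where
  "resp X B0 Mo A0 u = B0 * rows_sub X Mo + A0 * mat (dim_row A0) (dim_col X) u"

end

theory Submission
  imports Defs "Jordan_Normal_Form.Spectral_Radius" "HOL-Real_Asymp.Real_Asymp"
begin

text \<open>
  Because \<open>n powr \<alpha> * ln (p * n) = o(n)\<close>, there are only \<open>exp (o(n))\<close> candidate models, and for each of them the
  gamma functions, the powers of \<open>\<pi>\<close> and the scale of the determinants contribute at most another factor \<open>exp (o(n))\<close>.
  So it is enough to find, for every wrong model \<open>M\<close>, one factor of \<open>r_eps\<close> that is exponentially small in \<open>n\<close>,
  uniformly in \<open>M\<close>.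

  If \<open>M\<close> is not contained in \<open>Mo\<close>, dropping the column \<open>j\<close> from (C5) changes the fit by less than the threshold of the
  h-function, unless \<open>B\<close> is far from \<open>B_hat\<close>; under the matrix-t law this has exponentially small probability.
  If \<open>M\<close> is a proper subset of \<open>Mo\<close>, then (C4) makes \<open>det (Sigma_hat Y X M)\<close> larger than \<open>det (Sigma_hat Y X Mo)\<close>
  by a constant factor, which enters \<open>r_eps\<close> with exponent of order \<open>- n / 2\<close>. For \<open>M = Mo\<close>, (C4) keeps the h-function
  equal to 1 near \<open>B_hat\<close>.

  Randomness enters only through two events: the Gram matrix of the noise is close to \<open>n\<close> times the identity
  (Chebyshev), and the noise projected onto the row space of any model of size at most \<open>2 * n powr \<alpha>\<close> has
  squared norm at most \<open>\<eta> * n\<close> (exponential moments and a union bound). After multiplication by the inverse of \<open>A0\<close>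
  the noise is isotropic, and all matrix bounds reduce to Frobenius inner products.
\<close>

text \<open>Models that contribute to \<open>r_eps\<close> have full row rank, but the noise has to
  be controlled on the joint row space of \<open>M\<close> and \<open>Mo\<close>, where the rows may
  be dependent. Projecting the joint space away leaves pure noise, so the residual Gram matrices of
  all models share one lower bound, whatever signal they miss. A matching upper bound is proved only
  for \<open>Mo\<close>.

  The exponential rate is a budget: a wrong model gains \<open>\<rho> powr (- (n / 2))\<close>,
  comparing its determinant with that of \<open>Mo\<close> costs at most
  \<open>\<rho> powr (n / 4)\<close>, and the remaining \<open>\<rho> powr (- (n / 4))\<close>
  absorbs all subexponential factors. So \<open>\<rho>\<close> is fixed first and
  \<open>\<eta>\<close> is then made small enough for the cost.

  The h-function compares a squared norm with \<open>2 * \<epsilon>\<close>. In units of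
  \<open>sqrt \<epsilon>\<close> the three errors for \<open>M\<close> not contained in
  \<open>Mo\<close> are 1/2, 2/5 and 1/5, while for \<open>Mo\<close> condition (C4) supplies a
  signal of size 4.\<close>

lemma mult_entry:
  assumes "i < dim_row A" "j < dim_col B" "dim_col A = dim_row B"
  shows "(A * B) $$ (i,j) = (\<Sum>k<dim_col A. A $$ (i,k) * B $$ (k,j))"
  using assms by (simp add: scalar_prod_def lessThan_atLeast0)

text \<open>The side conditions of this group are equations between dimensions, so that the
  simplifier can discharge them from \<open>carrier_matD\<close> facts and use the rules for
  normalising products.\<close>

lemma mat_assoc: "dim_col A = dim_row B \<Longrightarrow> dim_col B = dim_row C \<Longrightarrow> (A * B) * C = A * (B * (C :: 'a :: semiring_0 mat))"
  by (rule assoc_mult_mat[of A "dim_row A" "dim_row B" B "dim_col B" C "dim_col C"]) auto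

lemma mat_trans_mult: "dim_col A = dim_row B \<Longrightarrow> transpose_mat (A * B) = transpose_mat B * transpose_mat (A :: 'a :: comm_semiring_0 mat)"
  by (rule transpose_mult[of A "dim_row A" "dim_row B" B "dim_col B"]) auto

lemma mat_trans_minus: "dim_row A = dim_row B \<Longrightarrow> dim_col A = dim_col B \<Longrightarrow>
   transpose_mat (A - B) = transpose_mat A - transpose_mat (B :: 'a :: ab_group_add mat)"
  by (intro eq_matI) auto

lemma mat_minus_mult: "dim_row A = dim_row B \<Longrightarrow> dim_col A = dim_col B \<Longrightarrow> dim_col A = dim_row C \<Longrightarrow>
   (A - B) * C = A * C - B * (C :: 'a :: ring mat)"
  by (rule minus_mult_distrib_mat[of A "dim_row A" "dim_col A" B C "dim_col C"]) auto

lemma mat_add_mult: "dim_row A = dim_row B \<Longrightarrow> dim_col A = dim_col B \<Longrightarrow> dim_col A = dim_row C \<Longrightarrow>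
   (A + B) * C = A * C + B * (C :: 'a :: semiring_0 mat)"
  by (rule add_mult_distrib_mat[of A "dim_row A" "dim_col A" B C "dim_col C"]) auto

lemma mat_mult_minus: "dim_row B = dim_row C \<Longrightarrow> dim_col B = dim_col C \<Longrightarrow> dim_col A = dim_row B \<Longrightarrow>
   A * (B - C) = A * B - A * (C :: 'a :: ring mat)"
  by (rule mult_minus_distrib_mat[of A "dim_row A" "dim_row B" B "dim_col B" C]) auto

lemma mat_mult_add: "dim_row B = dim_row C \<Longrightarrow> dim_col B = dim_col C \<Longrightarrow> dim_col A = dim_row B \<Longrightarrow>
   A * (B + C) = A * B + A * (C :: 'a :: semiring_0 mat)"
  by (rule mult_add_distrib_mat[of A "dim_row A" "dim_row B" B "dim_col B" C]) auto

lemma mat_mult_one: "dim_col A = k \<Longrightarrow> A * 1\<^sub>m k = (A :: 'a :: semiring_1 mat)"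
  by (rule right_mult_one_mat[of A "dim_row A" k]) auto

lemma mat_one_mult: "dim_row A = k \<Longrightarrow> 1\<^sub>m k * A = (A :: 'a :: semiring_1 mat)"
  by (rule left_mult_one_mat[of A k "dim_col A"]) auto

section \<open>The Frobenius inner product\<close>

text \<open>The trace of \<open>transpose_mat A * B\<close>. The index ranges are read off
  \<open>A\<close> alone, which is why symmetry needs matching dimensions.\<close>

definition fip :: "real mat \<Rightarrow> real mat \<Rightarrow> real" where
  "fip A B = (\<Sum>i<dim_row A. \<Sum>j<dim_col A. A $$ (i,j) * B $$ (i,j))"

lemma fro2_fip: "fro2 A = fip A A"
  by (simp add: fro2_def fip_def power2_eq_square)

lemma fip_commute: "dim_row A = dim_row B \<Longrightarrow> dim_col A = dim_col B \<Longrightarrow> fip A B = fip B A"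
  by (simp add: fip_def mult.commute)

lemma fip_add_left: "dim_row A = dim_row B \<Longrightarrow> dim_col A = dim_col B \<Longrightarrow> fip (A + B) C = fip A C + fip B C"
  by (simp add: fip_def algebra_simps sum.distrib)

lemma fip_minus_left: "dim_row A = dim_row B \<Longrightarrow> dim_col A = dim_col B \<Longrightarrow> fip (A - B) C = fip A C - fip B C"
  by (simp add: fip_def algebra_simps sum_subtractf)

lemma fip_minus_right:
  "dim_row A = dim_row B \<Longrightarrow> dim_col A = dim_col B \<Longrightarrow> dim_row A = dim_row C \<Longrightarrow> dim_col A = dim_col C
   \<Longrightarrow> fip A (B - C) = fip A B - fip A C"
  by (simp add: fip_def algebra_simps sum_subtractf)

lemma fip_transpose: "dim_row A = dim_row B \<Longrightarrow> dim_col A = dim_col B \<Longrightarrow>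
  fip (transpose_mat A) (transpose_mat B) = fip A B"
  by (simp add: fip_def) (rule sum.swap)

text \<open>Cyclicity of the trace in the form used throughout: identities about projections, Gram
  matrices and quadratic forms come from moving one factor to the other side of
  \<open>fip\<close>.\<close>

lemma fip_mult_right_adjoint:
  assumes "dim_col A = dim_row B" "dim_row C = dim_row A" "dim_col C = dim_col B"
  shows "fip (A * B) C = fip A (C * transpose_mat B)"
proof -
  have "fip (A * B) C = (\<Sum>i<dim_row A. \<Sum>j<dim_col B. \<Sum>k<dim_col A. A $$ (i,k) * B $$ (k,j) * C $$ (i,j))"
    using assms by (simp add: fip_def mult_entry sum_distrib_right del: index_mult_mat(1))
  also have "\<dots> = (\<Sum>i<dim_row A. \<Sum>k<dim_col A. \<Sum>j<dim_col B. A $$ (i,k) * B $$ (k,j) * C $$ (i,j))"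
    by (rule sum.cong[OF refl]) (rule sum.swap)
  also have "\<dots> = fip A (C * transpose_mat B)"
    using assms by (simp add: fip_def mult_entry sum_distrib_left algebra_simps del: index_mult_mat(1))
  finally show ?thesis .
qed

lemma fip_mult_left_adjoint:
  assumes "dim_col A = dim_row B" "dim_row C = dim_row A" "dim_col C = dim_col B"
  shows "fip (A * B) C = fip B (transpose_mat A * C)"
proof -
  have "fip (A * B) C = fip (transpose_mat B * transpose_mat A) (transpose_mat C)"
    using assms by (subst mat_trans_mult[symmetric]) (auto simp: fip_transpose)
  also have "\<dots> = fip (transpose_mat B) (transpose_mat C * A)"
    using assms by (subst fip_mult_right_adjoint) auto
  also have "\<dots> = fip (transpose_mat B) (transpose_mat (transpose_mat A * C))"
    using assms by (subst mat_trans_mult) auto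
  also have "\<dots> = fip B (transpose_mat A * C)"
    using assms by (subst fip_transpose) auto
  finally show ?thesis .
qed

text \<open>Places the Frobenius norm inside \<open>L2_set\<close>, which supplies the triangle
  inequality and the Cauchy-Schwarz bound \<open>fip_le\<close>.\<close>

lemma fro2_L2: "fro2 A = (L2_set (\<lambda>x. A $$ x) ({..<dim_row A} \<times> {..<dim_col A}))\<^sup>2"
  by (simp add: fro2_def L2_set_def sum_nonneg sum.cartesian_product)

lemma fro2_nonneg [simp]: "0 \<le> fro2 A"
  by (simp add: fro2_def sum_nonneg)

lemma sqrt_fro2: "sqrt (fro2 A) = L2_set (\<lambda>x. A $$ x) ({..<dim_row A} \<times> {..<dim_col A})"
  by (simp add: fro2_L2)

lemma fro2_0_iff: "fro2 A = 0 \<longleftrightarrow> A = 0\<^sub>m (dim_row A) (dim_col A)"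
proof
  assume "fro2 A = 0"
  hence "\<forall>i<dim_row A. \<forall>j<dim_col A. A $$ (i,j) = 0"
    by (auto simp: fro2_def sum_nonneg_eq_0_iff sum_nonneg)
  thus "A = 0\<^sub>m (dim_row A) (dim_col A)" by (intro eq_matI) auto
next
  assume *: "A = 0\<^sub>m (dim_row A) (dim_col A)"
  have "fro2 (0\<^sub>m (dim_row A) (dim_col A)) = 0" by (simp add: fro2_def)
  thus "fro2 A = 0" using * by simp
qed

lemma fro2_add_le:
  assumes "dim_row A = dim_row B" "dim_col A = dim_col B"
  shows "sqrt (fro2 (A + B)) \<le> sqrt (fro2 A) + sqrt (fro2 B)"
proof -
  have "sqrt (fro2 (A + B)) = L2_set (\<lambda>x. A $$ x + B $$ x) ({..<dim_row B} \<times> {..<dim_col B})"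
    unfolding sqrt_fro2 using assms by (auto intro!: L2_set_cong)
  also have "\<dots> \<le> sqrt (fro2 A) + sqrt (fro2 B)"
    unfolding sqrt_fro2 using assms by (simp add: L2_set_triangle_ineq)
  finally show ?thesis .
qed

lemma fro2_uminus [simp]: "fro2 (- A) = fro2 A"
  by (simp add: fro2_def)

lemma fro2_transpose [simp]: "fro2 (transpose_mat A) = fro2 A"
  by (simp add: fro2_fip fip_transpose)

lemma fro2_minus_le:
  assumes "dim_row A = dim_row B" "dim_col A = dim_col B"
  shows "sqrt (fro2 (A - B)) \<le> sqrt (fro2 A) + sqrt (fro2 B)"
proof -
  have "A - B = A + (- B)" using assms by (intro eq_matI) auto
  thus ?thesis using fro2_add_le[of A "- B"] assms by simp
qed

lemma fro2_add_ge:
  assumes "dim_row A = dim_row B" "dim_col A = dim_col B"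
  shows "sqrt (fro2 (A + B)) \<ge> sqrt (fro2 A) - sqrt (fro2 B)"
proof -
  have "A = (A + B) - B" using assms by (intro eq_matI) auto
  thus ?thesis using fro2_minus_le[of "A + B" B] assms by simp
qed

lemma fip_le:
  assumes "dim_row A = dim_row B" "dim_col A = dim_col B"
  shows "fip A B \<le> sqrt (fro2 A) * sqrt (fro2 B)"
proof -
  have "fip A B \<le> (\<Sum>x\<in>{..<dim_row A} \<times> {..<dim_col A}. \<bar>A $$ x\<bar> * \<bar>B $$ x\<bar>)"
    by (auto simp: fip_def sum.cartesian_product intro!: sum_mono) (metis abs_ge_self abs_mult)
  also have "\<dots> \<le> sqrt (fro2 A) * sqrt (fro2 B)"
    unfolding sqrt_fro2 using assms by (simp add: L2_set_mult_ineq)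
  finally show ?thesis .
qed

lemma fro2_mult_le:
  assumes "dim_col A = dim_row B"
  shows "fro2 (A * B) \<le> fro2 A * fro2 B"
proof -
  have "fro2 (A * B) = (\<Sum>i<dim_row A. \<Sum>j<dim_col B. (\<Sum>k<dim_col A. A $$ (i,k) * B $$ (k,j))\<^sup>2)"
    using assms by (simp add: fro2_def mult_entry del: index_mult_mat(1))
  also have "\<dots> \<le> (\<Sum>i<dim_row A. \<Sum>j<dim_col B. (\<Sum>k<dim_col A. (A $$ (i,k))\<^sup>2) * (\<Sum>k<dim_col A. (B $$ (k,j))\<^sup>2))"
    by (intro sum_mono Cauchy_Schwarz_ineq_sum)
  also have "\<dots> = fro2 A * (\<Sum>j<dim_col B. \<Sum>k<dim_col A. (B $$ (k,j))\<^sup>2)"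
    by (simp add: fro2_def sum_product)
  also have "(\<Sum>j<dim_col B. \<Sum>k<dim_col A. (B $$ (k,j))\<^sup>2) = fro2 B"
    unfolding fro2_def assms by (rule sum.swap)
  finally show ?thesis .
qed

section \<open>The spectral theorem for real symmetric matrices\<close>

text \<open>Split a complex eigenvector into real part \<open>x\<close> and imaginary part
  \<open>y\<close>. By symmetry, pairing \<open>y\<close> with the image of \<open>x\<close> equals
  pairing \<open>x\<close> with the image of \<open>y\<close>; this gives \<open>Im k\<close> times
  the squared length of the eigenvector equal to 0. So \<open>k\<close> is real, and whichever of
  \<open>x\<close> and \<open>y\<close> is nonzero is a real eigenvector.\<close>

lemma real_sym_eigenvector:
  fixes s :: "nat \<Rightarrow> nat \<Rightarrow> real"
  assumes n: "n > 0" and sym: "\<And>i j. i < n \<Longrightarrow> j < n \<Longrightarrow> s i j = s j i"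
  obtains v l where "(\<Sum>i<n. (v i)\<^sup>2) = 1" "\<And>i. i < n \<Longrightarrow> (\<Sum>j<n. s i j * v j) = l * v i"
proof -
  note found = that
  define Sc where "Sc = mat n n (\<lambda>(i,j). complex_of_real (s i j))"
  have Sc: "Sc \<in> carrier_mat n n" by (simp add: Sc_def)
  obtain k where "k \<in> spectrum Sc" using spectrum_non_empty[OF Sc n] by auto
  then obtain z where z: "z \<in> carrier_vec n" "z \<noteq> 0\<^sub>v n" "Sc *\<^sub>v z = k \<cdot>\<^sub>v z"
    using Sc by (auto simp: spectrum_def eigenvalue_def eigenvector_def)
  define x where "x = (\<lambda>i. Re (vec_index z i))"
  define y where "y = (\<lambda>i. Im (vec_index z i))"
  have ev: "(\<Sum>j<n. complex_of_real (s i j) * vec_index z j) = k * vec_index z i" if "i < n" for i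
  proof -
    have "vec_index (Sc *\<^sub>v z) i = vec_index (k \<cdot>\<^sub>v z) i" using z by simp
    thus ?thesis using that z Sc by (simp add: scalar_prod_def Sc_def lessThan_atLeast0)
  qed
  have ex: "(\<Sum>j<n. s i j * x j) = Re k * x i - Im k * y i" if "i < n" for i
    using arg_cong[OF ev[OF that], of Re] by (simp add: x_def y_def)
  have ey: "(\<Sum>j<n. s i j * y j) = Re k * y i + Im k * x i" if "i < n" for i
    using arg_cong[OF ev[OF that], of Im] by (simp add: x_def y_def)
  have "(\<Sum>i<n. y i * (\<Sum>j<n. s i j * x j)) = (\<Sum>i<n. \<Sum>j<n. y i * s i j * x j)"
    by (simp add: sum_distrib_left algebra_simps)
  also have "\<dots> = (\<Sum>j<n. \<Sum>i<n. y i * s i j * x j)" by (rule sum.swap)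
  also have "\<dots> = (\<Sum>j<n. x j * (\<Sum>i<n. s j i * y i))"
    by (auto simp add: sum_distrib_left sym intro!: sum.cong)
  finally have "(\<Sum>i<n. y i * (Re k * x i - Im k * y i)) = (\<Sum>j<n. x j * (Re k * y j + Im k * x j))"
    by (simp add: ex ey)
  hence "Im k * (\<Sum>i<n. (x i)\<^sup>2 + (y i)\<^sup>2) = 0"
    by (simp add: sum_distrib_left sum_subtractf sum.distrib algebra_simps power2_eq_square)
  moreover have "(\<Sum>i<n. (x i)\<^sup>2 + (y i)\<^sup>2) \<noteq> 0"
  proof
    assume "(\<Sum>i<n. (x i)\<^sup>2 + (y i)\<^sup>2) = 0"
    hence "\<forall>i<n. (x i)\<^sup>2 + (y i)\<^sup>2 = 0" by (subst (asm) sum_nonneg_eq_0_iff) auto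
    hence "z = 0\<^sub>v n" using z by (intro eq_vecI) (auto simp: x_def y_def complex_eq_iff sum_power2_eq_zero_iff)
    thus False using z by simp
  qed
  ultimately have im: "Im k = 0" by simp
  have main: ?thesis if ne: "(\<Sum>i<n. (w i)\<^sup>2) \<noteq> 0" and e: "\<And>i. i < n \<Longrightarrow> (\<Sum>j<n. s i j * w j) = Re k * w i" for w
  proof -
    define t where "t = sqrt (\<Sum>i<n. (w i)\<^sup>2)"
    have t2: "t\<^sup>2 = (\<Sum>i<n. (w i)\<^sup>2)" by (simp add: t_def sum_nonneg)
    have t: "t \<noteq> 0" using ne t2 by auto
    show ?thesis
    proof (rule found[of "\<lambda>i. w i / t" "Re k"])
      show "(\<Sum>i<n. (w i / t)\<^sup>2) = 1"
        using t by (simp add: power_divide t2[symmetric] sum_divide_distrib[symmetric])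
      show "(\<Sum>j<n. s i j * (w j / t)) = Re k * (w i / t)" if "i < n" for i
        using e[OF that] by (simp add: sum_divide_distrib[symmetric])
    qed
  qed
  show ?thesis
  proof (cases "(\<Sum>i<n. (x i)\<^sup>2) = 0")
    case False
    thus ?thesis by (rule main) (simp add: ex im)
  next
    case True
    with \<open>(\<Sum>i<n. (x i)\<^sup>2 + (y i)\<^sup>2) \<noteq> 0\<close> have "(\<Sum>i<n. (y i)\<^sup>2) \<noteq> 0"
      by (simp add: sum.distrib)
    thus ?thesis by (rule main) (simp add: ey im)
  qed
qed

text \<open>The reflection along the difference \<open>w\<close> of \<open>v\<close> and the first
  unit vector exchanges these two. If they coincide then \<open>s = 0\<close>, and as division by
  zero yields 0 the same formula for \<open>H\<close> is the identity.\<close>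

lemma householder:
  fixes v :: "nat \<Rightarrow> real"
  assumes n: "n > 0" and v: "(\<Sum>i<n. (v i)\<^sup>2) = 1"
  obtains H where "H \<in> carrier_mat n n" "transpose_mat H = H" "H * H = 1\<^sub>m n"
    "\<And>i. i < n \<Longrightarrow> H $$ (i,0) = v i"
proof -
  define w where "w = (\<lambda>i. v i - (if i = 0 then 1 else 0))"
  define s where "s = (\<Sum>i<n. (w i)\<^sup>2)"
  have s: "s = 2 - 2 * v 0"
  proof -
    have "s = (\<Sum>i<n. (v i)\<^sup>2 + (if i = 0 then 1 - 2 * v i else 0))"
      unfolding s_def w_def by (intro sum.cong) (auto simp: power2_eq_square algebra_simps)
    also have "\<dots> = 2 - 2 * v 0" using n by (simp add: sum.distrib v)
    finally show ?thesis .
  qed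
  define H where "H = mat n n (\<lambda>(i,j). (if i = j then 1 else 0) - 2 / s * (w i * w j))"
  have H: "H \<in> carrier_mat n n" by (simp add: H_def)
  have "H * H = 1\<^sub>m n"
  proof (intro eq_matI)
    fix i j assume ij: "i < dim_row (1\<^sub>m n :: real mat)" "j < dim_col (1\<^sub>m n :: real mat)"
    have "(H * H) $$ (i,j) = (\<Sum>k<n. ((if i = k then 1 else 0) - 2 / s * (w i * w k)) * ((if k = j then 1 else 0) - 2 / s * (w k * w j)))"
      using ij H by (subst mult_entry) (auto simp: H_def)
    also have "\<dots> = (\<Sum>k<n. (if k = j then (if i = k then 1 else 0) - 2 / s * (w i * w k) else 0)
        - (if i = k then 2 / s * (w k * w j) else 0) + (2/s)^2 * (w i * w j) * (w k)\<^sup>2)"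
      by (intro sum.cong refl) (auto simp: algebra_simps power2_eq_square)
    also have "\<dots> = (if i = j then 1 else 0) - 2 / s * (w i * w j) - 2 / s * (w i * w j) + (2/s)^2 * (w i * w j) * s"
      using ij by (simp add: sum.distrib sum_subtractf sum_distrib_left[symmetric] s_def[symmetric])
    also have "\<dots> = (if i = j then 1 else 0)"
      by (cases "s = 0") (simp_all add: power2_eq_square)
    finally show "(H * H) $$ (i,j) = 1\<^sub>m n $$ (i,j)" using ij by simp
  qed (auto simp: H_def)
  moreover have "H $$ (i,0) = v i" if "i < n" for i
  proof (cases "s = 0")
    case True
    hence "\<forall>i<n. (w i)\<^sup>2 = 0" unfolding s_def by (subst (asm) sum_nonneg_eq_0_iff) auto
    hence "w i = 0" using that by auto
    thus ?thesis using n that by (auto simp: H_def w_def)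
  next
    case False
    have "w 0 = - s / 2" using s by (simp add: w_def)
    hence "2 / s * (w i * w 0) = - w i" using False by simp
    moreover have "H $$ (i,0) = (if i = 0 then 1 else 0) - 2 / s * (w i * w 0)"
      using n that by (simp add: H_def)
    ultimately show ?thesis by (simp add: w_def)
  qed
  moreover have "transpose_mat H = H" by (intro eq_matI) (auto simp: H_def)
  ultimately show ?thesis using that H by blast
qed

definition diagm :: "nat \<Rightarrow> (nat \<Rightarrow> real) \<Rightarrow> real mat" where
  "diagm n d = mat n n (\<lambda>(i,j). if i = j then d i else 0)"

lemma diagm_dim [simp]: "diagm n d \<in> carrier_mat n n" "dim_row (diagm n d) = n" "dim_col (diagm n d) = n"
  by (auto simp: diagm_def)

lemma diagm_mult: "diagm n d * diagm n e = diagm n (\<lambda>i. d i * e i)"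
  by (intro eq_matI) (auto simp: mult_entry diagm_def if_distrib[where f="\<lambda>x. x * _"] cong: if_cong simp del: index_mult_mat(1))

lemma diagm_transpose [simp]: "transpose_mat (diagm n d) = diagm n d"
  by (intro eq_matI) (auto simp: diagm_def)

lemma diagm_one: "1\<^sub>m n = diagm n (\<lambda>_. 1)"
  by (intro eq_matI) (auto simp: diagm_def)

lemma diagm_cong: "(\<And>i. i < n \<Longrightarrow> d i = e i) \<Longrightarrow> diagm n d = diagm n e"
  by (intro eq_matI) (auto simp: diagm_def)

lemma det_diagm: "det (diagm n d) = (\<Prod>i<n. d i)"
proof -
  have "det (diagm n d) = prod_list (diag_mat (diagm n d))"
    by (rule det_upper_triangular[of _ n]) (auto simp: upper_triangular_def diagm_def)
  also have "\<dots> = (\<Prod>i<n. d i)"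
    by (simp add: diag_mat_def prod.list_conv_set_nth diagm_def lessThan_atLeast0)
  finally show ?thesis .
qed

lemma mult_diagm_entry: "dim_col A = n \<Longrightarrow> i < dim_row A \<Longrightarrow> j < n \<Longrightarrow> (A * diagm n d) $$ (i,j) = A $$ (i,j) * d j"
  by (auto simp: mult_entry diagm_def if_distrib[where f="\<lambda>x. _ * x"] cong: if_cong simp del: index_mult_mat(1))

text \<open>Deflation: conjugation by a reflection whose first column is a unit eigenvector turns
  the first column of \<open>S\<close> into a multiple of the first unit vector. Symmetry clears the
  first row as well, and the induction hypothesis applies to the remaining block.\<close>

theorem real_spectral:
  assumes "S \<in> carrier_mat n n" "transpose_mat S = S"
  shows "\<exists>Q d. Q \<in> carrier_mat n n \<and> transpose_mat Q * Q = 1\<^sub>m n \<and> Q * transpose_mat Q = 1\<^sub>m n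
    \<and> transpose_mat Q * S * Q = diagm n d"
  using assms
proof (induction n arbitrary: S)
  case 0
  thus ?case by (intro exI[of _ S] exI[of _ "\<lambda>_. 0"] conjI eq_matI) auto
next
  case (Suc n S)
  note S = Suc.prems(1)
  note dS[simp] = carrier_matD[OF S]
  have sym: "S $$ (i,j) = S $$ (j,i)" if "i < Suc n" "j < Suc n" for i j
  proof -
    have "S $$ (i,j) = transpose_mat S $$ (i,j)" by (simp only: Suc.prems(2))
    thus ?thesis using that by simp
  qed
  obtain v l where v: "(\<Sum>i<Suc n. (v i)\<^sup>2) = 1"
      "\<And>i. i < Suc n \<Longrightarrow> (\<Sum>j<Suc n. S $$ (i,j) * v j) = l * v i"
    using real_sym_eigenvector[of "Suc n" "\<lambda>i j. S $$ (i,j)"] sym by blast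
  obtain H where H: "H \<in> carrier_mat (Suc n) (Suc n)" "transpose_mat H = H" "H * H = 1\<^sub>m (Suc n)"
    "\<And>i. i < Suc n \<Longrightarrow> H $$ (i,0) = v i"
    using householder[OF _ v(1)] by blast
  note dH[simp] = carrier_matD[OF H(1)]
  define S1 where "S1 = H * S * H"
  have dS1[simp]: "S1 \<in> carrier_mat (Suc n) (Suc n)" "dim_row S1 = Suc n" "dim_col S1 = Suc n"
    by (auto simp: S1_def)
  have S1t: "transpose_mat S1 = S1"
    by (simp add: S1_def mat_trans_mult H(2) Suc.prems(2) mat_assoc)
  have symS1: "S1 $$ (i,j) = S1 $$ (j,i)" if "i < Suc n" "j < Suc n" for i j
  proof -
    have "S1 $$ (i,j) = transpose_mat S1 $$ (i,j)" by (simp only: S1t)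
    thus ?thesis using that by simp
  qed
  have col0: "S1 $$ (i,0) = (if i = 0 then l else 0)" if i: "i < Suc n" for i
  proof -
    have a: "(S * H) $$ (k,0) = l * H $$ (k,0)" if "k < Suc n" for k
    proof -
      have "(S * H) $$ (k,0) = (\<Sum>j<Suc n. S $$ (k,j) * v j)"
        using that H(4) by (subst mult_entry) (auto simp del: sum.lessThan_Suc)
      also have "\<dots> = l * H $$ (k,0)" using v(2)[OF that] H(4)[OF that] by simp
      finally show ?thesis .
    qed
    have "S1 $$ (i,0) = (H * (S * H)) $$ (i,0)" by (simp add: S1_def mat_assoc)
    also have "\<dots> = (\<Sum>k<Suc n. H $$ (i,k) * (l * H $$ (k,0)))"
      using i a by (subst mult_entry) (auto simp del: sum.lessThan_Suc index_mult_mat(1))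
    also have "\<dots> = l * (\<Sum>k<Suc n. H $$ (i,k) * H $$ (k,0))"
      by (simp only: sum_distrib_left mult.left_commute)
    also have "(\<Sum>k<Suc n. H $$ (i,k) * H $$ (k,0)) = (H * H) $$ (i,0)"
      using i by (subst mult_entry) auto
    finally show ?thesis using i by (simp add: H(3))
  qed
  define S2 where "S2 = mat n n (\<lambda>(i,j). S1 $$ (Suc i, Suc j))"
  have "S2 \<in> carrier_mat n n" "transpose_mat S2 = S2"
    by (auto simp: S2_def intro!: eq_matI symS1)
  from Suc.IH[OF this] obtain Q2 d2 where Q2: "Q2 \<in> carrier_mat n n" "transpose_mat Q2 * Q2 = 1\<^sub>m n"
     "Q2 * transpose_mat Q2 = 1\<^sub>m n" "transpose_mat Q2 * S2 * Q2 = diagm n d2" by blast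
  note dQ2[simp] = carrier_matD[OF Q2(1)]
  define F where "F = four_block_mat (1\<^sub>m 1) (0\<^sub>m 1 n) (0\<^sub>m n 1) Q2"
  have F: "F \<in> carrier_mat (Suc n) (Suc n)" using Q2(1) by (auto simp: F_def)
  note dF[simp] = carrier_matD[OF F]
  have Ft: "transpose_mat F = four_block_mat (1\<^sub>m 1) (0\<^sub>m 1 n) (0\<^sub>m n 1) (transpose_mat Q2)"
    unfolding F_def using Q2(1) by (subst transpose_four_block_mat[of _ 1 1 _ n _ n]) auto
  have one: "four_block_mat (1\<^sub>m 1) (0\<^sub>m 1 n) (0\<^sub>m n 1) (1\<^sub>m n) = (1\<^sub>m (Suc n) :: real mat)"
    by (intro eq_matI) auto
  have S1b: "S1 = four_block_mat (l \<cdot>\<^sub>m 1\<^sub>m 1) (0\<^sub>m 1 n) (0\<^sub>m n 1) S2"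
  proof (intro eq_matI)
    fix i j assume "i < dim_row (four_block_mat (l \<cdot>\<^sub>m 1\<^sub>m 1) (0\<^sub>m 1 n) (0\<^sub>m n 1) S2)"
      "j < dim_col (four_block_mat (l \<cdot>\<^sub>m 1\<^sub>m 1) (0\<^sub>m 1 n) (0\<^sub>m n 1) S2)"
    hence ij: "i < Suc n" "j < Suc n" by (auto simp: S2_def)
    show "S1 $$ (i,j) = four_block_mat (l \<cdot>\<^sub>m 1\<^sub>m 1) (0\<^sub>m 1 n) (0\<^sub>m n 1) S2 $$ (i,j)"
      using ij col0[OF ij(1)] col0[OF ij(2)] symS1[OF ij] by (cases i; cases j) (auto simp: S2_def)
  qed (auto simp: S2_def)
  have FF: "transpose_mat F * F = 1\<^sub>m (Suc n)"
    unfolding Ft unfolding F_def one[symmetric]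
    by (subst mult_four_block_mat[of _ 1 1 _ n _ n _ _ 1 _ n]) (auto simp: Q2)
  have FF': "F * transpose_mat F = 1\<^sub>m (Suc n)"
    unfolding Ft unfolding F_def one[symmetric]
    by (subst mult_four_block_mat[of _ 1 1 _ n _ n _ _ 1 _ n]) (auto simp: Q2)
  have FSF: "transpose_mat F * S1 * F = diagm (Suc n) (\<lambda>i. if i = 0 then l else d2 (i - 1))"
  proof -
    have S2c: "S2 \<in> carrier_mat n n" by (simp add: S2_def)
    have "transpose_mat F * S1 = four_block_mat (l \<cdot>\<^sub>m 1\<^sub>m 1) (0\<^sub>m 1 n) (0\<^sub>m n 1) (transpose_mat Q2 * S2)"
      unfolding Ft S1b using S2c Q2(1)
      by (subst mult_four_block_mat[of _ 1 1 _ n _ n _ _ 1 _ n]) auto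
    hence "transpose_mat F * S1 * F = four_block_mat (l \<cdot>\<^sub>m 1\<^sub>m 1) (0\<^sub>m 1 n) (0\<^sub>m n 1) (transpose_mat Q2 * S2 * Q2)"
      unfolding F_def using S2c Q2(1)
      by (simp, subst mult_four_block_mat[of _ 1 1 _ n _ n _ _ 1 _ n]) auto
    also have "\<dots> = diagm (Suc n) (\<lambda>i. if i = 0 then l else d2 (i - 1))"
      unfolding Q2(4) by (intro eq_matI) (auto simp: diagm_def)
    finally show ?thesis .
  qed
  have a: "transpose_mat (H * F) * (H * F) = transpose_mat F * ((H * H) * F)"
    by (simp add: mat_trans_mult H(2) mat_assoc)
  have b: "(H * F) * transpose_mat (H * F) = H * ((F * transpose_mat F) * H)"
    by (simp add: mat_trans_mult H(2) mat_assoc)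
  have c: "transpose_mat (H * F) * S * (H * F) = transpose_mat F * S1 * F"
    by (simp add: mat_trans_mult H(2) mat_assoc S1_def)
  show ?case
    by (intro exI[of _ "H * F"] exI conjI)
       (use F H(1) in simp, use a FF in \<open>simp add: H(3)\<close>, use b H(3) in \<open>simp add: FF'\<close>, unfold c, rule FSF)
qed

lemma mat_smult_mult: "dim_col A = dim_row B \<Longrightarrow> (c \<cdot>\<^sub>m A) * B = c \<cdot>\<^sub>m (A * (B :: 'a :: comm_semiring_0 mat))"
  by (rule mult_smult_assoc_mat[of A "dim_row A" "dim_col A" B "dim_col B"]) auto

lemma mat_mult_smult: "dim_col A = dim_row B \<Longrightarrow> A * (c \<cdot>\<^sub>m B) = c \<cdot>\<^sub>m (A * (B :: 'a :: comm_semiring_0 mat))"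
  by (rule mult_smult_distrib[of A "dim_row A" "dim_col A" B "dim_col B"]) auto

lemma det_orthogonal_conj:
  assumes "Q \<in> carrier_mat n n" "transpose_mat Q * Q = 1\<^sub>m n" "S \<in> carrier_mat n n"
  shows "det (transpose_mat Q * S * Q) = det S"
proof -
  have "det (transpose_mat Q) * det Q = 1"
    using assms det_mult[of "transpose_mat Q" n Q] by simp
  moreover have "det (transpose_mat Q * S * Q) = det (transpose_mat Q) * det S * det Q"
    using assms by (subst det_mult[of _ n], simp_all add: det_mult[of "transpose_mat Q" n S])
  ultimately show ?thesis by (metis mult.assoc mult.commute mult_1)
qed

text \<open>Vectors are \<open>1 \<times> q\<close> matrices from here on, so that the Frobenius
  calculus covers them too.\<close>

definition unit_row :: "nat \<Rightarrow> nat \<Rightarrow> real mat" where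
  "unit_row q i = mat 1 q (\<lambda>(_,k). if k = i then 1 else 0)"

lemma unit_row_dim [simp]: "unit_row q i \<in> carrier_mat 1 q" "dim_row (unit_row q i) = 1" "dim_col (unit_row q i) = q"
  by (auto simp: unit_row_def)

lemma fip_unit_row: "A \<in> carrier_mat q q \<Longrightarrow> i < q \<Longrightarrow> fip (unit_row q i * A) (unit_row q i) = A $$ (i,i)"
  by (simp add: fip_def mult_entry del: index_mult_mat(1))
     (simp add: unit_row_def if_distrib[where f="\<lambda>x. x * _"] if_distrib[where f="\<lambda>x. _ * x"] cong: if_cong)

lemma fro2_unit_row: "i < q \<Longrightarrow> fro2 (unit_row q i) = 1"
  by (simp add: fro2_def unit_row_def if_distrib[where f="\<lambda>x. x ^ _"] cong: if_cong)

text \<open>An eigenvalue is the quadratic form at a unit row, namely a transposed column of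
  \<open>Q\<close>. This is how bounds valid for all rows \<open>R\<close> become bounds on
  eigenvalues.\<close>

lemma spectral_entry:
  assumes Q: "Q \<in> carrier_mat q q" "transpose_mat Q * Q = 1\<^sub>m q" "S \<in> carrier_mat q q"
    "transpose_mat Q * S * Q = diagm q d" and i: "i < q"
  shows "d i = fip (unit_row q i * transpose_mat Q * S) (unit_row q i * transpose_mat Q)"
    "fro2 (unit_row q i * transpose_mat Q) = 1"
proof -
  note [simp] = carrier_matD[OF Q(1)] carrier_matD[OF Q(3)]
  have "d i = fip (unit_row q i * (transpose_mat Q * S * Q)) (unit_row q i)"
    using i by (subst fip_unit_row) (auto simp: Q(4), simp add: diagm_def)
  also have "\<dots> = fip (unit_row q i * transpose_mat Q * S * Q) (unit_row q i)"
    by (simp add: mat_assoc)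
  also have "\<dots> = fip (unit_row q i * transpose_mat Q * S) (unit_row q i * transpose_mat Q)"
    by (rule fip_mult_right_adjoint) auto
  finally show "d i = \<dots>" .
  have "fro2 (unit_row q i * transpose_mat Q) = fip (unit_row q i) (unit_row q i * (transpose_mat Q * Q))"
    unfolding fro2_fip by (subst fip_mult_right_adjoint) (auto simp: mat_assoc)
  thus "fro2 (unit_row q i * transpose_mat Q) = 1"
    using i by (simp add: Q(2) mat_mult_one fro2_fip[symmetric] fro2_unit_row)
qed

text \<open>Exports just the eigenvalues \<open>d\<close> of the Gram matrix and hides the
  eigenvectors: the same \<open>d\<close> expresses determinant, trace and the determinants in the
  fiducial density, and each value is the squared length of a unit row combination of
  \<open>Z\<close>.\<close>

lemma gram_spectral:
  assumes Z: "Z \<in> carrier_mat q n"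
  shows "\<exists>d. (\<forall>i<q. \<exists>R \<in> carrier_mat 1 q. fro2 R = 1 \<and> d i = fro2 (R * Z)) \<and>
     det (Z * transpose_mat Z) = (\<Prod>i<q. d i) \<and> fro2 Z = (\<Sum>i<q. d i) \<and>
     (\<forall>c. det (1\<^sub>m q + c \<cdot>\<^sub>m (Z * transpose_mat Z)) = (\<Prod>i<q. 1 + c * d i))"
proof -
  note [simp] = carrier_matD[OF Z]
  define S where "S = Z * transpose_mat Z"
  have S: "S \<in> carrier_mat q q" "transpose_mat S = S" by (auto simp: S_def mat_trans_mult)
  note [simp] = carrier_matD[OF S(1)]
  obtain Q d where Q: "Q \<in> carrier_mat q q" "transpose_mat Q * Q = 1\<^sub>m q" "Q * transpose_mat Q = 1\<^sub>m q"
    "transpose_mat Q * S * Q = diagm q d" using real_spectral[OF S] by blast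
  note [simp] = carrier_matD[OF Q(1)]
  have d: "d i = fro2 (unit_row q i * transpose_mat Q * Z)" if "i < q" for i
  proof -
    have "fro2 (unit_row q i * transpose_mat Q * Z) = fip (unit_row q i * transpose_mat Q) (unit_row q i * transpose_mat Q * Z * transpose_mat Z)"
      unfolding fro2_fip by (subst fip_mult_right_adjoint) auto
    also have "\<dots> = fip (unit_row q i * transpose_mat Q * S) (unit_row q i * transpose_mat Q)"
      unfolding S_def by (subst fip_commute) (auto simp: mat_assoc)
    finally show ?thesis using spectral_entry(1)[OF Q(1,2) S(1) Q(4) that] by simp
  qed
  have tr: "fro2 Z = (\<Sum>i<q. d i)"
  proof -
    define G where "G = transpose_mat Q * Z"
    have [simp]: "dim_row G = q" "dim_col G = n" by (auto simp: G_def)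
    have "G * transpose_mat G = diagm q d"
      unfolding Q(4)[symmetric] S_def G_def by (simp add: mat_trans_mult mat_assoc)
    hence *: "(\<Sum>k<n. G $$ (i,k) * G $$ (i,k)) = d i" if "i < q" for i
      using arg_cong[of _ _ "\<lambda>A. A $$ (i,i)"] that mult_entry[of i G i "transpose_mat G"]
      by (simp add: diagm_def)
    have "fro2 Z = fip Z (Q * transpose_mat Q * Z)" by (simp add: Q(3) mat_one_mult fro2_fip)
    also have "\<dots> = fip (Q * (transpose_mat Q * Z)) Z"
      by (subst fip_commute) (auto simp: mat_assoc)
    also have "\<dots> = fro2 G" unfolding G_def fro2_fip by (rule fip_mult_left_adjoint) auto
    also have "\<dots> = (\<Sum>i<q. d i)" by (simp add: fro2_def power2_eq_square *)
    finally show ?thesis .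
  qed
  have dt: "det S = (\<Prod>i<q. d i)"
    using det_orthogonal_conj[OF Q(1,2) S(1)] by (simp add: Q(4) det_diagm)
  have "det (1\<^sub>m q + c \<cdot>\<^sub>m S) = (\<Prod>i<q. 1 + c * d i)" for c
  proof -
    have "transpose_mat Q * (1\<^sub>m q + c \<cdot>\<^sub>m S) * Q = transpose_mat Q * Q + c \<cdot>\<^sub>m (transpose_mat Q * S * Q)"
      by (simp add: mat_mult_add mat_add_mult mat_mult_one mat_smult_mult mat_mult_smult)
    also have "\<dots> = diagm q (\<lambda>i. 1 + c * d i)"
      unfolding Q by (intro eq_matI) (auto simp: diagm_def)
    finally have "det (1\<^sub>m q + c \<cdot>\<^sub>m S) = det (diagm q (\<lambda>i. 1 + c * d i))"
      using det_orthogonal_conj[OF Q(1,2), of "1\<^sub>m q + c \<cdot>\<^sub>m S"] S(1) by simp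
    thus ?thesis by (simp add: det_diagm)
  qed
  with d tr dt show ?thesis unfolding S_def
    by (intro exI[of _ d] conjI allI impI)
       (auto intro!: bexI[of _ "unit_row q _ * transpose_mat Q"] simp: spectral_entry(2)[OF Q(1,2) S(1) Q(4)])
qed

section \<open>Inverses and inverse square roots\<close>

lemma mat_inv_eqI:
  assumes "A \<in> carrier_mat n n" "B \<in> carrier_mat n n" "A * B = 1\<^sub>m n"
  shows "mat_inv A = B"
proof -
  have BA: "B * A = 1\<^sub>m n" by (rule mat_mult_left_right_inverse[OF assms])
  show ?thesis unfolding mat_inv_def
  proof (rule the_equality)
    show "B \<in> carrier_mat (dim_row A) (dim_row A) \<and> inverts_mat A B \<and> inverts_mat B A"
      using assms BA by (auto simp: inverts_mat_def)
    fix B' assume B': "B' \<in> carrier_mat (dim_row A) (dim_row A) \<and> inverts_mat A B' \<and> inverts_mat B' A"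
    hence "B' = (B * A) * B'" using assms unfolding BA by (subst mat_one_mult) auto
    also have "\<dots> = B * (A * B')" using B' assms by (intro mat_assoc) auto
    also have "\<dots> = B" using B' assms by (simp add: inverts_mat_def mat_mult_one)
    finally show "B' = B" .
  qed
qed

lemma mat_inv_props:
  assumes "A \<in> carrier_mat n n" "det A \<noteq> 0"
  shows "mat_inv A \<in> carrier_mat n n" "A * mat_inv A = 1\<^sub>m n" "mat_inv A * A = 1\<^sub>m n"
proof -
  obtain B where B: "B \<in> carrier_mat n n" "B * A = 1\<^sub>m n" "A * B = 1\<^sub>m n"
    using det_non_zero_imp_unit[OF assms, of "()"] by (auto simp: Units_def ring_mat_def)
  with mat_inv_eqI[OF assms(1) B(1,3)]
  show "mat_inv A \<in> carrier_mat n n" "A * mat_inv A = 1\<^sub>m n" "mat_inv A * A = 1\<^sub>m n" by auto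
qed

lemma quadratic_form_fip:
  assumes "S \<in> carrier_mat q q" "x \<in> carrier_vec q"
  shows "scalar_prod x (S *\<^sub>v x) = fip (mat 1 q (\<lambda>(_,k). vec_index x k) * S) (mat 1 q (\<lambda>(_,k). vec_index x k))"
proof -
  have "scalar_prod x (S *\<^sub>v x) = (\<Sum>i<q. \<Sum>j<q. vec_index x i * S $$ (i,j) * vec_index x j)"
    using assms by (simp add: scalar_prod_def lessThan_atLeast0 sum_distrib_left mult.assoc)
  also have "\<dots> = (\<Sum>j<q. \<Sum>i<q. vec_index x i * S $$ (i,j) * vec_index x j)" by (rule sum.swap)
  also have "\<dots> = fip (mat 1 q (\<lambda>(_,k). vec_index x k) * S) (mat 1 q (\<lambda>(_,k). vec_index x k))"
    using assms by (simp add: fip_def mult_entry sum_distrib_right del: index_mult_mat(1))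
  finally show ?thesis .
qed

text \<open>Replaces vectors by one-row matrices, which makes the adjoint rules for
  \<open>fip\<close> applicable to positive definiteness.\<close>

lemma pos_def_iff:
  assumes S: "S \<in> carrier_mat q q"
  shows "pos_def_mat S \<longleftrightarrow> transpose_mat S = S \<and> (\<forall>R \<in> carrier_mat 1 q. R \<noteq> 0\<^sub>m 1 q \<longrightarrow> 0 < fip (R * S) R)"
proof -
  note [simp] = carrier_matD[OF S]
  have "(\<forall>x\<in>carrier_vec q. x \<noteq> 0\<^sub>v q \<longrightarrow> 0 < scalar_prod x (S *\<^sub>v x)) \<longleftrightarrow>
    (\<forall>R \<in> carrier_mat 1 q. R \<noteq> 0\<^sub>m 1 q \<longrightarrow> 0 < fip (R * S) R)" (is "?l = ?r")
  proof
    assume l: ?l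
    show ?r
    proof (intro ballI impI)
      fix R :: "real mat" assume R: "R \<in> carrier_mat 1 q" "R \<noteq> 0\<^sub>m 1 q"
      define x where "x = vec q (\<lambda>k. R $$ (0,k))"
      have x: "x \<in> carrier_vec q" by (simp add: x_def)
      have Rx: "R = mat 1 q (\<lambda>(_,k). vec_index x k)" using R(1) by (intro eq_matI) (auto simp: x_def)
      have "x \<noteq> 0\<^sub>v q" using R(2) by (subst (asm) Rx) (auto simp: mat_eq_iff)
      with l x have "0 < scalar_prod x (S *\<^sub>v x)" by blast
      thus "0 < fip (R * S) R" unfolding quadratic_form_fip[OF S x] Rx[symmetric] .
    qed
  next
    assume r: ?r
    show ?l
    proof (intro ballI impI)
      fix x :: "real vec" assume x: "x \<in> carrier_vec q" "x \<noteq> 0\<^sub>v q"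
      have "mat 1 q (\<lambda>(_,k). vec_index x k) \<noteq> 0\<^sub>m 1 q"
        using x by (auto simp: mat_eq_iff vec_eq_iff)
      thus "0 < scalar_prod x (S *\<^sub>v x)" using r quadratic_form_fip[OF S x(1)] by simp
    qed
  qed
  thus ?thesis using S by (simp add: pos_def_mat_def)
qed

lemma fip_rows:
  assumes "R \<in> carrier_mat m q" "S \<in> carrier_mat q q"
  shows "fip (R * S) R = (\<Sum>i<m. fip (mat 1 q (\<lambda>(_,k). R $$ (i,k)) * S) (mat 1 q (\<lambda>(_,k). R $$ (i,k))))"
  using assms by (simp add: fip_def mult_entry del: index_mult_mat(1))

text \<open>Sums the one-row statement over the rows of \<open>R\<close>. The uniqueness of the
  square root uses it with a square matrix in place of a vector.\<close>

lemma pos_def_fip: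
  assumes S: "S \<in> carrier_mat q q" "pos_def_mat S" and R: "R \<in> carrier_mat m q"
  shows "0 \<le> fip (R * S) R" "R \<noteq> 0\<^sub>m m q \<Longrightarrow> 0 < fip (R * S) R"
proof -
  note pd = S(2)[unfolded pos_def_iff[OF S(1)], THEN conjunct2, rule_format]
  define r where "r = (\<lambda>i. mat 1 q (\<lambda>(_::nat,k). R $$ (i,k)))"
  have eq: "fip (R * S) R = (\<Sum>i<m. fip (r i * S) (r i))"
    unfolding r_def by (rule fip_rows[OF R S(1)])
  have r: "r i \<in> carrier_mat 1 q" for i by (simp add: r_def)
  have nn: "0 \<le> fip (r i * S) (r i)" for i
    using pd[OF r[of i]] S by (cases "r i = 0\<^sub>m 1 q") (auto simp: fip_def intro!: less_imp_le)
  show "0 \<le> fip (R * S) R" unfolding eq by (intro sum_nonneg nn)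
  assume "R \<noteq> 0\<^sub>m m q"
  then obtain i k where ik: "i < m" "k < q" "R $$ (i,k) \<noteq> 0" using R by (auto simp: mat_eq_iff)
  have "r i \<noteq> 0\<^sub>m 1 q" using ik by (auto simp: r_def mat_eq_iff intro!: exI[of _ k])
  from pd[OF r this] show "0 < fip (R * S) R" unfolding eq using ik nn
    by (intro sum_pos2[of _ i]) auto
qed

lemma pos_def_det:
  assumes "S \<in> carrier_mat q q" "pos_def_mat S"
  shows "det S \<noteq> 0"
proof
  assume "det S = 0"
  then obtain v where "v \<in> carrier_vec q" "v \<noteq> 0\<^sub>v q" "S *\<^sub>v v = 0\<^sub>v q"
    using det_0_iff_vec_prod_zero_field[OF assms(1)] by auto
  thus False using assms by (auto simp: pos_def_mat_def)
qed

lemma inv_sqrt_eqI: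
  assumes S: "S \<in> carrier_mat q q" and R: "R \<in> carrier_mat q q" "pos_def_mat R" "R * R = mat_inv S"
  shows "inv_sqrt S = R"
  unfolding inv_sqrt_def
proof (rule the_equality)
  show "R \<in> carrier_mat (dim_row S) (dim_row S) \<and> pos_def_mat R \<and> R * R = mat_inv S"
    using assms by simp
  fix T assume "T \<in> carrier_mat (dim_row S) (dim_row S) \<and> pos_def_mat T \<and> T * T = mat_inv S"
  hence T: "T \<in> carrier_mat q q" "pos_def_mat T" "T * T = mat_inv S" using S by auto
  note [simp] = carrier_matD[OF R(1)] carrier_matD[OF T(1)]
  have Tt: "transpose_mat T = T" using T by (simp add: pos_def_mat_def)
  define D where "D = R - T"
  have [simp]: "dim_row D = q" "dim_col D = q" by (auto simp: D_def)
  have D: "D \<in> carrier_mat q q" by auto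
  text \<open>Pairing the Sylvester equation \<open>D R + T D = 0\<close> with \<open>D\<close> gives uniqueness without assuming that \<open>R\<close> and \<open>T\<close> commute.\<close>
  have sum0: "D * R + T * D = 0\<^sub>m q q"
  proof -
    have "D * R + T * D = (R * R - T * R) + (T * R - R * R)"
      unfolding D_def R(3) T(3)[symmetric] by (simp add: mat_minus_mult mat_mult_minus R(3)[unfolded T(3)[symmetric], symmetric])
    also have "\<dots> = 0\<^sub>m q q" by (intro eq_matI) auto
    finally show ?thesis .
  qed
  have "0 = fip (D * R + T * D) D" unfolding sum0 by (simp add: fip_def)
  also have "\<dots> = fip (D * R) D + fip (T * D) D" by (rule fip_add_left) auto
  also have "fip (T * D) D = fip (transpose_mat D * T) (transpose_mat D)"
    by (subst fip_transpose[symmetric]) (auto simp: mat_trans_mult Tt)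
  finally have "fip (D * R) D \<le> 0"
    using pos_def_fip(1)[OF T(1,2), of "transpose_mat D" q] D by simp
  hence "D = 0\<^sub>m q q" using pos_def_fip(2)[OF R(1,2) D] by force
  have "T $$ (i,j) = R $$ (i,j)" if "i < q" "j < q" for i j
  proof -
    have "D $$ (i,j) = 0" using \<open>D = 0\<^sub>m q q\<close> that by simp
    thus ?thesis using that by (simp add: D_def)
  qed
  thus "T = R" by (intro eq_matI) auto
qed

lemma pos_def_inv_sqrt:
  assumes S: "S \<in> carrier_mat q q" "pos_def_mat S"
  shows "inv_sqrt S \<in> carrier_mat q q" "transpose_mat (inv_sqrt S) = inv_sqrt S"
    "inv_sqrt S * inv_sqrt S = mat_inv S" "inv_sqrt S * inv_sqrt S * S = 1\<^sub>m q" "S * (inv_sqrt S * inv_sqrt S) = 1\<^sub>m q"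
proof -
  have St: "transpose_mat S = S" using S by (simp add: pos_def_mat_def)
  obtain Q d where Q: "Q \<in> carrier_mat q q" "transpose_mat Q * Q = 1\<^sub>m q" "Q * transpose_mat Q = 1\<^sub>m q"
    "transpose_mat Q * S * Q = diagm q d" using real_spectral[OF S(1) St] by blast
  note [simp] = carrier_matD[OF Q(1)] carrier_matD[OF S(1)]
  have d: "d i > 0" if "i < q" for i
  proof -
    have "unit_row q i * transpose_mat Q \<noteq> 0\<^sub>m 1 q"
      using spectral_entry(2)[OF Q(1,2) S(1) Q(4) that] fro2_0_iff[of "0\<^sub>m 1 q"] by auto
    moreover have "unit_row q i * transpose_mat Q \<in> carrier_mat 1 q" by (intro carrier_matI) auto
    ultimately show ?thesis using pos_def_fip(2)[OF S, of "unit_row q i * transpose_mat Q" 1]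
        spectral_entry(1)[OF Q(1,2) S(1) Q(4) that] by simp
  qed
  define W where "W = Q * diagm q (\<lambda>i. 1 / sqrt (d i)) * transpose_mat Q"
  have W: "W \<in> carrier_mat q q" by (auto simp: W_def)
  have Wt: "transpose_mat W = W" by (simp add: W_def mat_trans_mult mat_assoc)
  have "W * W = Q * (diagm q (\<lambda>i. 1 / sqrt (d i)) * ((transpose_mat Q * Q) * diagm q (\<lambda>i. 1 / sqrt (d i)))) * transpose_mat Q"
    by (simp add: W_def mat_assoc)
  also have "\<dots> = Q * diagm q (\<lambda>i. 1 / sqrt (d i) * (1 / sqrt (d i))) * transpose_mat Q"
    unfolding Q(2) by (simp add: mat_one_mult diagm_mult)
  also have "diagm q (\<lambda>i. 1 / sqrt (d i) * (1 / sqrt (d i))) = diagm q (\<lambda>i. 1 / d i)"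
    using d by (intro diagm_cong) (simp add: less_imp_le)
  finally have WW: "W * W = Q * diagm q (\<lambda>i. 1 / d i) * transpose_mat Q" .
  have Sd: "S = Q * diagm q d * transpose_mat Q"
  proof -
    have "Q * diagm q d * transpose_mat Q = (Q * transpose_mat Q) * S * (Q * transpose_mat Q)"
      unfolding Q(4)[symmetric] by (simp add: mat_assoc)
    thus ?thesis by (simp add: Q(3) mat_one_mult mat_mult_one)
  qed
  have "S * (W * W) = Q * (diagm q d * ((transpose_mat Q * Q) * diagm q (\<lambda>i. 1 / d i))) * transpose_mat Q"
    by (subst Sd) (simp add: WW mat_assoc)
  also have "\<dots> = Q * diagm q (\<lambda>i. d i * (1 / d i)) * transpose_mat Q"
    unfolding Q(2) by (simp add: mat_one_mult diagm_mult)
  also have "diagm q (\<lambda>i. d i * (1 / d i)) = diagm q (\<lambda>_. 1)"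
    using d by (intro diagm_cong) (metis less_irrefl nonzero_mult_div_cancel_left times_divide_eq_right mult.right_neutral)
  also have "Q * diagm q (\<lambda>_. 1) * transpose_mat Q = 1\<^sub>m q" by (simp add: diagm_one[symmetric] mat_mult_one Q(3))
  finally have SWW: "S * (W * W) = 1\<^sub>m q" .
  have WWc: "W * W \<in> carrier_mat q q" using W by simp
  have inv: "W * W = mat_inv S" by (rule mat_inv_eqI[OF S(1) WWc SWW, symmetric])
  have pd: "pos_def_mat W"
    unfolding pos_def_iff[OF W]
  proof (intro conjI ballI impI Wt)
    fix R :: "real mat" assume R: "R \<in> carrier_mat 1 q" "R \<noteq> 0\<^sub>m 1 q"
    note [simp] = carrier_matD[OF R(1)]
    define G where "G = R * Q"
    have [simp]: "dim_row G = 1" "dim_col G = q" by (auto simp: G_def)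
    have "fip (R * W) R = fip (G * diagm q (\<lambda>i. 1 / sqrt (d i)) * transpose_mat Q) R"
      by (simp add: W_def G_def mat_assoc)
    also have "\<dots> = fip (G * diagm q (\<lambda>i. 1 / sqrt (d i))) G"
      by (subst fip_mult_right_adjoint) (auto simp: G_def)
    also have "\<dots> = (\<Sum>j<q. (G $$ (0,j))\<^sup>2 / sqrt (d j))"
      by (simp add: fip_def mult_diagm_entry power2_eq_square del: index_mult_mat(1))
    finally have eq: "fip (R * W) R = (\<Sum>j<q. (G $$ (0,j))\<^sup>2 / sqrt (d j))" .
    have "R = G * transpose_mat Q" by (simp add: G_def mat_assoc Q(3) mat_mult_one)
    hence "G \<noteq> 0\<^sub>m 1 q" using R Q(1) by auto
    then obtain j where "j < q" "G $$ (0,j) \<noteq> 0" by (auto simp: mat_eq_iff)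
    thus "0 < fip (R * W) R" unfolding eq using d
      by (intro sum_pos2[of _ j]) (auto intro!: divide_nonneg_pos simp: less_imp_le)
  qed
  have [simp]: "inv_sqrt S = W" by (rule inv_sqrt_eqI[OF S(1) W pd inv])
  show "inv_sqrt S \<in> carrier_mat q q" "transpose_mat (inv_sqrt S) = inv_sqrt S"
    "inv_sqrt S * inv_sqrt S = mat_inv S" "S * (inv_sqrt S * inv_sqrt S) = 1\<^sub>m q"
    using W Wt inv SWW by simp_all
  show "inv_sqrt S * inv_sqrt S * S = 1\<^sub>m q"
    using mat_mult_left_right_inverse[OF S(1) WWc SWW] by simp
qed

text \<open>A positive definite \<open>A\<close> is itself the positive root of
  \<open>A * transpose_mat A\<close>, and its inverse is again positive definite. Hence the norm in
  (C4) is the Frobenius norm after multiplication by \<open>mat_inv A0\<close>.\<close>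

lemma inv_sqrt_square:
  assumes A: "A \<in> carrier_mat q q" "pos_def_mat A"
  shows "inv_sqrt (A * transpose_mat A) = mat_inv A" "transpose_mat (mat_inv A) = mat_inv A"
proof -
  note inv = mat_inv_props[OF A(1) pos_def_det[OF A]]
  define B where "B = mat_inv A"
  note inv = inv[folded B_def]
  note [simp] = carrier_matD[OF A(1)] carrier_matD[OF inv(1)]
  have At: "transpose_mat A = A" using A by (simp add: pos_def_mat_def)
  have "A * transpose_mat B = 1\<^sub>m q"
    using arg_cong[OF inv(3), of transpose_mat] by (simp add: mat_trans_mult At)
  hence Bt: "transpose_mat B = B"
    using mat_inv_eqI[OF A(1), of "transpose_mat B"] inv by (simp add: B_def)
  have pd: "pos_def_mat B"
    unfolding pos_def_iff[OF inv(1)]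
  proof (intro conjI ballI impI Bt)
    fix R :: "real mat" assume R: "R \<in> carrier_mat 1 q" "R \<noteq> 0\<^sub>m 1 q"
    note [simp] = carrier_matD[OF R(1)]
    \<comment> \<open>Writing \<open>R\<close> as \<open>(R * B) * A\<close> turns the form of
      \<open>B\<close> at \<open>R\<close> into the form of \<open>A\<close> at
      \<open>R * B\<close>.\<close>
    have R1: "R = R * B * A" by (simp add: mat_assoc inv(3) mat_mult_one)
    have "R * B \<noteq> 0\<^sub>m 1 q" using R R1 A(1) by auto
    hence "0 < fip (R * B * A) (R * B)" using R by (intro pos_def_fip[OF A]) (use inv in auto)
    also have "fip (R * B * A) (R * B) = fip (R * B) R"
      unfolding R1[symmetric] by (rule fip_commute) auto
    finally show "0 < fip (R * B) R" .
  qed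
  have "A * transpose_mat A * (B * B) = A * ((A * B) * B)" by (simp add: At mat_assoc)
  also have "\<dots> = 1\<^sub>m q" by (simp add: inv mat_one_mult)
  finally have BB: "B * B = mat_inv (A * transpose_mat A)"
    by (intro mat_inv_eqI[symmetric, where n=q]) auto
  show "inv_sqrt (A * transpose_mat A) = mat_inv A"
    unfolding B_def[symmetric] by (rule inv_sqrt_eqI[OF _ inv(1) pd BB]) auto
  show "transpose_mat (mat_inv A) = mat_inv A" using Bt by (simp add: B_def)
qed

text \<open>Here \<open>W\<close> is an inverse root of the Gram matrix of \<open>A0 * Z\<close>. In
  the order of symmetric matrices the lemma says that inversion is antitone: a lower bound on
  \<open>Z\<close> bounds the inverse from above. With \<open>R = transpose_mat M * (W * W)\<close>,
  both \<open>fro2 (R * A0 * Z)\<close> and the inner product of \<open>Ai * M\<close> with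
  \<open>A0 * transpose_mat R\<close> equal \<open>fro2 (W * M)\<close>; Cauchy-Schwarz and
  \<open>L(2)\<close> at \<open>R * A0\<close> then give the bound.\<close>

lemma fro2_inv_sqrt_le:
  assumes A: "A0 \<in> carrier_mat q q" "transpose_mat A0 = A0" "Ai \<in> carrier_mat q q" "A0 * Ai = 1\<^sub>m q"
    and Z: "Z \<in> carrier_mat q n" and W: "W \<in> carrier_mat q q" "transpose_mat W = W"
    "W * W * ((A0 * Z) * transpose_mat (A0 * Z)) = 1\<^sub>m q"
    and L: "L > 0" "\<And>R. R \<in> carrier_mat k q \<Longrightarrow> L * fro2 R \<le> fro2 (R * Z)"
    and M: "M \<in> carrier_mat q k"
  shows "L * fro2 (W * M) \<le> fro2 (Ai * M)"
proof -
  note [simp] = carrier_matD[OF A(1)] carrier_matD[OF A(3)] carrier_matD[OF Z] carrier_matD[OF W(1)] carrier_matD[OF M]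
  define R where "R = transpose_mat M * (W * W)"
  have [simp]: "dim_row R = k" "dim_col R = q" by (auto simp: R_def)
  have WWt: "transpose_mat (W * W) = W * W" by (simp add: mat_trans_mult W)
  have "fro2 (R * A0 * Z) = fip (R * (A0 * Z)) (R * (A0 * Z))" by (simp add: fro2_fip mat_assoc)
  also have "\<dots> = fip R (transpose_mat M * (W * W * ((A0 * Z) * transpose_mat (A0 * Z))))"
    by (subst fip_mult_right_adjoint) (auto simp: R_def mat_assoc)
  also have "\<dots> = fip (transpose_mat M * W * W) (transpose_mat M)"
    by (simp only: W(3)) (simp add: mat_mult_one R_def mat_assoc)
  also have "\<dots> = fip (transpose_mat M * W) (transpose_mat M * W)"
    by (subst fip_mult_right_adjoint) (auto simp: W(2))
  also have "\<dots> = fro2 (transpose_mat (W * M))" by (simp add: fro2_fip mat_trans_mult W(2))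
  finally have eq: "fro2 (R * A0 * Z) = fro2 (W * M)" by simp
  have le: "L * fro2 (R * A0) \<le> fro2 (W * M)"
    unfolding eq[symmetric] by (rule L(2)) auto
  have "fro2 (W * M) = fip M (W * (W * M))"
    unfolding fro2_fip by (subst fip_mult_left_adjoint) (auto simp: W(2))
  also have "\<dots> = fip (transpose_mat R) M"
    by (subst fip_commute) (auto simp: R_def mat_trans_mult WWt mat_assoc W(2))
  also have "\<dots> = fip (transpose_mat R) (A0 * (Ai * M))"
    by (simp add: mat_assoc[symmetric] A(4) mat_one_mult)
  also have "\<dots> = fip (A0 * (Ai * M)) (transpose_mat R)" by (rule fip_commute) auto
  also have "\<dots> = fip (Ai * M) (A0 * transpose_mat R)"
    by (subst fip_mult_left_adjoint) (auto simp: A(2))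
  also have "\<dots> \<le> sqrt (fro2 (Ai * M)) * sqrt (fro2 (A0 * transpose_mat R))"
    by (rule fip_le) auto
  also have "A0 * transpose_mat R = transpose_mat (R * A0)" by (simp add: mat_trans_mult A(2))
  finally have "fro2 (W * M) \<le> sqrt (fro2 (Ai * M)) * sqrt (fro2 (R * A0))" by simp
  hence "(fro2 (W * M))\<^sup>2 \<le> fro2 (Ai * M) * fro2 (R * A0)"
    using power_mono[of "fro2 (W * M)" _ 2] by (fastforce simp: power_mult_distrib)
  hence "L * (fro2 (W * M) * fro2 (W * M)) \<le> fro2 (Ai * M) * (L * fro2 (R * A0))"
    using L(1) by (simp add: power2_eq_square algebra_simps)
  also have "\<dots> \<le> fro2 (Ai * M) * fro2 (W * M)" by (intro mult_left_mono le) auto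
  finally have *: "(L * fro2 (W * M)) * fro2 (W * M) \<le> fro2 (Ai * M) * fro2 (W * M)" by (simp add: mult.assoc)
  show ?thesis
  proof (cases "fro2 (W * M) = 0")
    case False
    hence "fro2 (W * M) > 0" using fro2_nonneg[of "W * M"] by linarith
    with * show ?thesis by simp
  qed simp
qed

text \<open>The opposite comparison, by the same argument with the roles of the two Gram matrices
  exchanged.\<close>

lemma fro2_inv_sqrt_ge:
  assumes A: "A0 \<in> carrier_mat q q" "transpose_mat A0 = A0" "Ai \<in> carrier_mat q q" "Ai * A0 = 1\<^sub>m q" "transpose_mat Ai = Ai"
    and Z: "Z \<in> carrier_mat q n" and W: "W \<in> carrier_mat q q" "transpose_mat W = W"
    "(A0 * Z) * transpose_mat (A0 * Z) * (W * W) = 1\<^sub>m q"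
    and U: "U > 0" "\<And>R. R \<in> carrier_mat k q \<Longrightarrow> fro2 (R * Z) \<le> U * fro2 R"
    and M: "M \<in> carrier_mat q k"
  shows "fro2 (Ai * M) \<le> U * fro2 (W * M)"
proof -
  note [simp] = carrier_matD[OF A(1)] carrier_matD[OF A(3)] carrier_matD[OF Z] carrier_matD[OF W(1)] carrier_matD[OF M]
  define R where "R = transpose_mat M * (Ai * Ai)"
  define S where "S = (A0 * Z) * transpose_mat (A0 * Z)"
  have [simp]: "dim_row R = k" "dim_col R = q" by (auto simp: R_def)
  have [simp]: "dim_row S = q" "dim_col S = q" by (auto simp: S_def)
  have St: "transpose_mat S = S" by (simp add: S_def mat_trans_mult mat_assoc)
  have RA: "R * A0 = transpose_mat (Ai * M)"
    by (simp add: R_def mat_assoc A(4) mat_mult_one mat_trans_mult A(5))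
  \<comment> \<open>\<open>S * W\<close> is a square root of \<open>S\<close>, so
    \<open>fro2 T\<close> is the quadratic form of \<open>S\<close> at \<open>R\<close>, and
    \<open>R\<close> is recovered as \<open>T * W\<close>.\<close>
  define T where "T = R * S * W"
  have [simp]: "dim_row T = k" "dim_col T = q" by (auto simp: T_def)
  have SWW: "S * (W * W) = 1\<^sub>m q" using W(3) by (simp add: S_def)
  have TW: "T * W = R" by (simp add: T_def mat_assoc SWW mat_mult_one)
  have "fro2 T = fip (R * S * W) T" by (simp add: fro2_fip T_def)
  also have "\<dots> = fip (R * S) (T * transpose_mat W)" by (rule fip_mult_right_adjoint) auto
  also have "\<dots> = fip (R * S) R" by (simp add: W(2) TW)
  also have "\<dots> = fip (R * (A0 * Z) * transpose_mat (A0 * Z)) R" by (simp add: S_def mat_assoc)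
  also have "\<dots> = fro2 (R * (A0 * Z))" unfolding fro2_fip by (subst fip_mult_right_adjoint) auto
  also have "\<dots> = fro2 (transpose_mat (Ai * M) * Z)" by (simp add: RA[symmetric] mat_assoc)
  also have "\<dots> \<le> U * fro2 (transpose_mat (Ai * M))" by (rule U(2)) auto
  finally have T: "fro2 T \<le> U * fro2 (Ai * M)" by simp
  have "fro2 (Ai * M) = fip M (Ai * (Ai * M))"
    unfolding fro2_fip by (subst fip_mult_left_adjoint) (auto simp: A(5))
  also have "\<dots> = fip (transpose_mat R) M"
    by (subst fip_commute) (auto simp: R_def mat_trans_mult A(5) mat_assoc)
  also have "transpose_mat R = W * transpose_mat T" by (simp add: TW[symmetric] mat_trans_mult W(2))
  also have "fip (W * transpose_mat T) M = fip (transpose_mat T) (W * M)"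
    by (subst fip_mult_left_adjoint) (auto simp: W(2))
  also have "\<dots> \<le> sqrt (fro2 (transpose_mat T)) * sqrt (fro2 (W * M))" by (rule fip_le) auto
  finally have "(fro2 (Ai * M))\<^sup>2 \<le> fro2 T * fro2 (W * M)"
    using power_mono[of "fro2 (Ai * M)" _ 2] by (fastforce simp: power_mult_distrib)
  also have "\<dots> \<le> U * fro2 (Ai * M) * fro2 (W * M)" using T by (intro mult_right_mono) auto
  finally have *: "fro2 (Ai * M) * fro2 (Ai * M) \<le> (U * fro2 (W * M)) * fro2 (Ai * M)"
    by (simp add: power2_eq_square algebra_simps)
  show ?thesis
  proof (cases "fro2 (Ai * M) = 0")
    case False
    hence "fro2 (Ai * M) > 0" using fro2_nonneg[of "Ai * M"] by linarith
    with * show ?thesis by simp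
  next
    case True thus ?thesis using U(1) by simp
  qed
qed

section \<open>Projections onto row spaces\<close>

lemma fro2_proj_eq:
  assumes "P \<in> carrier_mat n n" "transpose_mat P = P" "P * P = P" "dim_col A = n"
  shows "fro2 (A * P) = fip A (A * P)"
  using assms unfolding fro2_fip by (subst fip_mult_right_adjoint) (auto simp: mat_assoc)

lemma fro2_pythagoras:
  assumes "P \<in> carrier_mat n n" "transpose_mat P = P" "P * P = P" "dim_col A = n"
  shows "fro2 A = fro2 (A * P) + fro2 (A * (1\<^sub>m n - P))"
proof -
  note [simp] = carrier_matD[OF assms(1)] assms(4)
  have "fro2 (A * (1\<^sub>m n - P)) = fro2 (A - A * P)"
    by (simp add: mat_mult_minus mat_mult_one)
  also have "\<dots> = fro2 A - 2 * fip A (A * P) + fro2 (A * P)"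
    using fip_commute[of A "A * P"] unfolding fro2_fip by (simp add: fip_minus_left fip_minus_right)
  finally show ?thesis using fro2_proj_eq[OF assms] by simp
qed

lemma fro2_proj_le:
  assumes "P \<in> carrier_mat n n" "transpose_mat P = P" "P * P = P" "dim_col A = n"
  shows "fro2 (A * P) \<le> fro2 A"
  using fro2_pythagoras[OF assms] by simp

lemma proj_complement:
  fixes P :: "real mat"
  assumes "P \<in> carrier_mat n n" "transpose_mat P = P" "P * P = P"
  shows "1\<^sub>m n - P \<in> carrier_mat n n" "transpose_mat (1\<^sub>m n - P) = 1\<^sub>m n - P"
    "(1\<^sub>m n - P) * (1\<^sub>m n - P) = 1\<^sub>m n - P"
proof -
  note [simp] = carrier_matD[OF assms(1)]
  show "1\<^sub>m n - P \<in> carrier_mat n n" using assms by auto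
  show "transpose_mat (1\<^sub>m n - P) = 1\<^sub>m n - P"
    using mat_trans_minus[of "1\<^sub>m n" P] by (simp add: assms(2))
  have "(1\<^sub>m n - P) * (1\<^sub>m n - P) = (1\<^sub>m n - P) - (P - P)"
    by (simp add: mat_minus_mult mat_mult_minus mat_mult_one mat_one_mult assms(3))
  also have "\<dots> = 1\<^sub>m n - P" by (intro eq_matI) auto
  finally show "(1\<^sub>m n - P) * (1\<^sub>m n - P) = 1\<^sub>m n - P" .
qed

text \<open>Gives the orthogonal projection onto the row space also when the rows of
  \<open>Z\<close> are dependent. The factor keeps the full width \<open>k\<close>, with zero
  columns for the kernel of the Gram matrix; it is then still a contraction, which is all that the
  Gaussian tail bound asks for.\<close>

lemma row_space_factor:
  assumes Z: "Z \<in> carrier_mat k n"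
  shows "\<exists>Q \<in> carrier_mat n k. Z * (Q * transpose_mat Q) = Z \<and>
    (Q * transpose_mat Q) * (Q * transpose_mat Q) = Q * transpose_mat Q \<and>
    (\<forall>m. \<forall>g \<in> carrier_mat m k. fro2 (g * transpose_mat Q) \<le> fro2 g)"
proof -
  note [simp] = carrier_matD[OF Z]
  define S where "S = Z * transpose_mat Z"
  have S: "S \<in> carrier_mat k k" "transpose_mat S = S" by (auto simp: S_def mat_trans_mult)
  note [simp] = carrier_matD[OF S(1)]
  obtain Q0 d where Q: "Q0 \<in> carrier_mat k k" "transpose_mat Q0 * Q0 = 1\<^sub>m k" "Q0 * transpose_mat Q0 = 1\<^sub>m k"
    "transpose_mat Q0 * S * Q0 = diagm k d" using real_spectral[OF S] by blast
  note [simp] = carrier_matD[OF Q(1)]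
  have d: "d i \<ge> 0" if "i < k" for i
  proof -
    have "d i = fip (unit_row k i * transpose_mat Q0 * S) (unit_row k i * transpose_mat Q0)"
      by (rule spectral_entry(1)[OF Q(1,2) S(1) Q(4) that])
    also have "\<dots> = fip (unit_row k i * transpose_mat Q0 * Z * transpose_mat Z) (unit_row k i * transpose_mat Q0)"
      by (simp add: S_def mat_assoc)
    also have "\<dots> = fro2 (unit_row k i * transpose_mat Q0 * Z)"
      unfolding fro2_fip by (subst fip_mult_right_adjoint) auto
    finally show ?thesis by simp
  qed
  \<comment> \<open>Inverse root of the Gram matrix on its range and 0 on its kernel.\<close>
  define e where "e = (\<lambda>i. if d i = 0 then 0 else 1 / sqrt (d i))"
  define J where "J = diagm k (\<lambda>i. if d i = 0 then 0 else 1)"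
  define Q where "Q = transpose_mat Z * Q0 * diagm k e"
  have [simp]: "dim_row Q = n" "dim_col Q = k" "dim_row J = k" "dim_col J = k" by (auto simp: Q_def J_def)
  have DE: "diagm k d * diagm k e * diagm k e = J"
    unfolding J_def diagm_mult using d by (intro diagm_cong) (auto simp: e_def)
  have QQ: "transpose_mat Q * Q = J"
  proof -
    have "transpose_mat Q * Q = diagm k e * (transpose_mat Q0 * S * Q0) * diagm k e"
      by (simp add: Q_def S_def mat_trans_mult mat_assoc)
    also have "\<dots> = J" unfolding Q(4) DE[symmetric] by (simp add: diagm_mult ac_simps)
    finally show ?thesis .
  qed
  have QJ: "Q * J = Q"
  proof -
    have "diagm k e * J = diagm k e" unfolding J_def diagm_mult by (intro diagm_cong) (auto simp: e_def)
    thus ?thesis by (simp add: Q_def mat_assoc)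
  qed
  have idem: "(Q * transpose_mat Q) * (Q * transpose_mat Q) = Q * transpose_mat Q"
  proof -
    have "(Q * transpose_mat Q) * (Q * transpose_mat Q) = (Q * (transpose_mat Q * Q)) * transpose_mat Q"
      by (simp add: mat_assoc)
    thus ?thesis by (simp add: QQ QJ)
  qed
  \<comment> \<open>\<open>N\<close> projects onto the kernel of \<open>S\<close>. From
    \<open>N * S = 0\<close> follows \<open>fro2 (N * Z) = 0\<close>, so removing \<open>N\<close>
    does not change \<open>Z\<close>.\<close>
  define N where "N = Q0 * (1\<^sub>m k - J) * transpose_mat Q0"
  have [simp]: "dim_row N = k" "dim_col N = k" by (auto simp: N_def)
  have "N * S = 0\<^sub>m k k"
  proof -
    have "N * S = N * S * (Q0 * transpose_mat Q0)" by (simp add: Q(3) mat_mult_one)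
    also have "\<dots> = Q0 * (1\<^sub>m k - J) * (transpose_mat Q0 * S * Q0) * transpose_mat Q0"
      by (simp add: N_def mat_assoc)
    also have "\<dots> = Q0 * ((1\<^sub>m k - J) * diagm k d) * transpose_mat Q0"
      unfolding Q(4) by (simp add: mat_assoc)
    also have "(1\<^sub>m k - J) * diagm k d = 0\<^sub>m k k"
      by (intro eq_matI) (auto simp: mult_diagm_entry J_def diagm_def[of k "\<lambda>i. if d i = 0 then 0 else 1"] simp del: index_mult_mat(1))
    finally show ?thesis using Q(1) by simp
  qed
  have "fro2 (N * Z) = fip N (N * Z * transpose_mat Z)"
    unfolding fro2_fip by (subst fip_mult_right_adjoint) auto
  also have "N * Z * transpose_mat Z = 0\<^sub>m k k" using \<open>N * S = 0\<^sub>m k k\<close> by (simp add: S_def mat_assoc)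
  finally have "fro2 (N * Z) = 0" by (simp add: fip_def)
  hence NZ: "N * Z = 0\<^sub>m k n" by (subst (asm) fro2_0_iff) simp
  have "Z * (Q * transpose_mat Q) = S * Q0 * diagm k e * diagm k e * transpose_mat Q0 * Z"
    by (simp add: Q_def S_def mat_trans_mult mat_assoc)
  also have "\<dots> = Q0 * (transpose_mat Q0 * S * Q0) * diagm k e * diagm k e * transpose_mat Q0 * Z"
  proof -
    have "Q0 * (transpose_mat Q0 * S * Q0) = (Q0 * transpose_mat Q0) * (S * Q0)" by (simp add: mat_assoc)
    thus ?thesis by (simp add: Q(3) mat_one_mult)
  qed
  also have "\<dots> = Q0 * (diagm k d * diagm k e * diagm k e) * transpose_mat Q0 * Z"
    unfolding Q(4) by (simp add: mat_assoc)
  also have "\<dots> = Q0 * J * transpose_mat Q0 * Z" by (simp add: DE)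
  also have "Q0 * J * transpose_mat Q0 = 1\<^sub>m k - N"
    by (simp add: N_def mat_minus_mult mat_mult_minus mat_mult_one Q(3))
       (intro eq_matI, auto)
  also have "(1\<^sub>m k - N) * Z = Z - N * Z" by (simp add: mat_minus_mult mat_one_mult)
  also have "\<dots> = Z" unfolding NZ by (intro eq_matI) auto
  finally have ZQ: "Z * (Q * transpose_mat Q) = Z" .
  have "fro2 (g * transpose_mat Q) \<le> fro2 g" if "g \<in> carrier_mat m k" for g m
  proof -
    note [simp] = carrier_matD[OF that]
    have "fro2 (g * transpose_mat Q) = fip (g * (transpose_mat Q * Q)) g"
      unfolding fro2_fip by (subst fip_mult_right_adjoint, simp_all, subst fip_commute, auto simp: mat_assoc)
    also have "\<dots> = fip (g * J) g" by (simp add: QQ)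
    also have "\<dots> \<le> fro2 g"
      unfolding fro2_def fip_def J_def
      by (auto intro!: sum_mono simp: mult_diagm_entry power2_eq_square simp del: index_mult_mat(1))
    finally show ?thesis .
  qed
  hence "\<forall>m. \<forall>g \<in> carrier_mat m k. fro2 (g * transpose_mat Q) \<le> fro2 g" by blast
  moreover have "Q \<in> carrier_mat n k" by (intro carrier_matI) auto
  ultimately show ?thesis using ZQ idem by blast
qed

lemma eq_mat_on_vecs:
  fixes A B :: "real mat"
  assumes "A \<in> carrier_mat m n" "B \<in> carrier_mat m n" "\<And>v. v \<in> carrier_vec n \<Longrightarrow> A *\<^sub>v v = B *\<^sub>v v"
  shows "A = B"
proof (intro eq_matI)
  fix i j assume ij: "i < dim_row B" "j < dim_col B"
  have "vec_index (A *\<^sub>v unit_vec n j) i = vec_index (B *\<^sub>v unit_vec n j) i" using assms(3) by simp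
  thus "A $$ (i,j) = B $$ (i,j)" using assms(1,2) ij by simp
qed (use assms in auto)

text \<open>For uniqueness, two idempotents with the same range satisfy \<open>P * T = T\<close> and
  \<open>T * P = P\<close>. By symmetry of both, transposing the second equation gives
  \<open>P * T = P\<close>, hence \<open>T = P\<close>.\<close>

lemma row_proj_full_rank:
  assumes Z: "Z \<in> carrier_mat m n" and d: "det (Z * transpose_mat Z) \<noteq> 0"
  shows "row_proj Z = transpose_mat Z * mat_inv (Z * transpose_mat Z) * Z"
    "row_proj Z \<in> carrier_mat n n" "transpose_mat (row_proj Z) = row_proj Z"
    "row_proj Z * row_proj Z = row_proj Z" "Z * row_proj Z = Z"
proof -
  note [simp] = carrier_matD[OF Z]
  define G where "G = mat_inv (Z * transpose_mat Z)"
  have "Z * transpose_mat Z \<in> carrier_mat m m" using Z by simp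
  note G = mat_inv_props[OF this d, folded G_def]
  note [simp] = carrier_matD[OF G(1)]
  have Gt: "transpose_mat G = G"
  proof -
    have "Z * transpose_mat Z * transpose_mat G = 1\<^sub>m m"
      using arg_cong[OF G(3), of transpose_mat] by (simp add: mat_trans_mult)
    thus ?thesis unfolding G_def using mat_inv_eqI[of "Z * transpose_mat Z" m "transpose_mat G"] G Z
      by (simp add: G_def)
  qed
  define P where "P = transpose_mat Z * G * Z"
  have P: "P \<in> carrier_mat n n" by (auto simp: P_def)
  note [simp] = carrier_matD[OF P]
  have Pt: "transpose_mat P = P" by (simp add: P_def mat_trans_mult Gt mat_assoc)
  have ZP: "Z * P = Z"
  proof -
    have "Z * P = ((Z * transpose_mat Z) * G) * Z" by (simp add: P_def mat_assoc)
    thus ?thesis by (simp add: G mat_one_mult)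
  qed
  have PP: "P * P = P"
  proof -
    have "P * P = transpose_mat Z * G * (Z * P)" by (subst (1) P_def) (simp add: mat_assoc)
    also have "\<dots> = P" by (simp add: ZP) (simp add: P_def)
    finally show ?thesis .
  qed
  have PZ: "P * transpose_mat Z = transpose_mat Z"
    using arg_cong[OF ZP, of transpose_mat] by (simp add: mat_trans_mult Pt)
  have rangeP: "(\<exists>w \<in> carrier_vec n. v = P *\<^sub>v w) \<longleftrightarrow> (\<exists>u \<in> carrier_vec m. v = transpose_mat Z *\<^sub>v u)"
    if v: "v \<in> carrier_vec n" for v
  proof
    assume "\<exists>w \<in> carrier_vec n. v = P *\<^sub>v w"
    then obtain w where w: "w \<in> carrier_vec n" "v = P *\<^sub>v w" by blast
    have "v = transpose_mat Z *\<^sub>v ((G * Z) *\<^sub>v w)"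
      using w Z G(1) unfolding P_def by (subst assoc_mult_mat_vec[symmetric, of _ n m _ n]) (auto simp: mat_assoc)
    moreover have "(G * Z) *\<^sub>v w \<in> carrier_vec m" using Z G(1) w by (intro mult_mat_vec_carrier[of _ m n]) auto
    ultimately show "\<exists>u \<in> carrier_vec m. v = transpose_mat Z *\<^sub>v u" by blast
  next
    assume "\<exists>u \<in> carrier_vec m. v = transpose_mat Z *\<^sub>v u"
    then obtain u where u: "u \<in> carrier_vec m" "v = transpose_mat Z *\<^sub>v u" by blast
    have "P *\<^sub>v v = (P * transpose_mat Z) *\<^sub>v u" using u Z P by (simp add: assoc_mult_mat_vec[of _ n n _ m])
    hence "v = P *\<^sub>v v" using u by (simp add: PZ)
    thus "\<exists>w \<in> carrier_vec n. v = P *\<^sub>v w" using v by blast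
  qed
  have "row_proj Z = P" unfolding row_proj_def
  proof (rule the_equality)
    show "P \<in> carrier_mat (dim_col Z) (dim_col Z) \<and> transpose_mat P = P \<and> P * P = P \<and>
     (\<forall>v \<in> carrier_vec (dim_col Z).
        (\<exists>w \<in> carrier_vec (dim_col Z). v = P *\<^sub>v w) \<longleftrightarrow>
        (\<exists>u \<in> carrier_vec (dim_row Z). v = transpose_mat Z *\<^sub>v u))"
      using P Pt PP rangeP by simp
    fix T assume "T \<in> carrier_mat (dim_col Z) (dim_col Z) \<and> transpose_mat T = T \<and> T * T = T \<and>
     (\<forall>v \<in> carrier_vec (dim_col Z).
        (\<exists>w \<in> carrier_vec (dim_col Z). v = T *\<^sub>v w) \<longleftrightarrow>
        (\<exists>u \<in> carrier_vec (dim_row Z). v = transpose_mat Z *\<^sub>v u))"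
    hence T: "T \<in> carrier_mat n n" "transpose_mat T = T" "T * T = T"
      "\<And>v. v \<in> carrier_vec n \<Longrightarrow> (\<exists>w \<in> carrier_vec n. v = T *\<^sub>v w) \<longleftrightarrow>
        (\<exists>u \<in> carrier_vec m. v = transpose_mat Z *\<^sub>v u)" by auto
    note [simp] = carrier_matD[OF T(1)]
    have fix_range: "A * B = B" if A: "A \<in> carrier_mat n n" "A * A = A" and B: "B \<in> carrier_mat n n"
      and sub: "\<And>v. v \<in> carrier_vec n \<Longrightarrow> \<exists>w \<in> carrier_vec n. B *\<^sub>v v = A *\<^sub>v w" for A B :: "real mat"
    proof (rule eq_mat_on_vecs)
      fix v :: "real vec" assume v: "v \<in> carrier_vec n"
      then obtain w where w: "w \<in> carrier_vec n" "B *\<^sub>v v = A *\<^sub>v w" using sub by blast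
      have "(A * B) *\<^sub>v v = A *\<^sub>v (A *\<^sub>v w)" using A(1) B v by (simp add: assoc_mult_mat_vec[of _ n n _ n] w(2))
      also have "\<dots> = B *\<^sub>v v" using A w by (simp add: assoc_mult_mat_vec[of _ n n _ n, symmetric])
      finally show "(A * B) *\<^sub>v v = B *\<^sub>v v" .
    qed (use A B in auto)
    have "P * T = T"
    proof (rule fix_range[OF P PP T(1)])
      fix v :: "real vec" assume "v \<in> carrier_vec n"
      moreover have "T *\<^sub>v v \<in> carrier_vec n" using T(1) calculation by simp
      ultimately show "\<exists>w \<in> carrier_vec n. T *\<^sub>v v = P *\<^sub>v w" using T(4)[of "T *\<^sub>v v"] rangeP[of "T *\<^sub>v v"] by blast
    qed
    moreover have "T * P = P"
    proof (rule fix_range[OF T(1,3) P])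
      fix v :: "real vec" assume "v \<in> carrier_vec n"
      moreover have "P *\<^sub>v v \<in> carrier_vec n" using P calculation by simp
      ultimately show "\<exists>w \<in> carrier_vec n. P *\<^sub>v v = T *\<^sub>v w" using T(4)[of "P *\<^sub>v v"] rangeP[of "P *\<^sub>v v"] by blast
    qed
    ultimately show "T = P"
      using mat_trans_mult[of T P] by (simp add: Pt T(2))
  qed
  thus "row_proj Z = transpose_mat Z * mat_inv (Z * transpose_mat Z) * Z"
    "row_proj Z \<in> carrier_mat n n" "transpose_mat (row_proj Z) = row_proj Z"
    "row_proj Z * row_proj Z = row_proj Z" "Z * row_proj Z = Z"
    using P Pt PP ZP by (simp_all add: P_def G_def)
qed

text \<open>Translates the rank test in \<open>r_eps\<close> into a nonsingular Gram matrix. If the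
  columns span, a kernel vector of the Gram matrix is orthogonal to all columns and therefore to
  itself; conversely \<open>mat_inv\<close> of the Gram matrix produces a preimage of every
  vector.\<close>

lemma rank_full_iff:
  fixes Z :: "real mat"
  assumes Z: "Z \<in> carrier_mat m n"
  shows "vec_space.rank m Z = m \<longleftrightarrow> det (Z * transpose_mat Z) \<noteq> 0"
proof -
  interpret V: vec_space "TYPE(real)" m .
  note [simp] = carrier_matD[OF Z]
  have S: "Z * transpose_mat Z \<in> carrier_mat m m" using Z by simp
  have cZ: "set (cols Z) \<subseteq> carrier_vec m" using cols_dim[of Z] by simp
  have range: "V.span (set (cols Z)) = {y\<in>carrier_vec m. \<exists>x\<in>carrier_vec n. Z *\<^sub>v x = y}"
    using V.col_space_eq[OF Z] by (simp add: V.col_space_def)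
  show ?thesis
  proof
    assume r: "V.rank Z = m"
    obtain B where B: "finite B" "maximal B (\<lambda>T. T \<subseteq> set (cols Z) \<and> V.lin_indpt T)"
      using maximal_exists_superset[of "set (cols Z)" "\<lambda>T. T \<subseteq> set (cols Z) \<and> V.lin_indpt T" "{}"]
        V.lin_dep_def by (metis (no_types, lifting) List.finite_set V.finite_lin_indpt2 empty_iff empty_subsetI finite.emptyI)
    have cardB: "card B = m" using V.rank_card_indpt[OF Z B(2)] r by simp
    have B': "B \<subseteq> set (cols Z)" "V.lin_indpt B" using B(2) by (auto simp: maximal_def)
    have "V.basis B"
      using B B' cZ cardB by (intro V.dim_li_is_basis) (auto simp: V.dim_is_n)
    hence "V.span B = carrier_vec m" by (simp add: V.basis_def )
    hence full: "carrier_vec m \<subseteq> V.span (set (cols Z))" using V.span_is_monotone[OF B'(1)] by simp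
    show "det (Z * transpose_mat Z) \<noteq> 0"
    proof
      assume "det (Z * transpose_mat Z) = 0"
      then obtain x where x: "x \<in> carrier_vec m" "x \<noteq> 0\<^sub>v m" "(Z * transpose_mat Z) *\<^sub>v x = 0\<^sub>v m"
        using det_0_iff_vec_prod_zero_field[OF S] by auto
      define y where "y = transpose_mat Z *\<^sub>v x"
      have y: "y \<in> carrier_vec n" using x Z by (simp add: y_def)
      have "Z *\<^sub>v y = 0\<^sub>v m" using x assoc_mult_mat_vec[of Z m n "transpose_mat Z" m x] Z by (simp add: y_def)
      hence "scalar_prod y y = 0"
        using transpose_vec_mult_scalar[OF Z y x(1)] x(1) by (simp add: y_def[symmetric])
      hence y0: "y = 0\<^sub>v n" using y
        by (intro eq_vecI) (auto simp: scalar_prod_def sum_nonneg_eq_0_iff)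
      obtain w where w: "w \<in> carrier_vec n" "Z *\<^sub>v w = x" using full range x(1) by blast
      have "scalar_prod x x = scalar_prod y w"
        using transpose_vec_mult_scalar[OF Z w(1) x(1)] by (simp add: w(2) y_def)
      also have "\<dots> = 0" using w(1) by (simp add: y0)
      finally have "x = 0\<^sub>v m" using x(1)
        by (intro eq_vecI) (auto simp: scalar_prod_def sum_nonneg_eq_0_iff)
      thus False using x(2) by simp
    qed
  next
    assume d: "det (Z * transpose_mat Z) \<noteq> 0"
    define G where "G = mat_inv (Z * transpose_mat Z)"
    note G = mat_inv_props[OF S d, folded G_def]
    have "V.span (set (cols Z)) = carrier_vec m"
    proof (intro equalityI subsetI)
      fix y :: "real vec" assume y: "y \<in> carrier_vec m"
      define x where "x = transpose_mat Z *\<^sub>v (G *\<^sub>v y)"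
      have "Z *\<^sub>v x = (Z * transpose_mat Z * G) *\<^sub>v y"
        unfolding x_def using Z G(1) y
        by (simp add: assoc_mult_mat_vec[of _ m m _ m] assoc_mult_mat_vec[of _ m n _ m])
      hence "Z *\<^sub>v x = y" using y by (simp add: G(2))
      moreover have "x \<in> carrier_vec n" using Z G(1) y by (simp add: x_def)
      ultimately show "y \<in> V.span (set (cols Z))" unfolding range using y by blast
    qed (auto simp: range)
    hence "V.span_vs (set (cols Z)) = V.V" by (simp add: module_vec_def)
    thus "V.rank Z = m" unfolding V.rank_def using V.dim_is_n by simp
  qed
qed

section \<open>Submatrices of rows\<close>

lemma rows_sub_dims:
  assumes "X \<in> carrier_mat p n" "M \<subseteq> {0..<p}"
  shows "rows_sub X M \<in> carrier_mat (card M) n" "dim_row (rows_sub X M) = card M" "dim_col (rows_sub X M) = n"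
proof -
  have "{i. i < p \<and> i \<in> M} = M" "{j. j < n \<and> j \<in> {0..<n}} = {0..<n}" using assms(2) by auto
  thus "dim_row (rows_sub X M) = card M" "dim_col (rows_sub X M) = n"
    using assms(1) by (auto simp: rows_sub_def dim_submatrix)
  thus "rows_sub X M \<in> carrier_mat (card M) n" by auto
qed

lemma pick_in:
  assumes "finite M" "i < card M"
  shows "pick M i \<in> M"
  using assms pick_in_set_le by blast

lemma pick_surj:
  assumes "finite M" "j \<in> M"
  obtains i where "i < card M" "pick M i = j"
proof -
  have "pick M (card {a\<in>M. a < j}) = j" by (rule pick_card_in_set[OF assms(2)])
  moreover have "card {a\<in>M. a < j} < card M"
    using assms by (intro psubset_card_mono) auto
  ultimately show ?thesis using that by blast
qed

lemma pick_atLeast0: "j < n \<Longrightarrow> pick {0..<n} j = j"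
proof -
  assume "j < n"
  hence "{a\<in>{0..<n}. a < j} = {..<j}" by auto
  hence "card {a\<in>{0..<n}. a < j} = j" by simp
  thus ?thesis using pick_card_in_set[of j "{0..<n}"] \<open>j < n\<close> by simp
qed

lemma rows_sub_entry:
  assumes "X \<in> carrier_mat p n" "M \<subseteq> {0..<p}" "i < card M" "j < n"
  shows "rows_sub X M $$ (i,j) = X $$ (pick M i, j)"
proof -
  have "{i. i < p \<and> i \<in> M} = M" "{j. j < n \<and> j \<in> {0..<n}} = {0..<n}" using assms(2) by auto
  thus ?thesis using assms unfolding rows_sub_def by (subst submatrix_index) (auto simp: pick_atLeast0)
qed

lemma rows_sub_select:
  assumes "X \<in> carrier_mat p n" "M \<subseteq> {0..<p}"
  shows "rows_sub (1\<^sub>m p) M * X = rows_sub X M"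
proof -
  have fin: "finite M" using assms(2) finite_subset by blast
  note d1 = rows_sub_dims[OF one_carrier_mat assms(2)] and d2 = rows_sub_dims[OF assms]
  show ?thesis
  proof (intro eq_matI)
    fix i j assume "i < dim_row (rows_sub X M)" "j < dim_col (rows_sub X M)"
    hence ij: "i < card M" "j < n" using d2 by auto
    have pk: "pick M i < p" using pick_in[OF fin ij(1)] assms(2) by auto
    have "(rows_sub (1\<^sub>m p) M * X) $$ (i,j) = (\<Sum>k<p. rows_sub (1\<^sub>m p) M $$ (i,k) * X $$ (k,j))"
      using ij d1 assms by (subst mult_entry) auto
    also have "\<dots> = (\<Sum>k<p. (if k = pick M i then X $$ (k,j) else 0))"
      using ij pk by (intro sum.cong refl) (simp add: rows_sub_entry[OF one_carrier_mat assms(2)])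
    also have "\<dots> = rows_sub X M $$ (i,j)" using pk ij by (simp add: rows_sub_entry[OF assms])
    finally show "(rows_sub (1\<^sub>m p) M * X) $$ (i,j) = rows_sub X M $$ (i,j)" .
  qed (use d1 d2 assms in auto)
qed

text \<open>Source of the competitors in the sparse minimisation: multiplying by the rows of the
  identity indexed by \<open>M\<close> spreads the columns of \<open>E\<close> over the positions in
  \<open>M\<close>.\<close>

lemma embed_columns:
  assumes X: "X \<in> carrier_mat p n" and M: "M \<subseteq> {0..<p}" and E: "E \<in> carrier_mat q (card M)"
  shows "\<exists>B \<in> carrier_mat q p. nz_cols B \<le> card M \<and> B * X = E * rows_sub X M"
proof (intro bexI conjI)
  have fin: "finite M" using M finite_subset by blast
  note d1 = rows_sub_dims[OF one_carrier_mat M]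
  let ?B = "E * rows_sub (1\<^sub>m p) M"
  show B: "?B \<in> carrier_mat q p" using E d1(1) by auto
  show "?B * X = E * rows_sub X M"
    using E d1 X by (simp add: mat_assoc rows_sub_select[OF X M])
  have "{j. j < dim_col ?B \<and> (\<exists>i < dim_row ?B. ?B $$ (i, j) \<noteq> 0)} \<subseteq> M"
  proof
    fix j assume "j \<in> {j. j < dim_col ?B \<and> (\<exists>i < dim_row ?B. ?B $$ (i, j) \<noteq> 0)}"
    then obtain i where ij: "j < p" "i < q" "?B $$ (i,j) \<noteq> 0" using E d1 by auto
    show "j \<in> M"
    proof (rule ccontr)
      assume "j \<notin> M"
      have "?B $$ (i,j) = (\<Sum>k<card M. E $$ (i,k) * rows_sub (1\<^sub>m p) M $$ (k,j))"
        using E d1 ij by (subst mult_entry) auto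
      also have "\<dots> = 0"
      proof (intro sum.neutral ballI)
        fix k assume k: "k \<in> {..<card M}"
        hence "pick M k \<in> M" by (intro pick_in[OF fin]) simp
        hence "pick M k \<noteq> j" "pick M k < p" using \<open>j \<notin> M\<close> M by auto
        thus "E $$ (i,k) * rows_sub (1\<^sub>m p) M $$ (k,j) = 0"
          using k ij by (simp add: rows_sub_entry[OF one_carrier_mat M])
      qed
      finally show False using ij by simp
    qed
  qed
  thus "nz_cols ?B \<le> card M" unfolding nz_cols_def by (intro card_mono[OF fin])
qed

text \<open>Lets one projection for a large index set act as the identity on the rows of every
  smaller one, in particular on those of \<open>M\<close> and \<open>Mo\<close> when
  \<open>K\<close> is their union.\<close>

lemma rows_sub_mult_eqI:
  assumes X: "X \<in> carrier_mat p n" and M: "M \<subseteq> {0..<p}" and KM: "M \<subseteq> K" and K: "K \<subseteq> {0..<p}"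
    and P: "P \<in> carrier_mat n n" and eq: "rows_sub X K * P = rows_sub X K"
  shows "rows_sub X M * P = rows_sub X M"
proof (intro eq_matI)
  have fin: "finite M" "finite K" using M K finite_subset by blast+
  note d = rows_sub_dims[OF X M] rows_sub_dims[OF X K]
  fix i j assume "i < dim_row (rows_sub X M)" "j < dim_col (rows_sub X M)"
  hence ij: "i < card M" "j < n" using d by auto
  obtain k where k: "k < card K" "pick K k = pick M i"
    using pick_surj[OF fin(2)] pick_in[OF fin(1) ij(1)] KM by blast
  have "(rows_sub X M * P) $$ (i,j) = (\<Sum>l<n. X $$ (pick M i, l) * P $$ (l,j))"
    using ij d P by (subst mult_entry) (auto simp: rows_sub_entry[OF X M])
  also have "\<dots> = (rows_sub X K * P) $$ (k,j)"
    using ij k d P by (subst mult_entry) (auto simp: rows_sub_entry[OF X K])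
  also have "\<dots> = rows_sub X M $$ (i,j)"
    using ij k by (simp add: eq rows_sub_entry[OF X K] rows_sub_entry[OF X M])
  finally show "(rows_sub X M * P) $$ (i,j) = rows_sub X M $$ (i,j)" .
qed (use rows_sub_dims[OF X M] P in auto)

text \<open>A vanishing combination of the rows in \<open>L\<close> is, padded with zeros, one of
  the rows in \<open>M\<close>. This gives the closed form of the projection for
  \<open>M - {j}\<close> and for the subsets of \<open>Mo\<close>.\<close>

lemma full_rank_subset:
  assumes X: "X \<in> carrier_mat p n" and M: "M \<subseteq> {0..<p}" and sub: "L \<subseteq> M"
    and d: "det (rows_sub X M * transpose_mat (rows_sub X M)) \<noteq> 0"
  shows "det (rows_sub X L * transpose_mat (rows_sub X L)) \<noteq> 0"
proof
  let ?ZL = "rows_sub X L" and ?ZM = "rows_sub X M"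
  have L: "L \<subseteq> {0..<p}" using sub M by blast
  have fin: "finite M" "finite L" using M L finite_subset by blast+
  note dl = rows_sub_dims[OF X L] and dm = rows_sub_dims[OF X M]
  note [simp] = dl(2,3) dm(2,3)
  assume "det (?ZL * transpose_mat ?ZL) = 0"
  hence "\<not> pos_def_mat (?ZL * transpose_mat ?ZL)"
    using pos_def_det[of "?ZL * transpose_mat ?ZL" "card L"] dl(1) by auto
  moreover have "?ZL * transpose_mat ?ZL \<in> carrier_mat (card L) (card L)" by auto
  ultimately obtain R where R: "R \<in> carrier_mat 1 (card L)" "R \<noteq> 0\<^sub>m 1 (card L)"
    "\<not> 0 < fip (R * (?ZL * transpose_mat ?ZL)) R"
    by (auto simp: pos_def_iff mat_trans_mult)
  note [simp] = carrier_matD[OF R(1)]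
  have "fip (R * (?ZL * transpose_mat ?ZL)) R = fip (R * ?ZL * transpose_mat ?ZL) R" by (simp add: mat_assoc)
  also have "\<dots> = fro2 (R * ?ZL)" unfolding fro2_fip by (subst fip_mult_right_adjoint) auto
  finally have "fro2 (R * ?ZL) = 0" using R(3) fro2_nonneg[of "R * ?ZL"] by linarith
  hence RZ: "R * ?ZL = 0\<^sub>m 1 n" by (subst (asm) fro2_0_iff) simp
  text \<open>\<open>R\<close> as coefficients on the larger index set.\<close>
  define T where "T = mat 1 (card M) (\<lambda>(_,k). \<Sum>i<card L. if pick L i = pick M k then R $$ (0,i) else 0)"
  have [simp]: "dim_row T = 1" "dim_col T = card M" by (auto simp: T_def)
  have pick_inj: "inj_on (pick N) {..<card N}" for N
  proof (rule linorder_inj_onI)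
    fix a b assume "a < b" "a \<in> {..<card N}" "b \<in> {..<card N}"
    thus "pick N a \<noteq> pick N b" using pick_mono_le[of b N a] by simp
  qed auto
  have inj: "inj_on (pick M) {..<card M}" by (rule pick_inj)
  have img: "pick M ` {..<card M} = M"
  proof (intro equalityI subsetI)
    fix x assume "x \<in> M"
    then obtain i where "i < card M" "pick M i = x" by (rule pick_surj[OF fin(1)])
    thus "x \<in> pick M ` {..<card M}" by blast
  qed (use pick_in[OF fin(1)] in auto)
  have injL: "inj_on (pick L) {..<card L}" by (rule pick_inj)
  have "T * ?ZM = R * ?ZL"
  proof (intro eq_matI)
    fix i j assume "i < dim_row (R * ?ZL)" "j < dim_col (R * ?ZL)"
    hence ij: "i = 0" "j < n" by auto
    have "(T * ?ZM) $$ (i,j) = (\<Sum>k<card M. (\<Sum>l<card L. if pick L l = pick M k then R $$ (0,l) else 0) * X $$ (pick M k, j))"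
      using ij by (subst mult_entry) (auto simp: T_def rows_sub_entry[OF X M])
    also have "\<dots> = (\<Sum>k\<in>M. (\<Sum>l<card L. if pick L l = k then R $$ (0,l) else 0) * X $$ (k, j))"
      by (subst (2) img[symmetric], subst sum.reindex[OF inj]) simp
    also have "\<dots> = (\<Sum>k\<in>M. \<Sum>l<card L. if pick L l = k then R $$ (0,l) * X $$ (k,j) else 0)"
      by (simp add: sum_distrib_right if_distrib[where f="\<lambda>x. x * _"] cong: if_cong)
    also have "\<dots> = (\<Sum>l<card L. \<Sum>k\<in>M. if pick L l = k then R $$ (0,l) * X $$ (k,j) else 0)" by (rule sum.swap)
    also have "\<dots> = (\<Sum>l<card L. R $$ (0,l) * X $$ (pick L l,j))"
      using fin pick_in[OF fin(2)] sub by (intro sum.cong refl) (auto simp: subset_iff)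
    also have "\<dots> = (R * ?ZL) $$ (i,j)"
      using ij by (subst mult_entry) (auto simp: rows_sub_entry[OF X L])
    finally show "(T * ?ZM) $$ (i,j) = (R * ?ZL) $$ (i,j)" .
  qed auto
  hence "T * (?ZM * transpose_mat ?ZM) = 0\<^sub>m 1 n * transpose_mat ?ZM" by (simp add: RZ mat_assoc[symmetric])
  also have "\<dots> = 0\<^sub>m 1 (card M)" by (intro eq_matI) auto
  finally have TS: "T * (?ZM * transpose_mat ?ZM) = 0\<^sub>m 1 (card M)" .
  have "?ZM * transpose_mat ?ZM \<in> carrier_mat (card M) (card M)" by auto
  note G = mat_inv_props[OF this d]
  have "T = T * (?ZM * transpose_mat ?ZM) * mat_inv (?ZM * transpose_mat ?ZM)"
    using G carrier_matD[OF G(1)] by (subst mat_assoc) (auto simp: mat_mult_one)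
  also have "\<dots> = 0\<^sub>m 1 (card M)" unfolding TS using G(1) by auto
  finally have T0: "T = 0\<^sub>m 1 (card M)" .
  have "R $$ (0,l) = 0" if l: "l < card L" for l
  proof -
    have "pick L l \<in> M" using pick_in[OF fin(2) l] sub by blast
    then obtain k where k: "k < card M" "pick M k = pick L l" using pick_surj[OF fin(1)] by blast
    have eq: "pick L i = pick M k \<longleftrightarrow> i = l" if "i < card L" for i
      using injL that l k by (auto simp: inj_on_def)
    have "0 = T $$ (0,k)" using k by (simp add: T0)
    also have "\<dots> = (\<Sum>i<card L. if i = l then R $$ (0,i) else 0)"
      using k(1) eq by (auto simp: T_def intro!: sum.cong)
    also have "\<dots> = R $$ (0,l)" using l by simp
    finally show ?thesis by simp
  qed
  hence "R = 0\<^sub>m 1 (card L)" by (intro eq_matI) auto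
  thus False using R(2) by simp
qed

section \<open>Measurable matrix-valued maps\<close>

text \<open>Measurability of a random matrix is taken entry by entry. The dimensions are fixed in
  advance so that all index sums have deterministic ranges.\<close>

definition mmat :: "'b measure \<Rightarrow> nat \<Rightarrow> nat \<Rightarrow> ('b \<Rightarrow> real mat) \<Rightarrow> bool" where
  "mmat N r c F \<longleftrightarrow> (\<forall>x. F x \<in> carrier_mat r c) \<and> (\<forall>i<r. \<forall>j<c. (\<lambda>x. F x $$ (i,j)) \<in> borel_measurable N)"

lemma mmat_dims: "mmat N r c F \<Longrightarrow> dim_row (F x) = r" "mmat N r c F \<Longrightarrow> dim_col (F x) = c"
  "mmat N r c F \<Longrightarrow> F x \<in> carrier_mat r c"
  by (auto simp: mmat_def)

lemma mmat_const: "A \<in> carrier_mat r c \<Longrightarrow> mmat N r c (\<lambda>_. A)"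
  by (simp add: mmat_def)

lemma mmat_coords:
  assumes "{0..<r} \<times> {0..<c} \<subseteq> I" "sets N = sets borel"
  shows "mmat (PiM I (\<lambda>_. N)) r c (\<lambda>b. mat r c b)"
proof -
  have "(\<lambda>x. x ij) \<in> borel_measurable (PiM I (\<lambda>_. N))" if "ij \<in> I" for ij
    using measurable_component_singleton[OF that, of "\<lambda>_. N"] assms(2)
    by (simp cong: measurable_cong_sets)
  moreover have "(i,j) \<in> I" if "i < r" "j < c" for i j using assms(1) that by auto
  ultimately show ?thesis by (simp add: mmat_def)
qed

lemma mmat_mult:
  assumes "mmat N r k F" "mmat N k c G"
  shows "mmat N r c (\<lambda>x. F x * G x)"
  unfolding mmat_def
proof (intro conjI allI impI)
  fix x show "F x * G x \<in> carrier_mat r c"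
    using mult_carrier_mat[OF mmat_dims(3)[OF assms(1)] mmat_dims(3)[OF assms(2)]] .
next
  fix i j assume ij: "i < r" "j < c"
  have "(\<lambda>x. (F x * G x) $$ (i,j)) = (\<lambda>x. \<Sum>l<k. F x $$ (i,l) * G x $$ (l,j))"
    using ij mmat_dims[OF assms(1)] mmat_dims[OF assms(2)] by (intro ext) (subst mult_entry, auto)
  thus "(\<lambda>x. (F x * G x) $$ (i,j)) \<in> borel_measurable N"
    using assms ij by (auto simp: mmat_def intro!: borel_measurable_sum borel_measurable_times)
qed

lemma mmatI:
  assumes "\<And>x. dim_row (F x) = r" "\<And>x. dim_col (F x) = c"
    "\<And>i j. i < r \<Longrightarrow> j < c \<Longrightarrow> (\<lambda>x. F x $$ (i,j)) \<in> borel_measurable N"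
  shows "mmat N r c F"
  unfolding mmat_def by (intro conjI allI impI carrier_matI assms)

lemma mmat_entry: "mmat N r c F \<Longrightarrow> i < r \<Longrightarrow> j < c \<Longrightarrow> (\<lambda>x. F x $$ (i,j)) \<in> borel_measurable N"
  by (simp add: mmat_def)

lemma mmat_add:
  assumes "mmat N r c F" "mmat N r c G" shows "mmat N r c (\<lambda>x. F x + G x)"
  using mmat_dims(1,2)[OF assms(1)] mmat_dims(1,2)[OF assms(2)] mmat_entry[OF assms(1)] mmat_entry[OF assms(2)]
  by (intro mmatI) simp_all

lemma mmat_minus:
  assumes "mmat N r c F" "mmat N r c G" shows "mmat N r c (\<lambda>x. F x - G x)"
  using mmat_dims(1,2)[OF assms(1)] mmat_dims(1,2)[OF assms(2)] mmat_entry[OF assms(1)] mmat_entry[OF assms(2)]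
  by (intro mmatI) simp_all

lemma mmat_transpose:
  assumes "mmat N r c F" shows "mmat N c r (\<lambda>x. transpose_mat (F x))"
  using mmat_dims(1,2)[OF assms(1)] mmat_entry[OF assms(1)] by (intro mmatI) simp_all

lemma mmat_fro2:
  assumes "mmat N r c F"
  shows "(\<lambda>x. fro2 (F x)) \<in> borel_measurable N"
  using assms by (auto simp: fro2_def mmat_dims[OF assms] mmat_def intro!: borel_measurable_sum borel_measurable_power)

lemma mmat_det:
  assumes "mmat N r r F"
  shows "(\<lambda>x. det (F x)) \<in> borel_measurable N"
proof -
  have "(\<lambda>x. F x $$ (i, p i)) \<in> borel_measurable N" if "p permutes {0..<r}" "i \<in> {0..<r}" for i p
    using assms permutes_in_image[OF that(1), of i] that(2) by (auto simp: mmat_def)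
  thus ?thesis
    by (subst det_def'[OF mmat_dims(3)[OF assms]])
       (auto intro!: borel_measurable_sum borel_measurable_times borel_measurable_prod)
qed

section \<open>Affine changes of variables for product Lebesgue measure\<close>

lemma product_sigma_finite_lborel: "product_sigma_finite (\<lambda>_. lborel :: real measure)"
  by (simp add: product_sigma_finite_def sigma_finite_lborel)

text \<open>The one-dimensional substitution is applied coordinate by coordinate. Two cases are used
  later: the shift that centres the density and the contraction by 1/2 towards its centre.\<close>

lemma nn_integral_PiM_lborel_affine:
  fixes a :: "'i \<Rightarrow> real" and c :: real
  assumes "finite I" "c > 0" "f \<in> borel_measurable (PiM I (\<lambda>_. lborel))"
  shows "(\<integral>\<^sup>+b. f b \<partial>PiM I (\<lambda>_. lborel)) =
    ennreal (c ^ card I) * (\<integral>\<^sup>+b. f (\<lambda>i\<in>I. a i + c * b i) \<partial>PiM I (\<lambda>_. lborel))"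
  using assms(1,3)
proof (induction I arbitrary: f)
  case empty
  have "(\<lambda>i\<in>{}. a i + c * b i) = b" if "b \<in> space (PiM {} (\<lambda>_. lborel :: real measure))" for b
    using that by (auto simp: space_PiM)
  hence "(\<integral>\<^sup>+b. f (\<lambda>i\<in>{}. a i + c * b i) \<partial>PiM {} (\<lambda>_. lborel)) = (\<integral>\<^sup>+b. f b \<partial>PiM {} (\<lambda>_. lborel))"
    by (intro nn_integral_cong) metis
  thus ?case by (simp only: card.empty power_0 ennreal_1 mult_1)
next
  case (insert i I)
  interpret product_sigma_finite "\<lambda>_::'i. lborel :: real measure" by (rule product_sigma_finite_lborel)
  note insert.prems[measurable]
  have aff[measurable]: "(\<lambda>b. (\<lambda>j\<in>J. a j + c * b j)) \<in> measurable (PiM J (\<lambda>_. lborel)) (PiM J (\<lambda>_. lborel))" for J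
    by measurable
  let ?L = "\<lambda>I. PiM I (\<lambda>_. lborel :: real measure)"
  define g where "g = (\<lambda>x. \<integral>\<^sup>+y. f (x(i := a i + c * y)) \<partial>lborel)"
  have [measurable]: "(\<lambda>(x,y). x(i := a i + c * y)) \<in> measurable (?L I \<Otimes>\<^sub>M lborel) (?L (insert i I))"
    unfolding split_beta by (rule measurable_fun_upd[of _ I]) auto
  have [measurable]: "g \<in> borel_measurable (?L I)"
    unfolding g_def by measurable
  have "(\<integral>\<^sup>+b. f b \<partial>?L (insert i I)) = (\<integral>\<^sup>+x. \<integral>\<^sup>+y. f (x(i := y)) \<partial>lborel \<partial>?L I)"
    by (rule product_nn_integral_insert[OF insert.hyps insert.prems])
  also have "\<dots> = (\<integral>\<^sup>+x. ennreal c * g x \<partial>?L I)"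
  proof (intro nn_integral_cong)
    fix x assume x: "x \<in> space (?L I)"
    have [measurable]: "(\<lambda>y. f (x(i := y))) \<in> borel_measurable lborel"
      using measurable_component_update[OF x insert.hyps(2)] by measurable
    show "(\<integral>\<^sup>+y. f (x(i := y)) \<partial>lborel) = ennreal c * g x"
      unfolding g_def using assms(2)
      by (subst nn_integral_real_affine[where c=c and t="a i"]) auto
  qed
  also have "\<dots> = ennreal c * (\<integral>\<^sup>+x. g x \<partial>?L I)" by (rule nn_integral_cmult) measurable
  also have "(\<integral>\<^sup>+x. g x \<partial>?L I) = ennreal (c ^ card I) * (\<integral>\<^sup>+x. g (\<lambda>j\<in>I. a j + c * x j) \<partial>?L I)"
    by (rule insert.IH) measurable
  also have "(\<integral>\<^sup>+x. g (\<lambda>j\<in>I. a j + c * x j) \<partial>?L I) =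
     (\<integral>\<^sup>+x. \<integral>\<^sup>+y. f (\<lambda>j\<in>insert i I. a j + c * (x(i := y)) j) \<partial>lborel \<partial>?L I)"
    unfolding g_def using insert.hyps(2)
    by (intro nn_integral_cong arg_cong[of _ _ f]) (auto simp: fun_eq_iff)
  also have "\<dots> = (\<integral>\<^sup>+b. f (\<lambda>j\<in>insert i I. a j + c * b j) \<partial>?L (insert i I))"
    by (rule product_nn_integral_insert[OF insert.hyps, symmetric]) measurable
  finally show ?case
    using insert.hyps assms(2) by (simp add: mult.assoc ennreal_mult del: insert_iff restrict_apply cong del: restrict_cong)
qed

section \<open>The generalized fiducial density\<close>

lemma one_plus_sum_le_prod:
  fixes d :: "'i \<Rightarrow> real"
  assumes "\<And>i. i \<in> I \<Longrightarrow> d i \<ge> 0"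
  shows "1 + (\<Sum>i\<in>I. d i) \<le> (\<Prod>i\<in>I. 1 + d i)"
  using assms
proof (induction I rule: infinite_finite_induct)
  case (insert i I)
  have "1 + (\<Sum>j\<in>insert i I. d j) \<le> (1 + d i) * (1 + (\<Sum>j\<in>I. d j))"
    using insert by (simp add: algebra_simps sum_nonneg)
  also have "\<dots> \<le> (1 + d i) * (\<Prod>j\<in>I. 1 + d j)" using insert by (intro mult_left_mono) auto
  finally show ?case using insert by simp
qed auto

lemma one_smult_real_mat: "(1::real) \<cdot>\<^sub>m A = A"
  by (intro eq_matI) auto

lemma det_one_add_gram_ge:
  assumes "T \<in> carrier_mat q k" "c \<ge> 0"
  shows "det (1\<^sub>m q + c \<cdot>\<^sub>m (T * transpose_mat T)) \<ge> 1 + c * fro2 T"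
proof -
  obtain d where d: "\<forall>i<q. \<exists>R \<in> carrier_mat 1 q. fro2 R = 1 \<and> d i = fro2 (R * T)" "fro2 T = (\<Sum>i<q. d i)"
    "\<And>c. det (1\<^sub>m q + c \<cdot>\<^sub>m (T * transpose_mat T)) = (\<Prod>i<q. 1 + c * d i)"
    using gram_spectral[OF assms(1)] by blast
  have "d i \<ge> 0" if "i < q" for i using d(1) that by force
  hence "1 + (\<Sum>i<q. c * d i) \<le> (\<Prod>i<q. 1 + c * d i)"
    using assms(2) by (intro one_plus_sum_le_prod) auto
  thus ?thesis by (simp add: d sum_distrib_left)
qed

text \<open>Some eigenvalue of the Gram matrix is at least \<open>\<delta> / q\<close>, since
  together they sum to at least \<open>\<delta>\<close>. The quotient of \<open>1 + d\<close> by
  \<open>1 + d / 4\<close> increases with \<open>d\<close>, so this eigenvalue alone yields the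
  factor, and the others contribute at least 1. The 1/4 is the square of the contraction by
  1/2.\<close>

lemma det_one_add_gram_scaling:
  assumes T: "T \<in> carrier_mat q k" and q: "q \<ge> 1" and \<delta>: "\<delta> > 0" "fro2 T \<ge> \<delta>"
  shows "det (1\<^sub>m q + T * transpose_mat T) \<ge>
    (1 + \<delta> / q) / (1 + \<delta> / (4 * q)) * det (1\<^sub>m q + (1/4) \<cdot>\<^sub>m (T * transpose_mat T))"
proof -
  obtain d where d: "\<forall>i<q. \<exists>R \<in> carrier_mat 1 q. fro2 R = 1 \<and> d i = fro2 (R * T)" "fro2 T = (\<Sum>i<q. d i)"
    "\<And>c. det (1\<^sub>m q + c \<cdot>\<^sub>m (T * transpose_mat T)) = (\<Prod>i<q. 1 + c * d i)"
    using gram_spectral[OF T] by blast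
  have d0: "d i \<ge> 0" if "i < q" for i using d(1) that by force
  obtain i where i: "i < q" "d i \<ge> \<delta> / q"
  proof (rule ccontr)
    assume "\<not> thesis"
    hence "\<forall>i\<in>{..<q}. d i < \<delta> / q" using that by force
    hence "(\<Sum>i<q. d i) < (\<Sum>i<q. \<delta> / q)" using q by (intro sum_strict_mono) (auto simp: lessThan_empty_iff)
    also have "\<dots> = \<delta>" using q by simp
    finally show False using d(2) \<delta> by simp
  qed
  let ?r = "(1 + \<delta> / q) / (1 + \<delta> / (4 * q))"
  have "?r * (1 + 1/4 * d i) \<le> 1 + d i"
  proof -
    have "(1 + \<delta> / q) * (1 + 1/4 * d i) \<le> (1 + d i) * (1 + \<delta> / (4 * q))"
    proof -
      have "(1 + d i) * (1 + \<delta> / (4 * q)) = (1 + \<delta> / q) * (1 + 1/4 * d i) + 3/4 * (d i - \<delta> / q)"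
        using q by (simp add: field_simps)
      thus ?thesis using i(2) by (simp only: le_add_same_cancel1) simp
    qed
    moreover have "1 + \<delta> / (4 * q) > 0" using \<delta> by (simp add: add_pos_nonneg)
    ultimately show ?thesis by (simp add: pos_divide_le_eq)
  qed
  moreover have "(\<Prod>j\<in>{..<q}-{i}. 1 + 1/4 * d j) \<le> (\<Prod>j\<in>{..<q}-{i}. 1 + d j)"
  proof (intro prod_mono)
    fix j assume "j \<in> {..<q} - {i}"
    thus "0 \<le> 1 + 1/4 * d j \<and> 1 + 1/4 * d j \<le> 1 + d j" using d0[of j] by simp
  qed
  moreover have "0 \<le> (\<Prod>j\<in>{..<q}-{i}. 1 + 1/4 * d j)"
  proof (intro prod_nonneg)
    fix j assume "j \<in> {..<q} - {i}"
    thus "0 \<le> 1 + 1/4 * d j" using d0[of j] by simp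
  qed
  ultimately have "(?r * (1 + 1/4 * d i)) * (\<Prod>j\<in>{..<q}-{i}. 1 + 1/4 * d j) \<le> (1 + d i) * (\<Prod>j\<in>{..<q}-{i}. 1 + d j)"
    using d0[OF i(1)] by (intro mult_mono) auto
  moreover have "(\<Prod>j<q. 1 + 1/4 * d j) = (1 + 1/4 * d i) * (\<Prod>j\<in>{..<q}-{i}. 1 + 1/4 * d j)"
    using i by (subst prod.remove[of _ i]) auto
  moreover have "(\<Prod>j<q. 1 + d j) = (1 + d i) * (\<Prod>j\<in>{..<q}-{i}. 1 + d j)"
    using i by (subst prod.remove[of _ i]) auto
  ultimately show ?thesis using d(3)[of 1] d(3)[of "1/4"] by (simp add: mult.assoc one_smult_real_mat)
qed

text \<open>Sylvester's identity for an invertible factor; it moves one inverse root across so that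
  the matrix inside the density becomes symmetric.\<close>

lemma det_one_add_swap:
  assumes A: "A \<in> carrier_mat q q" and B: "B \<in> carrier_mat q q" and d: "det A \<noteq> (0::real)"
  shows "det (1\<^sub>m q + A * B) = det (1\<^sub>m q + B * A)"
proof -
  note [simp] = carrier_matD[OF A] carrier_matD[OF B]
  have "A * (1\<^sub>m q + B * A) = (1\<^sub>m q + A * B) * A"
    by (simp add: mat_mult_add mat_add_mult mat_mult_one mat_one_mult mat_assoc)
  moreover have "det (A * (1\<^sub>m q + B * A)) = det A * det (1\<^sub>m q + B * A)"
    using A B by (intro det_mult) auto
  moreover have "det ((1\<^sub>m q + A * B) * A) = det (1\<^sub>m q + A * B) * det A"
    using A B by (intro det_mult) auto
  ultimately show ?thesis using d by simp
qed

text \<open>Splits the inverse of \<open>Sigma_hat\<close> as \<open>W * W\<close>. The density then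
  depends on \<open>B\<close> only through the whitened deviation \<open>T\<close>, the quantity in
  which tails are measured.\<close>

lemma gf_dens_eq:
  assumes Y: "Y \<in> carrier_mat q n" and X: "X \<in> carrier_mat p n" and M: "M \<subseteq> {0..<p}"
    and W: "W \<in> carrier_mat q q" "transpose_mat W = W" "W * W = mat_inv (Sigma_hat Y X M)" "det W \<noteq> 0"
    and B: "B \<in> carrier_mat q (card M)" and Bh: "B_hat Y X M \<in> carrier_mat q (card M)"
  defines "T \<equiv> W * (B - B_hat Y X M) * rows_sub X M"
  shows "gf_dens Y X M B = det (1\<^sub>m q + T * transpose_mat T) powr (- (real n / 2))"
proof -
  note d = rows_sub_dims[OF X M]
  define D where "D = B - B_hat Y X M"
  have D: "D \<in> carrier_mat q (card M)" unfolding D_def by (rule minus_carrier_mat[OF Bh])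
  note [simp] = carrier_matD[OF D] d(2,3) carrier_matD[OF W(1)] carrier_matD[OF X] carrier_matD[OF Y]
  define E where "E = W * D * (rows_sub X M * transpose_mat (rows_sub X M)) * transpose_mat D"
  have E: "E \<in> carrier_mat q q" by (intro carrier_matI) (auto simp: E_def)
  have "gf_dens Y X M B = det (1\<^sub>m q + W * E) powr (- (real n / 2))"
    unfolding gf_dens_def W(3)[symmetric] D_def[symmetric] by (simp add: E_def mat_assoc)
  also have "det (1\<^sub>m q + W * E) = det (1\<^sub>m q + E * W)" by (rule det_one_add_swap[OF W(1) E W(4)])
  also have "E * W = T * transpose_mat T"
    by (simp add: E_def T_def D_def[symmetric] mat_trans_mult W(2) mat_assoc)
  finally show ?thesis .
qed

text \<open>An expectation under a density known up to its constant. \<open>K\<close> bounds the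
  mass of the tail event \<open>P\<close>, and \<open>f\<close> stands for the h-function, which is
  constant off the tail.\<close>

lemma integral_ratio_bounds:
  fixes f g :: "'a \<Rightarrow> real"
  assumes g: "integrable N g" "\<And>x. g x \<ge> 0" "(\<integral>x. g x \<partial>N) > 0"
    and f: "f \<in> borel_measurable N" "\<And>x. 0 \<le> f x" "\<And>x. f x \<le> 1"
    and S: "{x \<in> space N. P x} \<in> sets N"
    and tail: "(\<integral>\<^sup>+x. ennreal (g x) * indicator {x \<in> space N. P x} x \<partial>N) \<le> ennreal K * (\<integral>\<^sup>+x. ennreal (g x) \<partial>N)" and K: "K \<ge> 0"
  shows "0 \<le> (\<integral>x. f x * g x \<partial>N) / (\<integral>x. g x \<partial>N)"
    and "(\<And>x. x \<in> space N \<Longrightarrow> \<not> P x \<Longrightarrow> f x = 0) \<Longrightarrow> (\<integral>x. f x * g x \<partial>N) / (\<integral>x. g x \<partial>N) \<le> K"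
    and "(\<And>x. x \<in> space N \<Longrightarrow> \<not> P x \<Longrightarrow> f x = 1) \<Longrightarrow> (\<integral>x. f x * g x \<partial>N) / (\<integral>x. g x \<partial>N) \<ge> 1 - K"
    and "(\<integral>x. f x * g x \<partial>N) / (\<integral>x. g x \<partial>N) \<le> 1"
proof -
  let ?S = "{x \<in> space N. P x}"
  note [measurable] = S f(1)
  have [measurable]: "g \<in> borel_measurable N" using g(1) by auto
  have int: "integrable N (\<lambda>x. h x * g x)" if "h \<in> borel_measurable N" "\<And>x. 0 \<le> h x" "\<And>x. h x \<le> 1" for h
    using that g(2) by (intro Bochner_Integration.integrable_bound[OF g(1)])
      (auto simp: abs_mult intro!: AE_I2 mult_left_le_one_le)
  have intS: "integrable N (\<lambda>x. indicator ?S x * g x)" by (rule int) (auto simp: indicator_def)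
  have "ennreal (\<integral>x. indicator ?S x * g x \<partial>N) = (\<integral>\<^sup>+x. ennreal (indicator ?S x * g x) \<partial>N)"
    using g(2) by (intro nn_integral_eq_integral[symmetric] intS) auto
  also have "\<dots> = (\<integral>\<^sup>+x. ennreal (g x) * indicator ?S x \<partial>N)"
    by (intro nn_integral_cong) (auto simp: indicator_def)
  also have "\<dots> \<le> ennreal K * (\<integral>\<^sup>+x. ennreal (g x) \<partial>N)" by (rule tail)
  also have "(\<integral>\<^sup>+x. ennreal (g x) \<partial>N) = ennreal (\<integral>x. g x \<partial>N)"
    using g(2) by (intro nn_integral_eq_integral g(1)) auto
  also have "ennreal K * \<dots> = ennreal (K * (\<integral>x. g x \<partial>N))" using K g(3) by (simp add: ennreal_mult)
  finally have tl: "(\<integral>x. indicator ?S x * g x \<partial>N) \<le> K * (\<integral>x. g x \<partial>N)"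
    using K g(3) by (subst (asm) ennreal_le_iff) auto
  have intf: "integrable N (\<lambda>x. f x * g x)" by (rule int) (use f in auto)
  show "0 \<le> (\<integral>x. f x * g x \<partial>N) / (\<integral>x. g x \<partial>N)"
    using f g by (intro divide_nonneg_pos Bochner_Integration.integral_nonneg) auto
  show "(\<integral>x. f x * g x \<partial>N) / (\<integral>x. g x \<partial>N) \<le> 1"
  proof -
    have "(\<integral>x. f x * g x \<partial>N) \<le> (\<integral>x. g x \<partial>N)"
      using f g by (intro integral_mono intf g(1) mult_left_le_one_le) auto
    thus ?thesis using g(3) by simp
  qed
  show "(\<integral>x. f x * g x \<partial>N) / (\<integral>x. g x \<partial>N) \<le> K" if z: "\<And>x. x \<in> space N \<Longrightarrow> \<not> P x \<Longrightarrow> f x = 0"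
  proof -
    have "(\<integral>x. f x * g x \<partial>N) \<le> (\<integral>x. indicator ?S x * g x \<partial>N)"
      using f g(2) z by (intro integral_mono intf intS mult_right_mono) (auto simp: indicator_def)
    thus ?thesis using g(3) tl by (simp add: pos_divide_le_eq)
  qed
  show "(\<integral>x. f x * g x \<partial>N) / (\<integral>x. g x \<partial>N) \<ge> 1 - K" if z: "\<And>x. x \<in> space N \<Longrightarrow> \<not> P x \<Longrightarrow> f x = 1"
  proof -
    have "(\<integral>x. g x \<partial>N) - (\<integral>x. indicator ?S x * g x \<partial>N) = (\<integral>x. g x - indicator ?S x * g x \<partial>N)"
      by (rule Bochner_Integration.integral_diff[symmetric, OF g(1) intS])
    also have "\<dots> \<le> (\<integral>x. f x * g x \<partial>N)"
    proof (intro integral_mono intf Bochner_Integration.integrable_diff g(1) intS)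
      fix x assume "x \<in> space N"
      thus "g x - indicator ?S x * g x \<le> f x * g x"
        using f(2)[of x] g(2)[of x] z[of x] by (cases "P x") (auto simp: indicator_def)
    qed
    finally have "(1 - K) * (\<integral>x. g x \<partial>N) \<le> (\<integral>x. f x * g x \<partial>N)"
      using tl by (simp add: algebra_simps)
    thus ?thesis using g(3) by (simp add: pos_le_divide_eq)
  qed
qed

lemma integrable_one_div_square:
  fixes \<kappa> :: real
  assumes "\<kappa> > 0"
  shows "integrable lborel (\<lambda>x::real. 1 / (1 + \<kappa> * x\<^sup>2))"
proof -
  have "einterval (-\<infinity>) \<infinity> = (UNIV :: real set)" by (auto simp: einterval_def)
  hence "integrable lborel (\<lambda>x::real. inverse (1 + x\<^sup>2))"
    using integrable_inverse_1_plus_square by (simp add: set_integrable_def)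
  hence "integrable lborel (\<lambda>x::real. inverse (1 + (0 + sqrt \<kappa> * x)\<^sup>2))"
    using assms by (intro lborel_integrable_real_affine) auto
  thus ?thesis using assms by (simp add: power_mult_distrib inverse_eq_divide)
qed

text \<open>Halving \<open>B - B_hat\<close> costs the factor \<open>2 ^ (q * m)\<close> in volume but gains an exponential factor
  in the density wherever \<open>T\<close> is bounded away from 0. Comparing the two integrals bounds the tail without
  computing the normalising constant.\<close>
lemma gf_density_integrals:
  fixes W Bh Z :: "real mat" and q m n :: nat
  assumes q: "q \<ge> 1" "m \<ge> 1" "n \<ge> 2 * q * m" and W: "W \<in> carrier_mat q q" "det W \<noteq> 0"
    and Bh: "Bh \<in> carrier_mat q m" and Z: "Z \<in> carrier_mat m k" and dZ: "det (Z * transpose_mat Z) \<noteq> 0"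
    and \<delta>: "\<delta> > 0"
  defines "T \<equiv> \<lambda>b. W * (mat q m b - Bh) * Z"
  defines "g \<equiv> \<lambda>b. det (1\<^sub>m q + T b * transpose_mat (T b)) powr (- (real n / 2))"
  shows "integrable (mat_lebesgue q m) g" "(\<integral>b. g b \<partial>mat_lebesgue q m) > 0"
    "(\<integral>\<^sup>+b. ennreal (g b) * indicator {b \<in> space (mat_lebesgue q m). \<delta> \<le> fro2 (T b)} b \<partial>mat_lebesgue q m)
      \<le> ennreal (2 ^ (q * m) * ((1 + \<delta> / q) / (1 + \<delta> / (4 * q))) powr (- (real n / 2))) * (\<integral>\<^sup>+b. ennreal (g b) \<partial>mat_lebesgue q m)"
    "{b \<in> space (mat_lebesgue q m). \<delta> \<le> fro2 (T b)} \<in> sets (mat_lebesgue q m)"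
proof -
  define I where "I = {0..<q} \<times> {0..<m}"
  define L where "L = PiM I (\<lambda>_. lborel :: real measure)"
  have Leq: "mat_lebesgue q m = L" by (simp add: mat_lebesgue_def L_def I_def)
  have fin: "finite I" and cardI: "card I = q * m" by (auto simp: I_def)
  note [simp] = carrier_matD[OF W(1)] carrier_matD[OF Bh] carrier_matD[OF Z]
  have [simp]: "dim_row (T b) = q" "dim_col (T b) = k" for b by (auto simp: T_def)
  have Tc: "T b \<in> carrier_mat q k" for b by (intro carrier_matI) auto
  have mT: "mmat L q k T"
  proof -
    have "mmat L q m (\<lambda>b. mat q m b)" unfolding L_def by (rule mmat_coords) (auto simp: I_def)
    note mmat_minus[OF this mmat_const[OF Bh]]
    note mmat_mult[OF mmat_mult[OF mmat_const[OF W(1)] this] mmat_const[OF Z]]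
    thus ?thesis by (simp add: T_def)
  qed
  have mg: "g \<in> borel_measurable L"
  proof -
    have [measurable]: "(\<lambda>b. det (1\<^sub>m q + T b * transpose_mat (T b))) \<in> borel_measurable L"
      by (rule mmat_det[OF mmat_add[OF mmat_const[OF one_carrier_mat] mmat_mult[OF mT mmat_transpose[OF mT]]]])
    show ?thesis unfolding g_def by measurable
  qed
  have mS: "{b \<in> space L. \<delta> \<le> fro2 (T b)} \<in> sets L"
    using mmat_fro2[OF mT] by measurable
  thus "{b \<in> space (mat_lebesgue q m). \<delta> \<le> fro2 (T b)} \<in> sets (mat_lebesgue q m)" by (simp add: Leq)
  have det_ge: "det (1\<^sub>m q + T b * transpose_mat (T b)) \<ge> 1 + fro2 (T b)" for b
    using det_one_add_gram_ge[OF Tc, of 1 b] by (simp add: one_smult_real_mat)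
  hence det_pos: "det (1\<^sub>m q + T b * transpose_mat (T b)) > 0" for b
    using fro2_nonneg[of "T b"] by (smt (verit))
  have g_pos: "g b > 0" for b using det_pos[of b] by (simp add: g_def)
  define Wi where "Wi = mat_inv W"
  define V where "V = transpose_mat Z * mat_inv (Z * transpose_mat Z)"
  note Wi = mat_inv_props[OF W, folded Wi_def]
  have "Z * transpose_mat Z \<in> carrier_mat m m" using Z by simp
  note Gi = mat_inv_props[OF this dZ]
  note [simp] = carrier_matD[OF Wi(1)] carrier_matD[OF Gi(1)]
  have [simp]: "dim_row V = k" "dim_col V = m" by (auto simp: V_def)
  have ZV: "Z * V = 1\<^sub>m m" using Gi(2) by (simp add: V_def mat_assoc)
  define \<kappa> where "\<kappa> = 1 / (fro2 Wi * fro2 V + 1)"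
  have \<kappa>: "\<kappa> > 0" by (simp add: \<kappa>_def add_nonneg_pos)
  \<comment> \<open>Since \<open>W\<close> is invertible and \<open>Z\<close> has a right inverse,
    \<open>T\<close> controls the full deviation of \<open>B\<close>; this makes the density decay
    in every coordinate.\<close>
  have lower: "\<kappa> * fro2 (mat q m b - Bh) \<le> fro2 (T b)" for b
  proof -
    define D where "D = mat q m b - Bh"
    have [simp]: "dim_row D = q" "dim_col D = m" by (auto simp: D_def)
    have "Wi * (T b) * V = (Wi * W) * D * (Z * V)" by (simp add: T_def D_def mat_assoc)
    also have "\<dots> = D" by (simp add: Wi ZV mat_one_mult mat_mult_one)
    finally have "fro2 D = fro2 (Wi * (T b) * V)" by simp
    also have "\<dots> \<le> fro2 (Wi * T b) * fro2 V" by (rule fro2_mult_le) simp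
    also have "\<dots> \<le> fro2 Wi * fro2 (T b) * fro2 V" by (intro mult_right_mono fro2_mult_le) auto
    also have "\<dots> \<le> (fro2 Wi * fro2 V + 1) * fro2 (T b)" by (simp add: algebra_simps)
    finally have "fro2 D \<le> (fro2 Wi * fro2 V + 1) * fro2 (T b)" .
    moreover have "fro2 Wi * fro2 V + 1 > 0" by (simp add: add_nonneg_pos)
    ultimately show ?thesis by (simp add: \<kappa>_def D_def pos_divide_le_eq mult.commute)
  qed
  have nn_fin: "(\<integral>\<^sup>+b. ennreal (g b) \<partial>L) < \<infinity>"
  proof -
    define a where "a = (\<lambda>ij. Bh $$ ij)"
    interpret product_sigma_finite "\<lambda>_::nat \<times> nat. lborel :: real measure" by (rule product_sigma_finite_lborel)
    have "(\<integral>\<^sup>+b. ennreal (g b) \<partial>L) = ennreal (1 ^ card I) * (\<integral>\<^sup>+b. ennreal (g (\<lambda>i\<in>I. a i + 1 * b i)) \<partial>L)"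
      unfolding L_def by (rule nn_integral_PiM_lborel_affine[OF fin]) (use mg in \<open>auto simp: L_def\<close>)
    also have "\<dots> \<le> (\<integral>\<^sup>+b. (\<Prod>ij\<in>I. ennreal (1 / (1 + \<kappa> * (b ij)\<^sup>2))) \<partial>L)"
    proof (simp, intro nn_integral_mono)
      fix b :: "nat \<times> nat \<Rightarrow> real"
      define b' where "b' = (\<lambda>i\<in>I. a i + b i)"
      have "fro2 (mat q m b' - Bh) = (\<Sum>ij\<in>I. (b ij)\<^sup>2)"
        by (simp add: fro2_def sum.cartesian_product I_def lessThan_atLeast0 b'_def a_def)
      hence "1 + (\<Sum>ij\<in>I. \<kappa> * (b ij)\<^sup>2) \<le> det (1\<^sub>m q + T b' * transpose_mat (T b'))" (is "?s \<le> ?d")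
        using lower[of b'] det_ge[of b'] by (simp add: sum_distrib_left)
      have s1: "?s \<ge> 1" using \<kappa> by (simp add: sum_nonneg)
      \<comment> \<open>Each of the \<open>q * m\<close> factors is at most \<open>?s\<close>, and
        \<open>n \<ge> 2 * q * m\<close> lets the exponent \<open>n / 2\<close> pay for all of them.
        So the density is dominated by a product of one-dimensional Cauchy-type densities.\<close>
      have "(\<Prod>ij\<in>I. 1 + \<kappa> * (b ij)\<^sup>2) \<le> (\<Prod>ij\<in>I. ?s)"
      proof (intro prod_mono conjI)
        fix ij assume "ij \<in> I"
        thus "1 + \<kappa> * (b ij)\<^sup>2 \<le> ?s" using fin \<kappa> member_le_sum[of ij I "\<lambda>ij. \<kappa> * (b ij)\<^sup>2"] by simp
      qed (use \<kappa> in auto)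
      also have "\<dots> = ?s powr (real (q * m))" using s1 by (subst powr_realpow) (auto simp: cardI)
      also have "\<dots> \<le> ?s powr (real n / 2)"
      proof (rule powr_mono[OF _ s1])
        have "real (2 * q * m) \<le> real n" using q(3) by (simp only: of_nat_le_iff)
        thus "real (q * m) \<le> real n / 2" by simp
      qed
      also have "\<dots> \<le> ?d powr (real n / 2)" using \<open>?s \<le> ?d\<close> s1 by (intro powr_mono2) auto
      finally have le: "(\<Prod>ij\<in>I. 1 + \<kappa> * (b ij)\<^sup>2) \<le> ?d powr (real n / 2)" .
      have pos: "(\<Prod>ij\<in>I. 1 + \<kappa> * (b ij)\<^sup>2) > 0" using \<kappa> by (intro prod_pos) (auto intro: add_pos_nonneg)
      have "g b' = 1 / ?d powr (real n / 2)" by (simp add: g_def powr_minus_divide)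
      also have "\<dots> \<le> 1 / (\<Prod>ij\<in>I. 1 + \<kappa> * (b ij)\<^sup>2)" using le pos less_le_trans[OF pos le]
        by (intro divide_left_mono mult_pos_pos) auto
      also have "\<dots> = (\<Prod>ij\<in>I. 1 / (1 + \<kappa> * (b ij)\<^sup>2))" by (simp add: prod_dividef)
      finally show "ennreal (g (\<lambda>i\<in>I. a i + b i)) \<le> (\<Prod>ij\<in>I. ennreal (1 / (1 + \<kappa> * (b ij)\<^sup>2)))"
        using \<kappa> by (subst prod_ennreal) (auto simp: b'_def add_nonneg_nonneg intro!: ennreal_leI)
    qed
    also have "\<dots> = (\<Prod>ij\<in>I. \<integral>\<^sup>+x. ennreal (1 / (1 + \<kappa> * x\<^sup>2)) \<partial>lborel)"
      unfolding L_def by (rule product_nn_integral_prod[OF fin]) measurable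
    also have "\<dots> = (\<Prod>ij\<in>I. ennreal (\<integral>x. 1 / (1 + \<kappa> * x\<^sup>2) \<partial>lborel))"
      using \<kappa> by (subst nn_integral_eq_integral[OF integrable_one_div_square[OF \<kappa>]]) auto
    also have "\<dots> < \<infinity>" by (simp add: ennreal_power[symmetric] power_less_top_ennreal)
    finally show ?thesis .
  qed
  have int: "integrable L g"
    using nn_fin mg g_pos by (intro integrableI_nonneg) (auto intro: less_imp_le)
  thus "integrable (mat_lebesgue q m) g" by (simp add: Leq)
  \<comment> \<open>A strictly positive function with integral 0 would make the whole space null,
    but the unit cube has measure 1.\<close>
  have "(\<integral>b. g b \<partial>L) > 0"
  proof (rule ccontr)
    assume "\<not> (\<integral>b. g b \<partial>L) > 0"
    hence "(\<integral>b. g b \<partial>L) = 0" using g_pos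
      by (meson Bochner_Integration.integral_nonneg less_imp_le not_less order_antisym)
    hence "AE b in L. g b = 0"
      using integral_nonneg_eq_0_iff_AE[OF int] g_pos by (simp add: less_imp_le)
    hence ae: "AE b in L. False" using g_pos by (auto elim!: eventually_mono simp: less_le)
    interpret product_sigma_finite "\<lambda>_::nat \<times> nat. lborel :: real measure" by (rule product_sigma_finite_lborel)
    have "emeasure L (PiE I (\<lambda>_. {0..1})) = 1"
      unfolding L_def using fin by (subst emeasure_PiM) auto
    moreover have "emeasure L (space L) = 0" using ae by (simp add: AE_iff_null null_setsD1)
    moreover have "emeasure L (PiE I (\<lambda>_. {0..1})) \<le> emeasure L (space L)"
      by (intro emeasure_space)
    ultimately show False by simp
  qed
  thus "(\<integral>b. g b \<partial>mat_lebesgue q m) > 0" by (simp add: Leq)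
  define \<rho> where "\<rho> = (1 + \<delta> / q) / (1 + \<delta> / (4 * q))"
  have \<rho>: "\<rho> > 0" using \<delta> by (auto simp: \<rho>_def intro!: divide_pos_pos add_pos_nonneg)
  define a where "a = (\<lambda>ij. 1/2 * Bh $$ ij)"
  \<comment> \<open>The midpoint between \<open>b\<close> and the centre \<open>Bh\<close>, so that
    \<open>T\<close> is halved.\<close>
  define half where "half = (\<lambda>b. \<lambda>i\<in>I. a i + 1/2 * b i)"
  have T_half: "T (half b) = 1/2 \<cdot>\<^sub>m T b" for b
  proof -
    have "mat q m (half b) - Bh = 1/2 \<cdot>\<^sub>m (mat q m b - Bh)"
      by (intro eq_matI) (auto simp: half_def a_def I_def)
    thus ?thesis by (simp add: T_def mat_smult_mult mat_mult_smult)
  qed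
  have "ennreal (g b) * indicator {b \<in> space L. \<delta> \<le> fro2 (T b)} b \<le> ennreal (\<rho> powr (- (real n / 2))) * ennreal (g (half b))"
    if "b \<in> space L" for b
  proof (cases "\<delta> \<le> fro2 (T b)")
    case True
    have "T (half b) * transpose_mat (T (half b)) = (1/4) \<cdot>\<^sub>m (T b * transpose_mat (T b))"
      unfolding T_half by (intro eq_matI) (auto simp: mult_entry sum_distrib_left simp del: index_mult_mat(1))
    hence "\<rho> * det (1\<^sub>m q + T (half b) * transpose_mat (T (half b))) \<le> det (1\<^sub>m q + T b * transpose_mat (T b))"
      using det_one_add_gram_scaling[OF Tc q(1) \<delta> True] by (simp add: \<rho>_def)
    moreover have "0 < \<rho> * det (1\<^sub>m q + T (half b) * transpose_mat (T (half b)))" using \<rho> det_pos by simp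
    ultimately have "g b \<le> (\<rho> * det (1\<^sub>m q + T (half b) * transpose_mat (T (half b)))) powr (- (real n / 2))"
      unfolding g_def by (intro powr_mono2') auto
    also have "\<dots> = \<rho> powr (- (real n / 2)) * g (half b)"
      unfolding g_def using \<rho> det_pos[of "half b"] by (simp add: powr_mult)
    finally show ?thesis using True that g_pos
      by (simp add: ennreal_mult'[symmetric] ennreal_leI)
  qed simp
  hence "(\<integral>\<^sup>+b. ennreal (g b) * indicator {b \<in> space L. \<delta> \<le> fro2 (T b)} b \<partial>L)
    \<le> (\<integral>\<^sup>+b. ennreal (\<rho> powr (- (real n / 2))) * ennreal (g (half b)) \<partial>L)"
    by (rule nn_integral_mono)
  also have "\<dots> = ennreal (\<rho> powr (- (real n / 2))) * (\<integral>\<^sup>+b. ennreal (g (half b)) \<partial>L)"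
  proof (rule nn_integral_cmult)
    have "half \<in> measurable L L" unfolding half_def L_def by measurable
    thus "(\<lambda>b. ennreal (g (half b))) \<in> borel_measurable L" using mg by measurable
  qed
  also have "(\<integral>\<^sup>+b. ennreal (g (half b)) \<partial>L) = ennreal (2 ^ (q * m)) * (\<integral>\<^sup>+b. ennreal (g b) \<partial>L)"
  proof -
    have "(\<integral>\<^sup>+b. ennreal (g b) \<partial>L) = ennreal ((1/2) ^ card I) * (\<integral>\<^sup>+b. ennreal (g (half b)) \<partial>L)"
      unfolding L_def half_def by (rule nn_integral_PiM_lborel_affine[OF fin]) (use mg in \<open>auto simp: L_def\<close>)
    hence "ennreal (2 ^ (q * m)) * (\<integral>\<^sup>+b. ennreal (g b) \<partial>L) =
      ennreal (2 ^ (q * m) * (1/2) ^ (q * m)) * (\<integral>\<^sup>+b. ennreal (g (half b)) \<partial>L)"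
      by (simp add: cardI ennreal_mult mult.assoc)
    also have "(2::real) ^ (q * m) * (1/2) ^ (q * m) = 1" by (simp add: power_mult_distrib[symmetric])
    finally show ?thesis by simp
  qed
  finally show "(\<integral>\<^sup>+b. ennreal (g b) * indicator {b \<in> space (mat_lebesgue q m). \<delta> \<le> fro2 (T b)} b \<partial>mat_lebesgue q m)
      \<le> ennreal (2 ^ (q * m) * ((1 + \<delta> / q) / (1 + \<delta> / (4 * q))) powr (- (real n / 2))) * (\<integral>\<^sup>+b. ennreal (g b) \<partial>mat_lebesgue q m)"
    by (simp add: Leq \<rho>_def ennreal_mult mult.assoc mult.left_commute)
qed

section \<open>Measurability of the h-function\<close>

lemma min_sparse_fit_le:
  assumes "B' \<in> carrier_mat (dim_row C) (dim_row X)" "nz_cols B' \<le> k"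
  shows "min_sparse_fit W C X k \<le> fro2 (W * (C - B' * X))"
  unfolding min_sparse_fit_def
  by (intro cInf_lower) (use assms in \<open>auto intro!: bdd_belowI[of _ 0]\<close>)

text \<open>Turns a bound on the infimum into a statement about every admissible \<open>B'\<close>;
  the zero matrix keeps the set of values nonempty.\<close>

lemma min_sparse_fit_ge_iff:
  "c \<le> min_sparse_fit W C X k \<longleftrightarrow>
    (\<forall>B' \<in> carrier_mat (dim_row C) (dim_row X). nz_cols B' \<le> k \<longrightarrow> c \<le> fro2 (W * (C - B' * X)))"
proof -
  have "0\<^sub>m (dim_row C) (dim_row X) \<in> carrier_mat (dim_row C) (dim_row X)" by simp
  moreover have "nz_cols (0\<^sub>m (dim_row C) (dim_row X)) \<le> k" by (simp add: nz_cols_def cong: conj_cong)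
  ultimately have "{fro2 (W * (C - B' * X)) | B'. B' \<in> carrier_mat (dim_row C) (dim_row X) \<and> nz_cols B' \<le> k} \<noteq> {}"
    by blast
  thus ?thesis unfolding min_sparse_fit_def
    by (subst le_cInf_iff) (auto intro!: bdd_belowI[of _ 0])
qed

lemma measurable_h_eps:
  fixes X W :: "real mat"
  assumes X: "X \<in> carrier_mat p n" and M: "M \<subseteq> {0..<p}" and Y: "Y \<in> carrier_mat q n"
    and W: "inv_sqrt (Sigma_hat Y X M) \<in> carrier_mat q q"
  shows "(\<lambda>b. h_eps \<epsilon> Y X M (mat q (card M) b)) \<in> borel_measurable (mat_lebesgue q (card M))"
proof -
  define m where "m = card M"
  define W where "W = inv_sqrt (Sigma_hat Y X M)"
  define Z where "Z = rows_sub X M"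
  define I where "I = {0..<q} \<times> {0..<m}"
  have Z: "Z \<in> carrier_mat m n" unfolding Z_def m_def by (rule rows_sub_dims(1)[OF X M])
  note [simp] = carrier_matD[OF X] carrier_matD[OF Y] carrier_matD[OF Z] carrier_matD[OF W, folded W_def]
  let ?C = "{B' \<in> carrier_mat q p. nz_cols B' \<le> m - 1}"
  let ?F = "\<lambda>B' b. fro2 (W * (mat q m b * Z - B' * X))"
  text \<open>The infimum over \<open>B'\<close> ranges over an uncountable set, but its superlevel sets are intersections of closed sets.\<close>
  define A where "A = (\<Inter>B'\<in>?C. {b :: nat \<times> nat \<Rightarrow> real. 2 * \<epsilon> \<le> ?F B' b})"
  have cont: "continuous_on UNIV (?F B')" if "B' \<in> ?C" for B'
  proof -
    have [simp]: "dim_row B' = q" "dim_col B' = p" using that by auto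
    have "?F B' = (\<lambda>b. \<Sum>i<q. \<Sum>j<n. (\<Sum>k<q. W $$ (i,k) * ((\<Sum>l<m. b (k,l) * Z $$ (l,j)) - (B' * X) $$ (k,j)))\<^sup>2)"
      by (intro ext) (simp add: fro2_def mult_entry del: index_mult_mat(1))
    moreover have "continuous_on UNIV \<dots>"
      by (intro continuous_intros continuous_on_product_coordinates)
    ultimately show ?thesis by (simp only:)
  qed
  have "closed A" unfolding A_def
  proof (intro closed_INT ballI)
    fix B' assume "B' \<in> ?C"
    from cont[OF this] show "closed {b. 2 * \<epsilon> \<le> ?F B' b}"
      by (intro closed_Collect_le continuous_on_const) auto
  qed
  hence A: "A \<in> sets borel" by simp
  have iff: "h_eps \<epsilon> Y X M (mat q m b) = (if b \<in> A \<and> real m < real n - real q then 1 else 0)" for b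
    unfolding h_eps_def W_def[symmetric] Z_def[symmetric] m_def[symmetric]
    using min_sparse_fit_ge_iff[of "2 * \<epsilon>" W "mat q m b * Z" X "m - 1"]
    by (auto simp: A_def)
  \<comment> \<open>Points of the product space over \<open>I\<close> are undefined outside
    \<open>I\<close>, whereas \<open>A\<close> is closed in the space of all functions. Extension by
    0 passes from one to the other and leaves the matrix \<open>mat q m b\<close> unchanged.\<close>
  define ex where "ex = (\<lambda>b :: nat \<times> nat \<Rightarrow> real. \<lambda>ij. if ij \<in> I then b ij else 0)"
  have memA: "b \<in> A \<longleftrightarrow> ex b \<in> A" for b
  proof -
    have "mat q m b = mat q m (ex b)" by (intro eq_matI) (auto simp: ex_def I_def)
    thus ?thesis by (simp add: A_def)
  qed
  have "ex \<in> measurable (PiM I (\<lambda>_. lborel)) (PiM UNIV (\<lambda>_. borel))"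
  proof (rule measurable_PiM_single')
    fix ij show "(\<lambda>b. ex b ij) \<in> measurable (PiM I (\<lambda>_. lborel)) borel"
      by (cases "ij \<in> I") (auto simp: ex_def)
  qed auto
  hence ex: "ex \<in> measurable (PiM I (\<lambda>_. lborel)) borel"
    by (subst measurable_cong_sets[OF refl sets_PiM_equal_borel[symmetric]])
  have "(\<lambda>b. h_eps \<epsilon> Y X M (mat q m b)) = (\<lambda>b. if ex b \<in> A \<and> real m < real n - real q then 1 else 0)"
    unfolding iff by (intro ext) (simp add: memA[symmetric])
  also have "\<dots> \<in> borel_measurable (PiM I (\<lambda>_. lborel))"
    using ex A by measurable
  finally show ?thesis by (simp add: mat_lebesgue_def m_def I_def)
qed

section \<open>Gaussian matrices\<close>

definition std_gauss :: "real measure" where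
  "std_gauss = density lborel (\<lambda>x. ennreal (std_normal_density x))"

lemma gauss_mat_measure_eq: "gauss_mat_measure q n = PiM ({0..<q} \<times> {0..<n}) (\<lambda>_. std_gauss)"
  by (simp add: gauss_mat_measure_def std_gauss_def)

lemma sets_std_gauss [simp, measurable_cong]: "sets std_gauss = sets borel"
  by (simp add: std_gauss_def)

lemma prob_space_std_gauss: "prob_space std_gauss"
  unfolding std_gauss_def by (rule prob_space_normal_density) simp

lemma product_sigma_finite_gauss: "product_sigma_finite (\<lambda>_. std_gauss)"
  using prob_space_std_gauss by (simp add: product_sigma_finite_def prob_space_imp_sigma_finite)

lemma prob_space_gauss_mat: "prob_space (gauss_mat_measure q n)"
  unfolding gauss_mat_measure_eq by (intro prob_space_PiM prob_space_std_gauss)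

lemma nn_integral_normal_density: "\<sigma> > 0 \<Longrightarrow> (\<integral>\<^sup>+x. ennreal (normal_density \<mu> \<sigma> x) \<partial>lborel) = 1"
  by (subst nn_integral_eq_integral) auto

lemma std_gauss_exp: "(\<integral>\<^sup>+x. ennreal (exp (s * x)) \<partial>std_gauss) = ennreal (exp (s\<^sup>2 / 2))"
proof -
  have eq: "std_normal_density x * exp (s * x) = exp (s\<^sup>2 / 2) * normal_density s 1 x" for x
  proof -
    have "- x\<^sup>2 / 2 + s * x = s\<^sup>2 / 2 + (- (x - s)\<^sup>2 / 2)"
      by (simp add: power2_eq_square field_simps)
    hence "exp (- x\<^sup>2 / 2) * exp (s * x) = exp (s\<^sup>2 / 2) * exp (- (x - s)\<^sup>2 / 2)"
      by (simp add: exp_add[symmetric])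
    thus ?thesis by (simp add: normal_density_def)
  qed
  have "(\<integral>\<^sup>+x. ennreal (exp (s * x)) \<partial>std_gauss) = (\<integral>\<^sup>+x. ennreal (exp (s\<^sup>2 / 2)) * ennreal (normal_density s 1 x) \<partial>lborel)"
    unfolding std_gauss_def by (subst nn_integral_density) (auto simp: ennreal_mult[symmetric] eq)
  also have "\<dots> = ennreal (exp (s\<^sup>2 / 2)) * (\<integral>\<^sup>+x. ennreal (normal_density s 1 x) \<partial>lborel)"
    by (rule nn_integral_cmult) simp
  finally show ?thesis by (simp add: nn_integral_normal_density)
qed

text \<open>The weight with exponent 1/4 turns variance 1 into variance 2, and the change of
  normalisation is the factor \<open>sqrt 2\<close>.\<close>

lemma std_gauss_exp_sq: "(\<integral>\<^sup>+x. ennreal (exp (x\<^sup>2 / 4)) \<partial>std_gauss) = ennreal (sqrt 2)"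
proof -
  have eq: "std_normal_density x * exp (x\<^sup>2 / 4) = sqrt 2 * normal_density 0 (sqrt 2) x" for x
  proof -
    have "exp (- x\<^sup>2 / 2) * exp (x\<^sup>2 / 4) = exp (- x\<^sup>2 / 4)" by (simp add: exp_add[symmetric])
    moreover have "1 / sqrt (2 * pi) = sqrt 2 * (1 / sqrt (2 * pi * 2))"
      by (simp add: real_sqrt_mult field_simps)
    ultimately show ?thesis by (simp add: normal_density_def)
  qed
  have "(\<integral>\<^sup>+x. ennreal (exp (x\<^sup>2 / 4)) \<partial>std_gauss) = (\<integral>\<^sup>+x. ennreal (sqrt 2) * ennreal (normal_density 0 (sqrt 2) x) \<partial>lborel)"
    unfolding std_gauss_def by (subst nn_integral_density) (auto simp: ennreal_mult[symmetric] eq)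
  also have "\<dots> = ennreal (sqrt 2) * (\<integral>\<^sup>+x. ennreal (normal_density 0 (sqrt 2) x) \<partial>lborel)"
    by (rule nn_integral_cmult) simp
  finally show ?thesis by (simp add: nn_integral_normal_density)
qed

lemma mmat_gauss: "mmat (gauss_mat_measure q n) q n (\<lambda>u. mat q n u)"
  unfolding gauss_mat_measure_eq by (rule mmat_coords) auto

lemma mmat_compose:
  assumes "mmat N r c F" "h \<in> measurable N' N"
  shows "mmat N' r c (\<lambda>x. F (h x))"
  using mmat_dims(1,2)[OF assms(1)] measurable_compose[OF assms(2) mmat_entry[OF assms(1)]]
  by (intro mmatI) auto

lemma mmat_fip:
  assumes "mmat N r c F" "mmat N r c G"
  shows "(\<lambda>x. fip (F x) (G x)) \<in> borel_measurable N"
  unfolding fip_def mmat_dims[OF assms(1)] mmat_dims[OF assms(2)]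
  by (intro borel_measurable_sum borel_measurable_times mmat_entry[OF assms(1)] mmat_entry[OF assms(2)]) auto

lemma prod_ennreal_exp: "finite I \<Longrightarrow> (\<Prod>i\<in>I. ennreal (exp (f i))) = ennreal (exp (\<Sum>i\<in>I. f i))"
  by (simp add: prod_ennreal exp_sum)

lemma gauss_mat_exp_fip:
  assumes "A \<in> carrier_mat q n"
  shows "(\<integral>\<^sup>+u. ennreal (exp (c * fip (mat q n u) A)) \<partial>gauss_mat_measure q n) = ennreal (exp (c\<^sup>2 / 2 * fro2 A))"
proof -
  define I where "I = {0..<q} \<times> {0..<n}"
  have fin: "finite I" by (simp add: I_def)
  interpret product_sigma_finite "\<lambda>_::nat \<times> nat. std_gauss" by (rule product_sigma_finite_gauss)
  have fip: "c * fip (mat q n u) A = (\<Sum>x\<in>I. (c * A $$ x) * u x)" for u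
    by (simp add: fip_def sum.cartesian_product I_def lessThan_atLeast0 sum_distrib_left mult_ac)
  have "(\<integral>\<^sup>+u. ennreal (exp (c * fip (mat q n u) A)) \<partial>gauss_mat_measure q n)
    = (\<integral>\<^sup>+u. (\<Prod>x\<in>I. ennreal (exp ((c * A $$ x) * u x))) \<partial>PiM I (\<lambda>_. std_gauss))"
    unfolding gauss_mat_measure_eq I_def[symmetric] by (simp add: prod_ennreal_exp[OF fin] fip)
  also have "\<dots> = (\<Prod>x\<in>I. \<integral>\<^sup>+v. ennreal (exp ((c * A $$ x) * v)) \<partial>std_gauss)"
    by (rule product_nn_integral_prod[OF fin]) measurable
  also have "\<dots> = (\<Prod>x\<in>I. ennreal (exp ((c * A $$ x)\<^sup>2 / 2)))" by (simp add: std_gauss_exp)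
  also have "\<dots> = ennreal (exp (\<Sum>x\<in>I. (c * A $$ x)\<^sup>2 / 2))" by (rule prod_ennreal_exp[OF fin])
  also have "(\<Sum>x\<in>I. (c * A $$ x)\<^sup>2 / 2) = c\<^sup>2 / 2 * fro2 A"
    using assms by (auto simp: fro2_def sum.cartesian_product I_def lessThan_atLeast0 sum_distrib_left power_mult_distrib)
  finally show ?thesis .
qed

lemma gauss_mat_exp_fro2:
  "(\<integral>\<^sup>+u. ennreal (exp (1/4 * fro2 (mat q n u))) \<partial>gauss_mat_measure q n) = ennreal (sqrt 2 ^ (q * n))"
proof -
  define I where "I = {0..<q} \<times> {0..<n}"
  have fin: "finite I" "card I = q * n" by (auto simp: I_def)
  interpret product_sigma_finite "\<lambda>_::nat \<times> nat. std_gauss" by (rule product_sigma_finite_gauss)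
  have eq: "1/4 * fro2 (mat q n u) = (\<Sum>x\<in>I. (u x)\<^sup>2 / 4)" for u
    by (simp add: fro2_def sum.cartesian_product I_def lessThan_atLeast0 sum_distrib_left)
  have "(\<integral>\<^sup>+u. ennreal (exp (1/4 * fro2 (mat q n u))) \<partial>gauss_mat_measure q n)
    = (\<integral>\<^sup>+u. (\<Prod>x\<in>I. ennreal (exp ((u x)\<^sup>2 / 4))) \<partial>PiM I (\<lambda>_. std_gauss))"
    unfolding gauss_mat_measure_eq I_def[symmetric] eq by (simp add: prod_ennreal_exp[OF fin(1)])
  also have "\<dots> = (\<Prod>x\<in>I. \<integral>\<^sup>+v. ennreal (exp (v\<^sup>2 / 4)) \<partial>std_gauss)"
    by (rule product_nn_integral_prod[OF fin(1)]) measurable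
  also have "\<dots> = ennreal (sqrt 2 ^ (q * n))" by (simp add: std_gauss_exp_sq fin ennreal_power)
  finally show ?thesis .
qed

text \<open>The square in the exponent is linearised by an auxiliary Gaussian matrix \<open>g\<close>
  (Hubbard--Stratonovich), so that no rotation invariance of the Gaussian measure is needed.\<close>
lemma gauss_mat_exp_contraction:
  assumes Q: "Q \<in> carrier_mat n k"
    and contr: "\<And>g. g \<in> carrier_mat q k \<Longrightarrow> fro2 (g * transpose_mat Q) \<le> fro2 g"
  shows "(\<integral>\<^sup>+u. ennreal (exp (1/4 * fro2 (mat q n u * Q))) \<partial>gauss_mat_measure q n) \<le> ennreal (sqrt 2 ^ (q * k))"
proof -
  let ?c = "1 / sqrt 2 :: real"
  let ?N = "gauss_mat_measure q n" and ?K = "gauss_mat_measure q k"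
  note [simp] = carrier_matD[OF Q]
  \<comment> \<open>\<open>?c\<close> is chosen so that the moment generating function of the
    auxiliary Gaussian reproduces the exponent 1/4.\<close>
  have c2: "?c\<^sup>2 / 2 = 1/4" by (simp add: power_divide)
  interpret N: prob_space ?N by (rule prob_space_gauss_mat)
  interpret K: prob_space ?K by (rule prob_space_gauss_mat)
  interpret pair_sigma_finite ?N ?K ..
  have "mmat (?N \<Otimes>\<^sub>M ?K) q k (\<lambda>x. mat q n (fst x) * Q)"
    by (rule mmat_mult[OF mmat_compose[OF mmat_gauss measurable_fst] mmat_const[OF Q]])
  from mmat_fip[OF mmat_compose[OF mmat_gauss measurable_snd] this]
  have meas: "(\<lambda>x. ennreal (exp (?c * fip (mat q k (snd x)) (mat q n (fst x) * Q)))) \<in> borel_measurable (?N \<Otimes>\<^sub>M ?K)"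
    by measurable
  have "(\<integral>\<^sup>+u. ennreal (exp (1/4 * fro2 (mat q n u * Q))) \<partial>?N) =
    (\<integral>\<^sup>+u. \<integral>\<^sup>+g. ennreal (exp (?c * fip (mat q k g) (mat q n u * Q))) \<partial>?K \<partial>?N)"
  proof (intro nn_integral_cong)
    fix u :: "nat \<times> nat \<Rightarrow> real"
    have "mat q n u * Q \<in> carrier_mat q k" using Q by auto
    from gauss_mat_exp_fip[OF this, of ?c]
    show "ennreal (exp (1/4 * fro2 (mat q n u * Q))) = (\<integral>\<^sup>+g. ennreal (exp (?c * fip (mat q k g) (mat q n u * Q))) \<partial>?K)"
      by (simp only: c2)
  qed
  also have "\<dots> = (\<integral>\<^sup>+g. \<integral>\<^sup>+u. ennreal (exp (?c * fip (mat q k g) (mat q n u * Q))) \<partial>?N \<partial>?K)"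
    using Fubini'[of "\<lambda>u g. ennreal (exp (?c * fip (mat q k g) (mat q n u * Q)))"] meas
    by (simp add: case_prod_beta')
  also have "\<dots> = (\<integral>\<^sup>+g. ennreal (exp (1/4 * fro2 (mat q k g * transpose_mat Q))) \<partial>?K)"
  proof (intro nn_integral_cong)
    fix g :: "nat \<times> nat \<Rightarrow> real"
    have G: "mat q k g * transpose_mat Q \<in> carrier_mat q n" using Q by auto
    have "fip (mat q k g) (mat q n u * Q) = fip (mat q n u) (mat q k g * transpose_mat Q)" for u
      by (subst fip_commute) (auto simp: fip_mult_right_adjoint)
    thus "(\<integral>\<^sup>+u. ennreal (exp (?c * fip (mat q k g) (mat q n u * Q))) \<partial>?N) = ennreal (exp (1/4 * fro2 (mat q k g * transpose_mat Q)))"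
      using gauss_mat_exp_fip[OF G, of ?c] by (simp only: c2)
  qed
  also have "\<dots> \<le> (\<integral>\<^sup>+g. ennreal (exp (1/4 * fro2 (mat q k g))) \<partial>?K)"
    by (intro nn_integral_mono ennreal_leI) (simp add: contr)
  also have "\<dots> = ennreal (sqrt 2 ^ (q * k))" by (rule gauss_mat_exp_fro2)
  finally show ?thesis .
qed

lemma gauss_mat_tail:
  assumes Q: "Q \<in> carrier_mat n k"
    and contr: "\<And>g. g \<in> carrier_mat q k \<Longrightarrow> fro2 (g * transpose_mat Q) \<le> fro2 g"
  shows "{u \<in> space (gauss_mat_measure q n). t < fro2 (mat q n u * Q)} \<in> sets (gauss_mat_measure q n)" (is "?S \<in> _")
    "measure (gauss_mat_measure q n) {u \<in> space (gauss_mat_measure q n). t < fro2 (mat q n u * Q)} \<le> exp (- t / 4) * sqrt 2 ^ (q * k)"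
proof -
  let ?N = "gauss_mat_measure q n"
  interpret N: prob_space ?N by (rule prob_space_gauss_mat)
  have mf: "(\<lambda>u. fro2 (mat q n u * Q)) \<in> borel_measurable ?N"
    by (rule mmat_fro2[OF mmat_mult[OF mmat_gauss mmat_const[OF Q]]])
  thus S: "?S \<in> sets ?N" by measurable
  have "ennreal (measure ?N ?S) = (\<integral>\<^sup>+u. indicator ?S u \<partial>?N)"
    using S by (simp add: N.emeasure_eq_measure)
  also have "\<dots> \<le> (\<integral>\<^sup>+u. ennreal (exp (- t / 4)) * ennreal (exp (1/4 * fro2 (mat q n u * Q))) \<partial>?N)"
  proof (intro nn_integral_mono)
    fix u
    have "1 \<le> exp (- t / 4) * exp (1/4 * fro2 (mat q n u * Q))" if "u \<in> ?S"
      using that by (simp add: exp_add[symmetric])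
    thus "indicator ?S u \<le> ennreal (exp (- t / 4)) * ennreal (exp (1/4 * fro2 (mat q n u * Q)))"
      by (auto simp: indicator_def ennreal_mult[symmetric])
  qed
  also have "\<dots> = ennreal (exp (- t / 4)) * (\<integral>\<^sup>+u. ennreal (exp (1/4 * fro2 (mat q n u * Q))) \<partial>?N)"
    using mf by (intro nn_integral_cmult) measurable
  also have "\<dots> \<le> ennreal (exp (- t / 4)) * ennreal (sqrt 2 ^ (q * k))"
    by (intro mult_left_mono gauss_mat_exp_contraction[OF Q contr]) auto
  finally show "measure ?N ?S \<le> exp (- t / 4) * sqrt 2 ^ (q * k)"
    by (simp add: ennreal_mult[symmetric])
qed

subsection \<open>Concentration of the Gram matrix\<close>

definition gmom :: "nat \<Rightarrow> real" where "gmom k = (\<integral>x. x ^ k \<partial>std_gauss)"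

lemma integrable_std_gauss_power: "integrable std_gauss (\<lambda>x. x ^ k)"
  unfolding std_gauss_def
  by (subst integrable_density) (auto simp: integrable_std_normal_moment)

lemma gmom_eq: "gmom k = (\<integral>x. std_normal_density x * x ^ k \<partial>lborel)"
  unfolding gmom_def std_gauss_def by (subst integral_density) auto

lemma gmom_values: "gmom 0 = 1" "gmom (Suc 0) = 0" "gmom 2 = 1" "gmom 4 = 3"
proof -
  show "gmom 0 = 1" by (simp add: gmom_eq)
  show "gmom (Suc 0) = 0" using integral_std_normal_moment_odd[of 0] by (simp add: gmom_eq)
  show "gmom 2 = 1" using integral_std_normal_moment_even[of 1] by (simp add: gmom_eq)
  show "gmom 4 = 3" using integral_std_normal_moment_even[of 2] by (simp add: gmom_eq fact_numeral)
qed

lemma gauss_monomial: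
  assumes "finite I"
  shows "integrable (PiM I (\<lambda>_. std_gauss)) (\<lambda>u. \<Prod>x\<in>I. u x ^ e x)"
    "(\<integral>u. (\<Prod>x\<in>I. u x ^ e x) \<partial>PiM I (\<lambda>_. std_gauss)) = (\<Prod>x\<in>I. gmom (e x))"
proof -
  interpret product_sigma_finite "\<lambda>_. std_gauss" by (rule product_sigma_finite_gauss)
  show "integrable (PiM I (\<lambda>_. std_gauss)) (\<lambda>u. \<Prod>x\<in>I. u x ^ e x)"
    by (intro product_integrable_prod assms integrable_std_gauss_power)
  show "(\<integral>u. (\<Prod>x\<in>I. u x ^ e x) \<partial>PiM I (\<lambda>_. std_gauss)) = (\<Prod>x\<in>I. gmom (e x))"
    unfolding gmom_def by (intro product_integral_prod assms integrable_std_gauss_power)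
qed

text \<open>The exponent \<open>e\<close> counts how often a coordinate occurs among the four, so
  one formula covers all coincidences of indices.\<close>

lemma gauss_moment4:
  assumes I: "finite I" "a \<in> I" "b \<in> I" "c \<in> I" "d \<in> I"
  defines "e \<equiv> \<lambda>x. of_bool (x = a) + of_bool (x = b) + of_bool (x = c) + of_bool (x = d)"
  shows "integrable (PiM I (\<lambda>_. std_gauss)) (\<lambda>u. u a * u b * u c * u d)"
    "(\<integral>u. u a * u b * u c * u d \<partial>PiM I (\<lambda>_. std_gauss)) = (\<Prod>x\<in>I. gmom (e x))"
proof -
  have one: "(\<Prod>x\<in>I. u x ^ of_bool (x = y)) = u y" if "y \<in> I" for u :: "_ \<Rightarrow> real" and y
  proof -
    have "(\<Prod>x\<in>I. u x ^ of_bool (x = y)) = (\<Prod>x\<in>I. if x = y then u x else 1)" by (intro prod.cong) auto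
    thus ?thesis using that I(1) by simp
  qed
  have "(\<lambda>u. u a * u b * u c * u d) = (\<lambda>u :: _ \<Rightarrow> real. \<Prod>x\<in>I. u x ^ e x)"
    using I by (intro ext) (simp add: e_def power_add prod.distrib one)
  thus "integrable (PiM I (\<lambda>_. std_gauss)) (\<lambda>u. u a * u b * u c * u d)"
    "(\<integral>u. u a * u b * u c * u d \<partial>PiM I (\<lambda>_. std_gauss)) = (\<Prod>x\<in>I. gmom (e x))"
    using gauss_monomial[OF I(1), of e] by simp_all
qed

lemma gauss_moment2:
  assumes I: "finite I" "a \<in> I" "b \<in> I"
  defines "e \<equiv> \<lambda>x. of_bool (x = a) + of_bool (x = b)"
  shows "integrable (PiM I (\<lambda>_. std_gauss)) (\<lambda>u. u a * u b)"
    "(\<integral>u. u a * u b \<partial>PiM I (\<lambda>_. std_gauss)) = (\<Prod>x\<in>I. gmom (e x))"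
proof -
  have one: "(\<Prod>x\<in>I. u x ^ of_bool (x = y)) = u y" if "y \<in> I" for u :: "_ \<Rightarrow> real" and y
  proof -
    have "(\<Prod>x\<in>I. u x ^ of_bool (x = y)) = (\<Prod>x\<in>I. if x = y then u x else 1)" by (intro prod.cong) auto
    thus ?thesis using that I(1) by simp
  qed
  have "(\<lambda>u. u a * u b) = (\<lambda>u :: _ \<Rightarrow> real. \<Prod>x\<in>I. u x ^ e x)"
    using I by (intro ext) (simp add: e_def power_add prod.distrib one)
  thus "integrable (PiM I (\<lambda>_. std_gauss)) (\<lambda>u. u a * u b)"
    "(\<integral>u. u a * u b \<partial>PiM I (\<lambda>_. std_gauss)) = (\<Prod>x\<in>I. gmom (e x))"
    using gauss_monomial[OF I(1), of e] by simp_all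
qed

text \<open>A diagonal entry is a centred chi-square variable with variance \<open>2 * n\<close>; an
  off-diagonal one is a sum of \<open>n\<close> uncorrelated products of independent variables, with
  variance \<open>n\<close>.\<close>

lemma gauss_gram_second_moment:
  fixes n :: nat
  assumes i: "i < q" "i' < q"
  defines "S \<equiv> \<lambda>u. (\<Sum>j<n. u (i,j) * u (i',j)) - of_bool (i = i') * real n"
  shows "integrable (gauss_mat_measure q n) (\<lambda>u. (S u)\<^sup>2)" "(\<integral>u. (S u)\<^sup>2 \<partial>gauss_mat_measure q n) \<le> 2 * real n"
proof -
  define I where "I = {0..<q} \<times> {0..<n}"
  define N where "N = PiM I (\<lambda>_. std_gauss)"
  have N: "gauss_mat_measure q n = N" by (simp add: gauss_mat_measure_eq N_def I_def)
  have fin: "finite I" by (simp add: I_def)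
  have mem: "(i,j) \<in> I" "(i',j) \<in> I" if "j < n" for j using i that by (auto simp: I_def)
  define \<delta> where "\<delta> = (of_bool (i = i') :: real)"
  have prod_two: "(\<Prod>x\<in>I. gmom (e x)) = gmom (e a) * gmom (e b)"
    if "a \<in> I" "b \<in> I" "a \<noteq> b" "\<And>x. x \<noteq> a \<Longrightarrow> x \<noteq> b \<Longrightarrow> e x = 0" for e a b
  proof -
    have "(\<Prod>x\<in>I. gmom (e x)) = (\<Prod>x\<in>{a,b}. gmom (e x))"
      using that fin by (intro prod.mono_neutral_right) (auto simp: gmom_values)
    thus ?thesis using that by simp
  qed
  have prod_one: "(\<Prod>x\<in>I. gmom (e x)) = gmom (e a)"
    if "a \<in> I" "\<And>x. x \<noteq> a \<Longrightarrow> e x = 0" for e a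
  proof -
    have "(\<Prod>x\<in>I. gmom (e x)) = (\<Prod>x\<in>{a}. gmom (e x))"
      using that fin by (intro prod.mono_neutral_right) (auto simp: gmom_values)
    thus ?thesis using that by simp
  qed
  \<comment> \<open>Wick's formula for four Gaussian factors: the three pairings contribute
    \<open>\<delta>\<close> for every \<open>j\<close> and \<open>k\<close>, plus 1 and
    \<open>\<delta>\<close> when \<open>j = k\<close>.\<close>
  have E4: "(\<integral>u. u (i,j) * u (i',j) * u (i,k) * u (i',k) \<partial>N) = \<delta> + (if j = k then 1 + \<delta> else 0)"
    if jk: "j < n" "k < n" for j k
  proof -
    define e where "e = (\<lambda>x. of_bool (x = (i,j)) + of_bool (x = (i',j)) + of_bool (x = (i,k)) + of_bool (x = (i',k)) :: nat)"
    have "(\<integral>u. u (i,j) * u (i',j) * u (i,k) * u (i',k) \<partial>N) = (\<Prod>x\<in>I. gmom (e x))"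
      unfolding e_def N_def by (rule gauss_moment4(2)[OF fin]) (use mem jk in auto)
    also have "\<dots> = \<delta> + (if j = k then 1 + \<delta> else 0)"
    proof (cases "i = i'")
      case True
      show ?thesis
      proof (cases "j = k")
        case jk': True
        have "(\<Prod>x\<in>I. gmom (e x)) = gmom (e (i,j))"
          by (rule prod_one) (use mem jk True jk' in \<open>auto simp: e_def\<close>)
        also have "e (i,j) = 4" using True jk' by (simp add: e_def)
        finally show ?thesis using True jk' by (simp add: gmom_values \<delta>_def)
      next
        case False
        have "(\<Prod>x\<in>I. gmom (e x)) = gmom (e (i,j)) * gmom (e (i,k))"
          by (rule prod_two) (use mem jk True False in \<open>auto simp: e_def\<close>)
        moreover have "e (i,j) = 2" "e (i,k) = 2" using True False by (auto simp: e_def)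
        ultimately show ?thesis using True False by (simp add: gmom_values \<delta>_def)
      qed
    next
      case ii: False
      show ?thesis
      proof (cases "j = k")
        case jk': True
        have "(\<Prod>x\<in>I. gmom (e x)) = gmom (e (i,j)) * gmom (e (i',j))"
          by (rule prod_two) (use mem jk ii jk' in \<open>auto simp: e_def\<close>)
        moreover have "e (i,j) = 2" "e (i',j) = 2" using ii jk' by (auto simp: e_def)
        ultimately show ?thesis using ii jk' by (simp add: gmom_values \<delta>_def)
      next
        case False
        \<comment> \<open>A coordinate occurring exactly once contributes the vanishing first
          moment.\<close>
        have "e (i,j) = Suc 0" using ii False by (simp add: e_def)
        hence "gmom (e (i,j)) = 0" by (simp add: gmom_values)
        hence "(\<Prod>x\<in>I. gmom (e x)) = 0" using mem(1)[OF jk(1)] fin by (intro prod_zero) auto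
        thus ?thesis using ii False by (simp add: \<delta>_def)
      qed
    qed
    finally show ?thesis .
  qed
  have I4: "integrable N (\<lambda>u. u (i,j) * u (i',j) * u (i,k) * u (i',k))" if jk: "j < n" "k < n" for j k
    unfolding N_def by (rule gauss_moment4(1)[OF fin]) (use mem jk in auto)
  have E2: "(\<integral>u. u (i,j) * u (i',j) \<partial>N) = \<delta>" if j: "j < n" for j
  proof -
    define e where "e = (\<lambda>x. of_bool (x = (i,j)) + of_bool (x = (i',j)) :: nat)"
    have eq: "(\<integral>u. u (i,j) * u (i',j) \<partial>N) = (\<Prod>x\<in>I. gmom (e x))"
      unfolding e_def N_def by (rule gauss_moment2(2)[OF fin]) (use mem j in auto)
    show ?thesis
    proof (cases "i = i'")
      case True
      have "(\<Prod>x\<in>I. gmom (e x)) = gmom (e (i,j))"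
        by (rule prod_one) (use mem j True in \<open>auto simp: e_def\<close>)
      also have "e (i,j) = 2" using True by (simp add: e_def)
      finally show ?thesis using True eq by (simp add: gmom_values \<delta>_def)
    next
      case False
      have "e (i,j) = Suc 0" using False by (simp add: e_def)
      hence "gmom (e (i,j)) = 0" by (simp add: gmom_values)
      hence "(\<Prod>x\<in>I. gmom (e x)) = 0" using mem(1)[OF j] fin by (intro prod_zero) auto
      thus ?thesis using False eq by (simp add: \<delta>_def)
    qed
  qed
  have I2: "integrable N (\<lambda>u. u (i,j) * u (i',j))" if j: "j < n" for j
    unfolding N_def by (rule gauss_moment2(1)[OF fin]) (use mem j in auto)
  interpret P: prob_space N unfolding N[symmetric] by (rule prob_space_gauss_mat)
  have S2: "(S u)\<^sup>2 = (\<Sum>j<n. \<Sum>k<n. u (i,j) * u (i',j) * u (i,k) * u (i',k)) - 2 * \<delta> * real n * (\<Sum>j<n. u (i,j) * u (i',j)) + \<delta> * (real n)\<^sup>2" for u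
  proof -
    have "(S u)\<^sup>2 = (\<Sum>j<n. u (i,j) * u (i',j)) * (\<Sum>j<n. u (i,j) * u (i',j)) - 2 * \<delta> * real n * (\<Sum>j<n. u (i,j) * u (i',j)) + \<delta>\<^sup>2 * (real n)\<^sup>2"
      unfolding S_def \<delta>_def[symmetric] by (simp add: power2_eq_square algebra_simps)
    moreover have "\<delta>\<^sup>2 = \<delta>" by (simp add: \<delta>_def)
    ultimately show ?thesis by (simp add: sum_product mult.assoc)
  qed
  show "integrable (gauss_mat_measure q n) (\<lambda>u. (S u)\<^sup>2)"
    unfolding N S2
    by (intro Bochner_Integration.integrable_add Bochner_Integration.integrable_diff Bochner_Integration.integrable_sum
      integrable_mult_right I4 I2) auto
  have "(\<integral>u. (S u)\<^sup>2 \<partial>N) = (\<Sum>j<n. \<Sum>k<n. \<delta> + (if j = k then 1 + \<delta> else 0)) - 2 * \<delta> * real n * (\<Sum>j<n. \<delta>) + \<delta> * (real n)\<^sup>2"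
  proof -
    define F where "F = (\<lambda>u :: nat \<times> nat \<Rightarrow> real. \<Sum>j<n. \<Sum>k<n. u (i,j) * u (i',j) * u (i,k) * u (i',k))"
    define G where "G = (\<lambda>u :: nat \<times> nat \<Rightarrow> real. \<Sum>j<n. u (i,j) * u (i',j))"
    have IF: "integrable N F" unfolding F_def by (intro Bochner_Integration.integrable_sum I4) auto
    have IG: "integrable N G" unfolding G_def by (intro Bochner_Integration.integrable_sum I2) auto
    have EF: "(\<integral>u. F u \<partial>N) = (\<Sum>j<n. \<Sum>k<n. \<delta> + (if j = k then 1 + \<delta> else 0))"
      unfolding F_def by (subst Bochner_Integration.integral_sum, (intro Bochner_Integration.integrable_sum I4; simp),
        intro sum.cong refl, subst Bochner_Integration.integral_sum, (intro I4; simp), intro sum.cong refl, simp add: E4)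
    have EG: "(\<integral>u. G u \<partial>N) = (\<Sum>j<n. \<delta>)"
      unfolding G_def by (subst Bochner_Integration.integral_sum, (intro I2; simp), intro sum.cong refl, simp add: E2)
    have "(\<integral>u. F u - 2 * \<delta> * real n * G u + \<delta> * (real n)\<^sup>2 \<partial>N)
      = (\<integral>u. F u \<partial>N) - 2 * \<delta> * real n * (\<integral>u. G u \<partial>N) + \<delta> * (real n)\<^sup>2"
      using IF IG by (simp add: P.prob_space)
    thus ?thesis unfolding S2 EF EG unfolding F_def G_def .
  qed
  also have "\<dots> = (1 + \<delta>) * real n"
    by (simp add: sum.distrib \<delta>_def power2_eq_square algebra_simps)
  also have "\<dots> \<le> 2 * real n" by (simp add: \<delta>_def)
  finally show "(\<integral>u. (S u)\<^sup>2 \<partial>gauss_mat_measure q n) \<le> 2 * real n" by (simp add: N)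
qed

lemma gauss_gram_tail:
  fixes n :: nat
  assumes i: "i < q" "i' < q" and t: "t > 0"
  defines "S \<equiv> \<lambda>u. (\<Sum>j<n. u (i,j) * u (i',j)) - of_bool (i = i') * real n"
  shows "{u \<in> space (gauss_mat_measure q n). t < \<bar>S u\<bar>} \<in> sets (gauss_mat_measure q n)" (is "?A \<in> _")
    "measure (gauss_mat_measure q n) {u \<in> space (gauss_mat_measure q n). t < \<bar>S u\<bar>} \<le> 2 * real n / t\<^sup>2"
proof -
  let ?N = "gauss_mat_measure q n"
  interpret P: prob_space ?N by (rule prob_space_gauss_mat)
  have "(\<lambda>u. mat q n u $$ (k,j)) \<in> borel_measurable ?N" if "k < q" "j < n" for k j
    by (rule mmat_entry[OF mmat_gauss that])
  hence "(\<lambda>u. u (k,j)) \<in> borel_measurable ?N" if "k < q" "j < n" for k j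
    using that by simp
  hence S: "S \<in> borel_measurable ?N" unfolding S_def using i by measurable
  note [measurable] = S
  show A: "?A \<in> sets ?N" by measurable
  have int: "integrable ?N (\<lambda>u. (S u)\<^sup>2)" "(\<integral>u. (S u)\<^sup>2 \<partial>?N) \<le> 2 * real n"
    unfolding S_def by (rule gauss_gram_second_moment[OF i])+
  have "measure ?N ?A * t\<^sup>2 = (\<integral>u. indicator ?A u * t\<^sup>2 \<partial>?N)"
    using A by simp
  also have "\<dots> \<le> (\<integral>u. (S u)\<^sup>2 \<partial>?N)"
  proof (intro integral_mono int)
    show "integrable ?N (\<lambda>u. indicator ?A u * t\<^sup>2)"
      using A by (intro integrable_mult_left integrable_real_indicator) (auto simp: P.emeasure_eq_measure)
    fix u
    have "t\<^sup>2 \<le> (S u)\<^sup>2" if "t < \<bar>S u\<bar>" using that t by (metis abs_le_square_iff abs_of_pos less_imp_le)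
    thus "indicator ?A u * t\<^sup>2 \<le> (S u)\<^sup>2" by (auto simp: indicator_def)
  qed
  also have "\<dots> \<le> 2 * real n" by (rule int)
  finally show "measure ?N ?A \<le> 2 * real n / t\<^sup>2" using t by (simp add: pos_le_divide_eq)
qed

lemma gauss_bad_event:
  fixes Q :: "'k \<Rightarrow> real mat" and k :: "'k \<Rightarrow> nat" and t :: real
  assumes F: "finite F" and Q: "\<And>K. K \<in> F \<Longrightarrow> Q K \<in> carrier_mat n (k K)" "\<And>K. K \<in> F \<Longrightarrow> real (k K) \<le> kmax"
    "\<And>K g. K \<in> F \<Longrightarrow> g \<in> carrier_mat q (k K) \<Longrightarrow> fro2 (g * transpose_mat (Q K)) \<le> fro2 g"
    and s: "s > 0"
  defines "A \<equiv> {u \<in> space (gauss_mat_measure q n).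
     (\<exists>i<q. \<exists>i'<q. s < \<bar>(\<Sum>j<n. u (i,j) * u (i',j)) - of_bool (i = i') * real n\<bar>) \<or> (\<exists>K\<in>F. t < fro2 (mat q n u * Q K))}"
  shows "A \<in> sets (gauss_mat_measure q n)"
    "measure (gauss_mat_measure q n) A \<le> (real q)\<^sup>2 * (2 * real n / s\<^sup>2) + real (card F) * (exp (- t / 4) * sqrt 2 powr (real q * kmax))"
proof -
  let ?N = "gauss_mat_measure q n"
  interpret P: prob_space ?N by (rule prob_space_gauss_mat)
  define S where "S = (\<lambda>(i,i'). {u \<in> space ?N. s < \<bar>(\<Sum>j<n. u (i,j) * u (i',j)) - of_bool (i = i') * real n\<bar>})"
  define R where "R = (\<lambda>K. {u \<in> space ?N. t < fro2 (mat q n u * Q K)})"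
  have S: "S x \<in> sets ?N" "measure ?N (S x) \<le> 2 * real n / s\<^sup>2" if mem: "x \<in> {..<q} \<times> {..<q}" for x
  proof -
    obtain i i' where x: "x = (i,i')" "i < q" "i' < q" using mem by auto
    show "S x \<in> sets ?N" "measure ?N (S x) \<le> 2 * real n / s\<^sup>2"
      unfolding x(1) S_def prod.case by (rule gauss_gram_tail[OF x(2,3) s])+
  qed
  have R: "R K \<in> sets ?N" "measure ?N (R K) \<le> exp (- t / 4) * sqrt 2 powr (real q * kmax)" if "K \<in> F" for K
  proof -
    show "R K \<in> sets ?N" unfolding R_def by (rule gauss_mat_tail(1)[OF Q(1)[OF that] Q(3)[OF that]])
    have "measure ?N (R K) \<le> exp (- t / 4) * sqrt 2 ^ (q * k K)"
      unfolding R_def by (rule gauss_mat_tail(2)[OF Q(1)[OF that] Q(3)[OF that]])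
    also have "sqrt 2 ^ (q * k K) = sqrt 2 powr (real (q * k K))" by (subst powr_realpow) auto
    also have "\<dots> \<le> sqrt 2 powr (real q * kmax)"
      using Q(2)[OF that] by (intro powr_mono) (auto intro: mult_left_mono)
    finally show "measure ?N (R K) \<le> exp (- t / 4) * sqrt 2 powr (real q * kmax)" by simp
  qed
  have A: "A = (\<Union>x\<in>{..<q} \<times> {..<q}. S x) \<union> (\<Union>K\<in>F. R K)"
  proof -
    define d where "d = (\<lambda>(i::nat) i' u. \<bar>(\<Sum>j<n. u (i,j) * u (i',j)) - of_bool (i = i') * real n\<bar>)"
    have "A = {u \<in> space ?N. (\<exists>i<q. \<exists>i'<q. s < d i i' u) \<or> (\<exists>K\<in>F. t < fro2 (mat q n u * Q K))}"
      unfolding A_def d_def ..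
    moreover have "S = (\<lambda>(i,i'). {u \<in> space ?N. s < d i i' u})" unfolding S_def d_def ..
    ultimately show ?thesis unfolding R_def by auto
  qed
  have US: "(\<Union>x\<in>{..<q} \<times> {..<q}. S x) \<in> sets ?N" using S by (intro sets.finite_UN) auto
  have UR: "(\<Union>K\<in>F. R K) \<in> sets ?N" using R F by (intro sets.finite_UN) auto
  show "A \<in> sets ?N" unfolding A using US UR by auto
  have "measure ?N A \<le> measure ?N (\<Union>x\<in>{..<q} \<times> {..<q}. S x) + measure ?N (\<Union>K\<in>F. R K)"
    unfolding A using US UR by (rule measure_Un_le)
  also have "measure ?N (\<Union>x\<in>{..<q} \<times> {..<q}. S x) \<le> (\<Sum>x\<in>{..<q} \<times> {..<q}. measure ?N (S x))"
    using S by (intro P.finite_measure_subadditive_finite) auto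
  also have "\<dots> \<le> (\<Sum>x\<in>{..<q} \<times> {..<q}. 2 * real n / s\<^sup>2)" using S by (intro sum_mono) auto
  also have "\<dots> = (real q)\<^sup>2 * (2 * real n / s\<^sup>2)" by (simp add: power2_eq_square)
  also have "measure ?N (\<Union>K\<in>F. R K) \<le> (\<Sum>K\<in>F. measure ?N (R K))"
    using R F by (intro P.finite_measure_subadditive_finite) auto
  also have "\<dots> \<le> (\<Sum>K\<in>F. exp (- t / 4) * sqrt 2 powr (real q * kmax))" using R by (intro sum_mono) auto
  also have "\<dots> = real (card F) * (exp (- t / 4) * sqrt 2 powr (real q * kmax))" by simp
  finally show "measure ?N A \<le> (real q)\<^sup>2 * (2 * real n / s\<^sup>2) + real (card F) * (exp (- t / 4) * sqrt 2 powr (real q * kmax))"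
    by simp
qed

section \<open>Determinants of Gram matrices and the smallest eigenvalue\<close>

lemma det_gram_ge:
  assumes Z: "Z \<in> carrier_mat q n" and L: "L > 0" "\<And>R. R \<in> carrier_mat 1 q \<Longrightarrow> L * fro2 R \<le> fro2 (R * Z)"
    and tr: "fro2 Z \<ge> L * (real q + t)" "t \<ge> 0"
  shows "det (Z * transpose_mat Z) \<ge> L ^ q * (1 + t)"
proof -
  obtain d where d: "\<forall>i<q. \<exists>R \<in> carrier_mat 1 q. fro2 R = 1 \<and> d i = fro2 (R * Z)"
    "det (Z * transpose_mat Z) = (\<Prod>i<q. d i)" "fro2 Z = (\<Sum>i<q. d i)"
    using gram_spectral[OF Z] by blast
  have dL: "d i \<ge> L" if "i < q" for i using d(1) that L(2) by force
  \<comment> \<open>Relative excess of the eigenvalues over \<open>L\<close>. Excess in the trace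
    must show up in the determinant, because a product of factors \<open>1 + e i\<close> is at least
    1 plus their sum.\<close>
  define e where "e = (\<lambda>i. d i / L - 1)"
  have e: "e i \<ge> 0" if "i < q" for i using dL[OF that] L by (simp add: e_def)
  have "1 + t \<le> 1 + (\<Sum>i<q. e i)"
  proof -
    have "(\<Sum>i<q. e i) = fro2 Z / L - real q" by (simp add: e_def sum_subtractf d(3) sum_divide_distrib)
    moreover have "real q + t \<le> fro2 Z / L" using tr L by (simp add: pos_le_divide_eq mult.commute)
    ultimately show ?thesis by simp
  qed
  also have "\<dots> \<le> (\<Prod>i<q. 1 + e i)" by (rule one_plus_sum_le_prod) (simp add: e)
  finally have "L ^ q * (1 + t) \<le> (\<Prod>i<q. L) * (\<Prod>i<q. 1 + e i)" using L by simp
  also have "\<dots> = (\<Prod>i<q. L * (1 + e i))" by (rule prod.distrib[symmetric])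
  also have "\<dots> = (\<Prod>i<q. d i)" using L by (intro prod.cong) (auto simp: e_def)
  finally show ?thesis by (simp add: d)
qed

lemma det_gram_le:
  assumes Z: "Z \<in> carrier_mat q n" and U: "\<And>R. R \<in> carrier_mat 1 q \<Longrightarrow> fro2 (R * Z) \<le> U * fro2 R"
  shows "det (Z * transpose_mat Z) \<le> U ^ q"
proof -
  obtain d where d: "\<forall>i<q. \<exists>R \<in> carrier_mat 1 q. fro2 R = 1 \<and> d i = fro2 (R * Z)"
    "det (Z * transpose_mat Z) = (\<Prod>i<q. d i)"
    using gram_spectral[OF Z] by blast
  have "0 \<le> d i \<and> d i \<le> U" if "i < q" for i using d(1) that U by force
  hence "(\<Prod>i<q. d i) \<le> (\<Prod>i<q. U)" by (intro prod_mono) auto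
  thus ?thesis by (simp add: d)
qed

text \<open>The Rayleigh bound. The diagonal entries in the spectral theorem have to be recognised
  as eigenvalues, and the spectrum as finite, before the \<open>Min\<close> in
  \<open>lam_min\<close> says anything about them.\<close>

lemma lam_min_bound:
  assumes A: "A \<in> carrier_mat q q" "transpose_mat A = A" and q: "q \<ge> 1" and R: "R \<in> carrier_mat m q"
  shows "lam_min (A * transpose_mat A) * fro2 R \<le> fro2 (R * A)"
proof -
  define V where "V = A * transpose_mat A"
  note [simp] = carrier_matD[OF A(1)] carrier_matD[OF R]
  have V: "V \<in> carrier_mat q q" "transpose_mat V = V" by (auto simp: V_def mat_trans_mult)
  note [simp] = carrier_matD[OF V(1)]
  obtain Q d where Q: "Q \<in> carrier_mat q q" "transpose_mat Q * Q = 1\<^sub>m q" "Q * transpose_mat Q = 1\<^sub>m q"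
    "transpose_mat Q * V * Q = diagm q d" using real_spectral[OF V] by blast
  note [simp] = carrier_matD[OF Q(1)]
  have VQ: "V * Q = Q * diagm q d"
  proof -
    have "Q * diagm q d = (Q * transpose_mat Q) * (V * Q)" unfolding Q(4)[symmetric] by (simp add: mat_assoc)
    thus ?thesis by (simp add: Q(3) mat_one_mult)
  qed
  have ev: "eigenvalue V (d i)" if i: "i < q" for i
  proof -
    define v where "v = col Q i"
    have v: "v \<in> carrier_vec q" by (simp add: v_def carrier_vecI)
    have "V *\<^sub>v v = col (V * Q) i" using i unfolding v_def by (intro eq_vecI) auto
    also have "\<dots> = d i \<cdot>\<^sub>v v"
      unfolding VQ v_def using i by (intro eq_vecI) (auto simp: mult_diagm_entry simp del: index_mult_mat(1))
    finally have "V *\<^sub>v v = d i \<cdot>\<^sub>v v" .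
    moreover have "v \<noteq> 0\<^sub>v q"
    proof
      assume "v = 0\<^sub>v q"
      hence z: "Q $$ (k,i) = 0" if "k < q" for k
        using that i by (metis v_def index_col carrier_matD(1,2) Q(1) index_zero_vec(1))
      have "1 = (transpose_mat Q * Q) $$ (i,i)" using i by (simp add: Q(2))
      also have "\<dots> = 0" using i z by (subst mult_entry) auto
      finally show False by simp
    qed
    ultimately show ?thesis using v V by (auto simp: eigenvalue_def eigenvector_def)
  qed
  have fin: "finite {k. eigenvalue V k}" using card_finite_spectrum(1)[OF V(1)] by (simp add: spectrum_def)
  have ld: "lam_min V \<le> d i" if "i < q" for i
    unfolding lam_min_def by (rule Min_le[OF fin]) (simp add: ev[OF that])
  define G where "G = R * Q"
  have [simp]: "dim_row G = m" "dim_col G = q" by (auto simp: G_def)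
  have "fro2 (R * A) = fip R (R * V)"
    unfolding fro2_fip by (subst fip_mult_right_adjoint) (auto simp: V_def mat_assoc)
  also have "R * V = G * diagm q d * transpose_mat Q"
  proof -
    have "G * diagm q d * transpose_mat Q = R * (Q * diagm q d) * transpose_mat Q" by (simp add: G_def mat_assoc)
    also have "\<dots> = R * V * (Q * transpose_mat Q)" by (simp add: VQ[symmetric] mat_assoc)
    finally show ?thesis by (simp add: Q(3) mat_mult_one)
  qed
  also have "fip R (G * diagm q d * transpose_mat Q) = fip (G * diagm q d) G"
    by (subst fip_commute) (auto simp: fip_mult_right_adjoint G_def)
  also have "\<dots> \<ge> lam_min V * fro2 G"
  proof -
    have "lam_min V * fro2 G = (\<Sum>i<m. \<Sum>j<q. lam_min V * (G $$ (i,j))\<^sup>2)"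
      by (simp add: fro2_def sum_distrib_left)
    also have "\<dots> \<le> (\<Sum>i<m. \<Sum>j<q. d j * (G $$ (i,j))\<^sup>2)"
      by (intro sum_mono mult_right_mono ld) auto
    also have "\<dots> = fip (G * diagm q d) G"
      by (simp add: fip_def mult_diagm_entry power2_eq_square mult_ac del: index_mult_mat(1))
    finally show ?thesis .
  qed
  also have "fro2 G = fip (R * (Q * transpose_mat Q)) R"
    unfolding G_def fro2_fip by (subst fip_mult_right_adjoint, simp_all, subst fip_commute, auto simp: mat_assoc)
  also have "\<dots> = fro2 R" by (simp add: Q(3) mat_mult_one fro2_fip)
  finally show ?thesis by (simp add: V_def)
qed

section \<open>The fiducial expectation of the h-function\<close>

lemma gf_expect_bounds:
  assumes Y: "Y \<in> carrier_mat q n" and X: "X \<in> carrier_mat p n" and M: "M \<subseteq> {0..<p}" "M \<noteq> {}"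
    and q: "q \<ge> 1" "n \<ge> 2 * q * card M"
    and pd: "Sigma_hat Y X M \<in> carrier_mat q q" "pos_def_mat (Sigma_hat Y X M)"
    and full: "det (rows_sub X M * transpose_mat (rows_sub X M)) \<noteq> 0" and \<delta>: "\<delta> > 0"
  defines "W \<equiv> inv_sqrt (Sigma_hat Y X M)"
  defines "K \<equiv> 2 ^ (q * card M) * ((1 + \<delta> / q) / (1 + \<delta> / (4 * q))) powr (- (real n / 2))"
  shows "0 \<le> gf_expect Y X M (h_eps \<epsilon> Y X M)" "gf_expect Y X M (h_eps \<epsilon> Y X M) \<le> 1"
    "(\<And>B. B \<in> carrier_mat q (card M) \<Longrightarrow> fro2 (W * (B - B_hat Y X M) * rows_sub X M) < \<delta> \<Longrightarrow> h_eps \<epsilon> Y X M B = 0)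
      \<Longrightarrow> gf_expect Y X M (h_eps \<epsilon> Y X M) \<le> K"
    "(\<And>B. B \<in> carrier_mat q (card M) \<Longrightarrow> fro2 (W * (B - B_hat Y X M) * rows_sub X M) < \<delta> \<Longrightarrow> h_eps \<epsilon> Y X M B = 1)
      \<Longrightarrow> gf_expect Y X M (h_eps \<epsilon> Y X M) \<ge> 1 - K"
proof -
  define m where "m = card M"
  define Z where "Z = rows_sub X M"
  define Bh where "Bh = B_hat Y X M"
  have fin: "finite M" using M finite_subset by blast
  have m: "m \<ge> 1" using fin M(2) by (simp add: m_def Suc_le_eq card_gt_0_iff)
  have Z: "Z \<in> carrier_mat m n" unfolding Z_def m_def by (rule rows_sub_dims(1)[OF X M(1)])
  note [simp] = carrier_matD[OF Y] carrier_matD[OF X] carrier_matD[OF Z]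
  have "Z * transpose_mat Z \<in> carrier_mat m m" by auto
  note G = mat_inv_props[OF this full[folded Z_def]]
  have Bh: "Bh \<in> carrier_mat q m"
    unfolding Bh_def B_hat_def Z_def[symmetric] using carrier_matD[OF G(1)] by (intro carrier_matI) auto
  note W = pos_def_inv_sqrt[OF pd, folded W_def]
  have dW: "det W \<noteq> 0"
  proof
    assume "det W = 0"
    hence "det (W * W * Sigma_hat Y X M) = 0"
      using W(1) pd(1) det_mult[OF W(1,1)] det_mult[of "W * W" q "Sigma_hat Y X M"] by simp
    thus False by (simp add: W(4))
  qed
  define T where "T = (\<lambda>b. W * (mat q m b - Bh) * Z)"
  define g where "g = (\<lambda>b. det (1\<^sub>m q + T b * transpose_mat (T b)) powr (- (real n / 2)))"
  have n: "n \<ge> 2 * q * m" using q by (simp add: m_def)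
  have K: "K = 2 ^ (q * m) * ((1 + \<delta> / q) / (1 + \<delta> / (4 * q))) powr (- (real n / 2))" "K \<ge> 0" by (simp_all add: K_def m_def)
  have int: "integrable (mat_lebesgue q m) g" "(\<integral>b. g b \<partial>mat_lebesgue q m) > 0"
    "(\<integral>\<^sup>+b. ennreal (g b) * indicator {b \<in> space (mat_lebesgue q m). \<delta> \<le> fro2 (T b)} b \<partial>mat_lebesgue q m)
      \<le> ennreal K * (\<integral>\<^sup>+b. ennreal (g b) \<partial>mat_lebesgue q m)"
    "{b \<in> space (mat_lebesgue q m). \<delta> \<le> fro2 (T b)} \<in> sets (mat_lebesgue q m)"
    unfolding K(1) g_def T_def
    by (rule gf_density_integrals[OF q(1) m n W(1) dW Bh Z full[folded Z_def] \<delta>])+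
  have dens: "gf_dens Y X M (mat q m b) = g b" for b
    unfolding g_def T_def Bh_def Z_def
    by (rule gf_dens_eq[OF Y X M(1) W(1-3) dW]) (use Bh in \<open>auto simp: m_def Bh_def\<close>)
  define f where "f = (\<lambda>b. h_eps \<epsilon> Y X M (mat q m b))"
  have f: "f \<in> borel_measurable (mat_lebesgue q m)" "\<And>b. 0 \<le> f b" "\<And>b. f b \<le> 1"
    using measurable_h_eps[OF X M(1) Y, of \<epsilon>] W(1) by (auto simp: f_def m_def W_def h_eps_def)
  have E: "gf_expect Y X M (h_eps \<epsilon> Y X M) = (\<integral>b. f b * g b \<partial>mat_lebesgue q m) / (\<integral>b. g b \<partial>mat_lebesgue q m)"
    by (simp add: gf_expect_def Let_def m_def[symmetric] dens f_def)
  have g0: "g b \<ge> 0" for b by (simp add: g_def)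
  note bounds = integral_ratio_bounds[where P = "\<lambda>b. \<delta> \<le> fro2 (T b)", OF int(1) g0 int(2) f int(4) int(3) K(2)]
  show "0 \<le> gf_expect Y X M (h_eps \<epsilon> Y X M)" unfolding E by (rule bounds(1))
  show "gf_expect Y X M (h_eps \<epsilon> Y X M) \<le> 1" unfolding E by (rule bounds(4))
  show "gf_expect Y X M (h_eps \<epsilon> Y X M) \<le> K"
    if h: "\<And>B. B \<in> carrier_mat q (card M) \<Longrightarrow> fro2 (W * (B - B_hat Y X M) * rows_sub X M) < \<delta> \<Longrightarrow> h_eps \<epsilon> Y X M B = 0"
    unfolding E by (rule bounds(2)) (use h[of "mat q m _"] in \<open>auto simp: f_def T_def m_def Bh_def Z_def\<close>)
  show "gf_expect Y X M (h_eps \<epsilon> Y X M) \<ge> 1 - K"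
    if h: "\<And>B. B \<in> carrier_mat q (card M) \<Longrightarrow> fro2 (W * (B - B_hat Y X M) * rows_sub X M) < \<delta> \<Longrightarrow> h_eps \<epsilon> Y X M B = 1"
    unfolding E by (rule bounds(3)) (use h[of "mat q m _"] in \<open>auto simp: f_def T_def m_def Bh_def Z_def\<close>)
qed

text \<open>The density estimates start at one column, so the empty model is treated apart.
  Truncated subtraction makes \<open>card {} - 1\<close> equal to 0; the zero competitor is
  admissible and fits exactly, so the h-function vanishes.\<close>

lemma gf_expect_empty:
  assumes "Y \<in> carrier_mat q n" "X \<in> carrier_mat p n" "\<epsilon> > 0"
  shows "gf_expect Y X {} (h_eps \<epsilon> Y X {}) = 0"
proof -
  have "h_eps \<epsilon> Y X {} (mat q 0 b) = 0" for b
  proof -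
    note d = rows_sub_dims[OF assms(2) empty_subsetI]
    let ?C = "mat q 0 b * rows_sub X {}" and ?W = "inv_sqrt (Sigma_hat Y X {})"
    have C: "?C = 0\<^sub>m q n" using d by (intro eq_matI) (auto simp: mult_entry simp del: index_mult_mat(1))
    have "min_sparse_fit ?W ?C X 0 \<le> fro2 (?W * (?C - 0\<^sub>m q p * X))"
      by (rule min_sparse_fit_le) (use d assms in \<open>auto simp: nz_cols_def cong: conj_cong\<close>)
    also have "?C - 0\<^sub>m q p * X = 0\<^sub>m q n" unfolding C using assms by (intro eq_matI) auto
    also have "fro2 (?W * 0\<^sub>m q n) = 0" by (simp add: fro2_def scalar_prod_def)
    finally show ?thesis using assms(3) by (auto simp: h_eps_def)
  qed
  thus ?thesis using assms(1) by (simp add: gf_expect_def)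
qed

section \<open>Ratios of multivariate gamma functions\<close>

lemma Gamma_real_mono: "3/2 \<le> x \<Longrightarrow> x \<le> y \<Longrightarrow> Gamma x \<le> Gamma (y::real)"
  using Gamma_real_strict_mono[of x y] by (cases "x = y") auto

text \<open>A crude bound suffices, since \<open>n powr (n powr \<alpha>)\<close> is subexponential for \<open>\<alpha> < 1\<close>.\<close>
lemma Gamma_shift_le:
  fixes x y N d :: real
  assumes x: "3/2 \<le> x" and y: "3/2 \<le> y" and xN: "x + d \<le> N" and d: "d \<ge> 0" "y - x \<le> d"
  shows "Gamma y \<le> N powr (d + 1) * Gamma x"
proof -
  have N: "N \<ge> 1" using x xN d by simp
  define k where "k = nat \<lfloor>d\<rfloor>"
  have k: "real k \<le> d" "d < real k + 1" using d by (auto simp: k_def)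
  show ?thesis
  proof (cases "y \<le> x")
    case True
    hence "Gamma y \<le> 1 * Gamma x" using Gamma_real_mono[OF y] by simp
    also have "\<dots> \<le> N powr (d + 1) * Gamma x"
      using N d x by (intro mult_right_mono ge_one_powr_ge_zero) auto
    finally show ?thesis .
  next
    case False
    \<comment> \<open>Round the gap up to \<open>k + 1\<close> steps of the recurrence; every factor
      \<open>x + i\<close> with \<open>i \<le> k\<close> stays below \<open>x + d\<close>, hence
      below \<open>N\<close>.\<close>
    have "Gamma y \<le> Gamma (x + real (k + 1))" using k d y by (intro Gamma_real_mono) auto
    also have "Gamma (x + real (k + 1)) = pochhammer x (k + 1) * Gamma x"
    proof -
      have "pochhammer x (k + 1) = Gamma (x + real (k + 1)) / Gamma x"
        using x by (intro pochhammer_Gamma) (auto elim!: nonpos_Ints_cases)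
      moreover have "Gamma x > 0" using x by (intro Gamma_real_pos) auto
      ultimately show ?thesis by simp
    qed
    also have "pochhammer x (k + 1) = (\<Prod>i<k+1. x + real i)" by (simp add: pochhammer_prod lessThan_atLeast0)
    also have "\<dots> \<le> (\<Prod>i<k+1. N)" using x xN k by (intro prod_mono) auto
    also have "\<dots> = N powr real (k + 1)" using N by (subst powr_realpow) auto
    also have "\<dots> \<le> N powr (d + 1)" using N k by (intro powr_mono) auto
    finally show ?thesis using x by simp
  qed
qed

lemma mgamma_pos: "a > (real q - 1) / 2 \<Longrightarrow> mgamma q a > 0"
  unfolding mgamma_def by (intro mult_pos_pos prod_pos) (auto intro!: Gamma_real_pos simp: field_simps)

lemma mgamma_shift_le:
  assumes "real m \<le> mx" "real mo \<le> mx" "mx + real q \<le> real n / 2" "real n \<ge> 8"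
  shows "mgamma q ((real n - real m) / 2) \<le> (real n powr (mx + 1)) ^ q * mgamma q ((real n - real mo) / 2)"
proof -
  have "(\<Prod>j = 1..q. Gamma ((real n - real m) / 2 + (1 - real j) / 2)) \<le>
    (\<Prod>j = 1..q. real n powr (mx + 1) * Gamma ((real n - real mo) / 2 + (1 - real j) / 2))"
  proof (intro prod_mono conjI)
    fix j assume "j \<in> {1..q}"
    hence j: "1 \<le> real j" "real j \<le> real q" by auto
    show "0 \<le> Gamma ((real n - real m) / 2 + (1 - real j) / 2)"
      using j assms by (intro Gamma_real_nonneg) (simp add: field_simps)
    \<comment> \<open>The shift is \<open>d = mx\<close>, with \<open>N = n\<close>. The conditions
      \<open>mx + q \<le> n / 2\<close> and \<open>n \<ge> 8\<close> keep both arguments above 3/2,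
      where Gamma is monotone.\<close>
    show "Gamma ((real n - real m) / 2 + (1 - real j) / 2) \<le> real n powr (mx + 1) * Gamma ((real n - real mo) / 2 + (1 - real j) / 2)"
      using j assms by (intro Gamma_shift_le) (simp_all add: field_simps)
  qed
  also have "\<dots> = (real n powr (mx + 1)) ^ q * (\<Prod>j = 1..q. Gamma ((real n - real mo) / 2 + (1 - real j) / 2))"
    by (simp add: prod.distrib)
  finally have "pi powr (real q * (real q - 1) / 4) * (\<Prod>j = 1..q. Gamma ((real n - real m) / 2 + (1 - real j) / 2)) \<le>
    pi powr (real q * (real q - 1) / 4) * ((real n powr (mx + 1)) ^ q * (\<Prod>j = 1..q. Gamma ((real n - real mo) / 2 + (1 - real j) / 2)))"
    by (intro mult_left_mono) auto
  thus ?thesis unfolding mgamma_def by (simp only: mult.left_commute mult.assoc)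
qed

section \<open>The deterministic comparison on the good event\<close>

text \<open>Here \<open>mx\<close> stands for \<open>n powr \<alpha>\<close>, \<open>\<eta>\<close> is the tolerance for the noise and \<open>\<rho>\<close> the exponential rate of the
  comparison; \<open>gram\<close> and \<open>proj\<close> describe the good event, everything else is a condition on the design.\<close>
locale gf_sample =
  fixes q p n :: nat and X B0 A0 :: "real mat" and Mo :: "nat set" and u :: "nat \<times> nat \<Rightarrow> real"
    and \<eta> \<epsilon> mx \<rho> :: real
  assumes X: "X \<in> carrier_mat p n" and Mo: "Mo \<subseteq> {0..<p}" and B0: "B0 \<in> carrier_mat q (card Mo)"
    and A0: "A0 \<in> carrier_mat q q" "pos_def_mat A0" and q: "q \<ge> 1" and \<epsilon>: "\<epsilon> > 0"
    and lam: "lam_min (A0 * transpose_mat A0) > 0"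
    and \<eta>: "0 < \<eta>" "\<eta> \<le> 1/8" "\<eta> \<le> \<epsilon> / 100"
    and mx: "real (card Mo) \<le> mx" "mx + real q \<le> real n / 2" "real n \<ge> 8" "2 * real q * mx \<le> real n"
    and full_Mo: "det (rows_sub X Mo * transpose_mat (rows_sub X Mo)) \<noteq> 0"
    and C4: "1 / (36 * real q * (real n - real (card Mo)))
               * min_sparse_fit (inv_sqrt (A0 * transpose_mat A0)) (B0 * rows_sub X Mo) X (card Mo - 1) > \<epsilon>"
    and C5: "\<And>M. M \<subseteq> {0..<p} \<Longrightarrow> \<not> M \<subseteq> Mo \<Longrightarrow> real (card M) \<le> mx \<Longrightarrow>
               9 / (lam_min (A0 * transpose_mat A0) * (real n - real (card M)))
               * Min ((\<lambda>j. fro2 (B0 * rows_sub X Mo * (H_proj X M - H_proj X (M - {j})))) ` M) < \<epsilon>"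
    and gram: "\<And>i i'. i < q \<Longrightarrow> i' < q \<Longrightarrow>
       \<bar>(\<Sum>j<n. u (i,j) * u (i',j)) - of_bool (i = i') * real n\<bar> \<le> \<eta> * real n / real q"
    and proj: "\<And>K. K \<subseteq> {0..<p} \<Longrightarrow> real (card K) \<le> 2 * mx \<Longrightarrow>
       \<exists>k. \<exists>Q \<in> carrier_mat n k. rows_sub X K * (Q * transpose_mat Q) = rows_sub X K \<and>
         (Q * transpose_mat Q) * (Q * transpose_mat Q) = Q * transpose_mat Q \<and>
         fro2 (mat q n u * Q) \<le> \<eta> * real n"
    and \<rho>: "\<rho> > 1" "\<rho> \<le> (1 + (\<epsilon>/4) / q) / (1 + (\<epsilon>/4) / (4 * q))" "\<rho>\<^sup>2 \<le> 1 + 16 * \<epsilon>"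
       "(((1 + \<eta>) / (1 - 2 * \<eta>)) ^ q)\<^sup>2 \<le> \<rho>"
    and small: "2 powr (real q * mx) * \<rho> powr (- (real n / 2)) \<le> 1/2"
begin

definition "U = mat q n u"
definition "Y = resp X B0 Mo A0 u"
definition "Ai = mat_inv A0"
definition "C0 = B0 * rows_sub X Mo"
definition "C = Ai * C0"
definition "H M = H_proj X M"
text \<open>The residual in coordinates where the noise is isotropic: for a full model,
  \<open>A0 * Z M\<close> is the residual of \<open>Y\<close>, and \<open>Sigma_hat\<close> is its
  Gram matrix.\<close>

definition "Z M = (C + U) * (1\<^sub>m n - H M)"
definition "full M \<longleftrightarrow> M \<subseteq> {0..<p} \<and> det (rows_sub X M * transpose_mat (rows_sub X M)) \<noteq> 0"
text \<open>One \<open>\<eta>\<close> is the error of the noise Gram matrix, the other the noise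
  lost to the joint projection.\<close>

definition "lo = (1 - 2 * \<eta>) * real n"

lemma Ai: "Ai \<in> carrier_mat q q" "A0 * Ai = 1\<^sub>m q" "Ai * A0 = 1\<^sub>m q" "transpose_mat Ai = Ai"
  "inv_sqrt (A0 * transpose_mat A0) = Ai" "transpose_mat A0 = A0"
  using mat_inv_props[OF A0(1) pos_def_det[OF A0]] inv_sqrt_square[OF A0] A0
  by (auto simp: Ai_def pos_def_mat_def)

lemma dims [simp]: "dim_row X = p" "dim_col X = n" "dim_row A0 = q" "dim_col A0 = q" "dim_row B0 = q" "dim_col B0 = card Mo"
  "dim_row Ai = q" "dim_col Ai = q" "dim_row U = q" "dim_col U = n" "dim_row C0 = q" "dim_col C0 = n"
  "dim_row C = q" "dim_col C = n" "dim_row Y = q" "dim_col Y = n"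
  using carrier_matD[OF X] carrier_matD[OF A0(1)] carrier_matD[OF B0] carrier_matD[OF Ai(1)] rows_sub_dims[OF X Mo]
  by (auto simp: U_def C0_def C_def Y_def resp_def)

lemma Y_eq: "Y = C0 + A0 * U"
  by (simp add: Y_def resp_def C0_def U_def)

lemma Y_eq': "Y = A0 * (C + U)"
  by (simp add: Y_eq C_def mat_mult_add mat_assoc[symmetric] Ai(2) mat_one_mult)

lemma n_pos: "real n > 0" using mx by simp

lemma lo_pos: "lo > 0" "lo \<ge> 3/4 * real n"
  using \<eta> n_pos by (auto simp: lo_def)

lemma full_Mo': "full Mo" using full_Mo Mo by (simp add: full_def)

lemma full_sub: "full M \<Longrightarrow> L \<subseteq> M \<Longrightarrow> full L"
  using full_rank_subset[OF X] by (auto simp: full_def)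

lemma H_props:
  assumes "full M"
  shows "H M = transpose_mat (rows_sub X M) * mat_inv (rows_sub X M * transpose_mat (rows_sub X M)) * rows_sub X M"
    "H M \<in> carrier_mat n n" "transpose_mat (H M) = H M" "H M * H M = H M" "rows_sub X M * H M = rows_sub X M"
    "dim_row (H M) = n" "dim_col (H M) = n"
proof -
  have "M \<subseteq> {0..<p}" and d: "det (rows_sub X M * transpose_mat (rows_sub X M)) \<noteq> 0"
    using assms by (auto simp: full_def)
  note props = row_proj_full_rank[OF rows_sub_dims(1)[OF X this(1)] d, folded H_proj_def, folded H_def]
  show "H M = transpose_mat (rows_sub X M) * mat_inv (rows_sub X M * transpose_mat (rows_sub X M)) * rows_sub X M"
    "H M \<in> carrier_mat n n" "transpose_mat (H M) = H M" "H M * H M = H M" "rows_sub X M * H M = rows_sub X M"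
    "dim_row (H M) = n" "dim_col (H M) = n"
    using props carrier_matD[OF props(2)] by simp_all
qed

lemma H_mult:
  assumes "full M" and P: "P \<in> carrier_mat n n" "rows_sub X M * P = rows_sub X M"
  shows "H M * P = H M"
proof -
  have "M \<subseteq> {0..<p}" and d: "det (rows_sub X M * transpose_mat (rows_sub X M)) \<noteq> 0" using assms(1) by (auto simp: full_def)
  note r = rows_sub_dims[OF X this(1)]
  have "rows_sub X M * transpose_mat (rows_sub X M) \<in> carrier_mat (card M) (card M)" using r by auto
  note G = mat_inv_props[OF this d]
  note [simp] = r(2,3) carrier_matD[OF G(1)] carrier_matD[OF P(1)]
  show ?thesis unfolding H_props(1)[OF assms(1)] by (simp add: mat_assoc P(2))
qed

lemma H_mult_H: "full M \<Longrightarrow> L \<subseteq> M \<Longrightarrow> H L * H M = H L"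
  using rows_sub_mult_eqI[OF X _ _ _ H_props(2,5)] full_sub[of M L]
  by (intro H_mult H_props) (auto simp: full_def)

lemma H_mult_H': "full M \<Longrightarrow> L \<subseteq> M \<Longrightarrow> H M * H L = H L"
  using arg_cong[OF H_mult_H, of M L transpose_mat] H_props(3,6,7)[of M] H_props(3,6,7)[OF full_sub, of M L]
  by (simp add: mat_trans_mult)

lemma C_mult:
  assumes P: "P \<in> carrier_mat n n" "rows_sub X Mo * P = rows_sub X Mo"
  shows "C * P = C" "C0 * P = C0"
  using rows_sub_dims[OF X Mo] carrier_matD[OF P(1)] by (simp_all add: C_def C0_def mat_assoc P(2))

lemma sum_rows_fro2: "A \<in> carrier_mat k q \<Longrightarrow> fro2 A = (\<Sum>a<k. \<Sum>i<q. (A $$ (a,i))\<^sup>2)"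
  by (simp add: fro2_def)

text \<open>Entrywise errors add up to a factor \<open>q\<close> in the quadratic form, by
  Cauchy-Schwarz on the row sums of absolute values; hence the division by \<open>q\<close> in the
  assumption \<open>gram\<close>.\<close>

lemma gram_bounds:
  assumes R: "R \<in> carrier_mat k q"
  shows "(1 - \<eta>) * real n * fro2 R \<le> fro2 (R * U)" "fro2 (R * U) \<le> (1 + \<eta>) * real n * fro2 R"
proof -
  note [simp] = carrier_matD[OF R]
  define s where "s = (\<lambda>i i'. (\<Sum>j<n. u (i,j) * u (i',j)) - of_bool (i = i') * real n)"
  have "fro2 (R * U) = (\<Sum>a<k. \<Sum>j<n. (\<Sum>i<q. R $$ (a,i) * u (i,j))\<^sup>2)"
    by (simp add: fro2_def mult_entry U_def del: index_mult_mat(1))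
  also have "\<dots> = (\<Sum>a<k. \<Sum>i<q. \<Sum>i'<q. R $$ (a,i) * R $$ (a,i') * (\<Sum>j<n. u (i,j) * u (i',j)))"
  proof (rule sum.cong[OF refl])
    fix a
    have "(\<Sum>j<n. (\<Sum>i<q. R $$ (a,i) * u (i,j))\<^sup>2) = (\<Sum>j<n. \<Sum>i<q. \<Sum>i'<q. R $$ (a,i) * R $$ (a,i') * (u (i,j) * u (i',j)))"
      by (simp add: power2_eq_square sum_product mult_ac)
    also have "\<dots> = (\<Sum>i<q. \<Sum>j<n. \<Sum>i'<q. R $$ (a,i) * R $$ (a,i') * (u (i,j) * u (i',j)))"
      by (rule sum.swap)
    also have "\<dots> = (\<Sum>i<q. \<Sum>i'<q. \<Sum>j<n. R $$ (a,i) * R $$ (a,i') * (u (i,j) * u (i',j)))"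
      by (rule sum.cong[OF refl]) (rule sum.swap)
    finally show "(\<Sum>j<n. (\<Sum>i<q. R $$ (a,i) * u (i,j))\<^sup>2) = (\<Sum>i<q. \<Sum>i'<q. R $$ (a,i) * R $$ (a,i') * (\<Sum>j<n. u (i,j) * u (i',j)))"
      by (simp add: sum_distrib_left)
  qed
  also have "\<dots> = (\<Sum>a<k. \<Sum>i<q. \<Sum>i'<q. (if i = i' then real n * (R $$ (a,i))\<^sup>2 else 0) + R $$ (a,i) * R $$ (a,i') * s i i')"
    by (intro sum.cong refl) (simp add: s_def power2_eq_square algebra_simps)
  also have "\<dots> = real n * fro2 R + (\<Sum>a<k. \<Sum>i<q. \<Sum>i'<q. R $$ (a,i) * R $$ (a,i') * s i i')"
    by (simp add: sum.distrib sum_rows_fro2[OF R] sum_distrib_left)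
  finally have eq: "fro2 (R * U) = real n * fro2 R + (\<Sum>a<k. \<Sum>i<q. \<Sum>i'<q. R $$ (a,i) * R $$ (a,i') * s i i')" .
  have "\<bar>\<Sum>a<k. \<Sum>i<q. \<Sum>i'<q. R $$ (a,i) * R $$ (a,i') * s i i'\<bar> \<le> (\<Sum>a<k. \<Sum>i<q. \<Sum>i'<q. \<bar>R $$ (a,i)\<bar> * \<bar>R $$ (a,i')\<bar> * (\<eta> * real n / real q))"
  proof -
    have "\<bar>\<Sum>a<k. \<Sum>i<q. \<Sum>i'<q. R $$ (a,i) * R $$ (a,i') * s i i'\<bar> \<le> (\<Sum>a<k. \<Sum>i<q. \<Sum>i'<q. \<bar>R $$ (a,i) * R $$ (a,i') * s i i'\<bar>)"
      by (rule order.trans[OF sum_abs sum_mono], rule order.trans[OF sum_abs sum_mono], rule sum_abs)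
    also have "\<dots> \<le> (\<Sum>a<k. \<Sum>i<q. \<Sum>i'<q. \<bar>R $$ (a,i)\<bar> * \<bar>R $$ (a,i')\<bar> * (\<eta> * real n / real q))"
      unfolding abs_mult s_def by (intro sum_mono mult_left_mono gram) auto
    finally show ?thesis .
  qed
  also have "\<dots> = (\<eta> * real n / real q) * (\<Sum>a<k. (\<Sum>i<q. \<bar>R $$ (a,i)\<bar>)\<^sup>2)"
    by (simp add: sum_distrib_left power2_eq_square sum_product mult_ac)
  also have "\<dots> \<le> (\<eta> * real n / real q) * (\<Sum>a<k. real q * (\<Sum>i<q. (R $$ (a,i))\<^sup>2))"
  proof (intro mult_left_mono sum_mono)
    fix a
    have "(\<Sum>i<q. \<bar>R $$ (a,i)\<bar>)\<^sup>2 = (\<Sum>i<q. \<bar>R $$ (a,i)\<bar> * 1)\<^sup>2" by simp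
    also have "\<dots> \<le> (\<Sum>i<q. \<bar>R $$ (a,i)\<bar>\<^sup>2) * (\<Sum>i<q. 1\<^sup>2)" by (rule Cauchy_Schwarz_ineq_sum)
    finally show "(\<Sum>i<q. \<bar>R $$ (a,i)\<bar>)\<^sup>2 \<le> real q * (\<Sum>i<q. (R $$ (a,i))\<^sup>2)" by (simp add: mult.commute)
  qed (use \<eta> in auto)
  also have "\<dots> = \<eta> * real n * fro2 R"
    using q by (simp add: sum_rows_fro2[OF R] sum_distrib_left[symmetric])
  finally show "(1 - \<eta>) * real n * fro2 R \<le> fro2 (R * U)" "fro2 (R * U) \<le> (1 + \<eta>) * real n * fro2 R"
    unfolding eq by (auto simp: algebra_simps abs_le_iff)
qed

text \<open>Applied to the union of a model with \<open>Mo\<close>, which may be rank deficient, so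
  \<open>P\<close> comes from the factor \<open>Q\<close> and not from \<open>H_proj\<close>. The
  single bound on \<open>U * P\<close> serves all row combinations by submultiplicativity.\<close>

lemma joint_projection:
  assumes "K \<subseteq> {0..<p}" "real (card K) \<le> 2 * mx"
  obtains P where "P \<in> carrier_mat n n" "transpose_mat P = P" "P * P = P" "rows_sub X K * P = rows_sub X K"
    "\<And>k R. R \<in> carrier_mat k q \<Longrightarrow> fro2 (R * U * P) \<le> \<eta> * real n * fro2 R"
    "fro2 (U * P) \<le> \<eta> * real n"
proof -
  obtain k Q where Q: "Q \<in> carrier_mat n k" "rows_sub X K * (Q * transpose_mat Q) = rows_sub X K"
    "(Q * transpose_mat Q) * (Q * transpose_mat Q) = Q * transpose_mat Q" "fro2 (mat q n u * Q) \<le> \<eta> * real n"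
    using proj[OF assms] by blast
  note [simp] = carrier_matD[OF Q(1)]
  define P where "P = Q * transpose_mat Q"
  have P: "P \<in> carrier_mat n n" "transpose_mat P = P" "P * P = P"
    using Q(3) by (auto simp: P_def mat_trans_mult)
  note [simp] = carrier_matD[OF P(1)]
  have le: "fro2 (A * P) = fro2 (A * Q)" if "dim_col A = n" for A
  proof -
    have "fro2 (A * P) = fip (A * Q * transpose_mat Q) A"
      using that by (subst fro2_proj_eq[OF P that], subst fip_commute) (auto simp: P_def mat_assoc)
    also have "\<dots> = fro2 (A * Q)" using that unfolding fro2_fip by (subst fip_mult_right_adjoint) auto
    finally show ?thesis .
  qed
  have "fro2 (R * U * P) \<le> \<eta> * real n * fro2 R" if "R \<in> carrier_mat j q" for j R
  proof -
    note [simp] = carrier_matD[OF that]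
    have "fro2 (R * U * P) = fro2 (R * (U * Q))" by (subst le) (auto simp: mat_assoc)
    also have "\<dots> \<le> fro2 R * fro2 (U * Q)" by (rule fro2_mult_le) simp
    also have "\<dots> \<le> fro2 R * (\<eta> * real n)" using Q(4) by (intro mult_left_mono) (auto simp: U_def)
    finally show ?thesis by (simp add: mult.commute)
  qed
  moreover have "fro2 (U * P) \<le> \<eta> * real n" using Q(4) by (simp add: le U_def[symmetric])
  ultimately show ?thesis using that P Q(2) by (auto simp: P_def)
qed

lemma residual_projection:
  assumes P: "P \<in> carrier_mat n n" "transpose_mat P = P" "P * P = P"
    and RU: "\<And>k R. R \<in> carrier_mat k q \<Longrightarrow> fro2 (R * U * P) \<le> \<eta> * real n * fro2 R" and R: "R \<in> carrier_mat k q"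
  shows "lo * fro2 R \<le> fro2 (R * U * (1\<^sub>m n - P))"
proof -
  note [simp] = carrier_matD[OF R]
  have "fro2 (R * U) = fro2 (R * U * P) + fro2 (R * U * (1\<^sub>m n - P))"
    by (rule fro2_pythagoras[OF P]) simp
  thus ?thesis using gram_bounds(1)[OF R] RU[OF R] by (simp add: lo_def algebra_simps)
qed

lemma Z_dims [simp]:
  assumes "full M"
  shows "dim_row (Z M) = q" "dim_col (Z M) = n" "Z M \<in> carrier_mat q n"
proof -
  show d: "dim_row (Z M) = q" "dim_col (Z M) = n" by (simp_all add: Z_def H_props(7)[OF assms])
  show "Z M \<in> carrier_mat q n" by (intro carrier_matI d)
qed

lemma mult_complement:
  fixes M1 P :: "real mat"
  assumes "M1 * P = M1" "dim_col M1 = n" "P \<in> carrier_mat n n"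
  shows "M1 * (1\<^sub>m n - P) = 0\<^sub>m (dim_row M1) n"
proof -
  have "M1 * (1\<^sub>m n - P) = M1 * 1\<^sub>m n - M1 * P" using assms by (intro mat_mult_minus) auto
  also have "\<dots> = M1 - M1" using assms by (simp add: mat_mult_one)
  also have "\<dots> = 0\<^sub>m (dim_row M1) n" using assms(2) by (intro eq_matI) auto
  finally show ?thesis .
qed

text \<open>Outside the joint row space both the signal and the effect of \<open>H M\<close>
  disappear, and only the noise is left.\<close>

lemma Z_complement:
  assumes "full M" and P: "P \<in> carrier_mat n n" "rows_sub X M * P = rows_sub X M" "rows_sub X Mo * P = rows_sub X Mo"
  shows "Z M * (1\<^sub>m n - P) = U * (1\<^sub>m n - P)"
proof -
  note [simp] = carrier_matD[OF P(1)] H_props(6,7)[OF assms(1)]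
  have HP: "H M * (1\<^sub>m n - P) = 0\<^sub>m n n"
    using mult_complement[OF H_mult[OF assms(1) P(1,2)]] P(1) by simp
  have CP: "C * (1\<^sub>m n - P) = 0\<^sub>m q n"
    using mult_complement[OF C_mult(1)[OF P(1,3)]] P(1) by simp
  have "(1\<^sub>m n - H M) * (1\<^sub>m n - P) = (1\<^sub>m n - P) - 0\<^sub>m n n"
    unfolding HP[symmetric] by (simp add: mat_minus_mult mat_one_mult)
  also have "\<dots> = 1\<^sub>m n - P" by (intro eq_matI) auto
  finally have "Z M * (1\<^sub>m n - P) = (C + U) * (1\<^sub>m n - P)" by (simp add: Z_def mat_assoc)
  also have "\<dots> = 0\<^sub>m q n + U * (1\<^sub>m n - P)" unfolding CP[symmetric] by (simp add: mat_add_mult)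
  also have "\<dots> = U * (1\<^sub>m n - P)" by (intro eq_matI) auto
  finally show ?thesis .
qed

text \<open>Project away the joint row space of \<open>M\<close> and \<open>Mo\<close>: this can
  only shorten \<open>R * Z M\<close>, and what remains is pure noise. So missed signal never lowers
  the bound.\<close>

lemma Z_lower:
  assumes M: "full M" "real (card M) \<le> mx" and R: "R \<in> carrier_mat k q"
  shows "lo * fro2 R \<le> fro2 (R * Z M)"
proof -
  have Mp: "M \<subseteq> {0..<p}" using M by (simp add: full_def)
  have K: "M \<union> Mo \<subseteq> {0..<p}" using Mp Mo by blast
  have "card (M \<union> Mo) \<le> card M + card Mo" by (rule card_Un_le)
  hence le: "real (card (M \<union> Mo)) \<le> 2 * mx" using M(2) mx(1) by linarith
  obtain P where P: "P \<in> carrier_mat n n" "transpose_mat P = P" "P * P = P" "rows_sub X (M \<union> Mo) * P = rows_sub X (M \<union> Mo)"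
    "\<And>k R. R \<in> carrier_mat k q \<Longrightarrow> fro2 (R * U * P) \<le> \<eta> * real n * fro2 R" "fro2 (U * P) \<le> \<eta> * real n"
    by (rule joint_projection[OF K le]) (rule that)
  note [simp] = carrier_matD[OF P(1)] carrier_matD[OF R]
  have "lo * fro2 R \<le> fro2 (R * U * (1\<^sub>m n - P))" by (rule residual_projection[OF P(1-3,5) R])
  also have "R * U * (1\<^sub>m n - P) = R * Z M * (1\<^sub>m n - P)"
    using Z_complement[OF M(1) P(1) rows_sub_mult_eqI[OF X Mp _ K P(1,4)] rows_sub_mult_eqI[OF X Mo _ K P(1,4)]] M(1)
    by (simp add: mat_assoc)
  also have "fro2 (R * Z M * (1\<^sub>m n - P)) \<le> fro2 (R * Z M)"
    by (rule fro2_proj_le[OF proj_complement[OF P(1-3)]]) (use M(1) in simp)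
  finally show ?thesis .
qed

lemma Z_Mo: "Z Mo = U * (1\<^sub>m n - H Mo)"
proof -
  note H = H_props[OF full_Mo']
  note [simp] = H(6,7)
  have "Z Mo = C * (1\<^sub>m n - H Mo) + U * (1\<^sub>m n - H Mo)" by (simp add: Z_def mat_add_mult)
  also have "C * (1\<^sub>m n - H Mo) = 0\<^sub>m q n" using mult_complement[OF C_mult(1)[OF H(2,5)]] H(2) by simp
  also have "0\<^sub>m q n + U * (1\<^sub>m n - H Mo) = U * (1\<^sub>m n - H Mo)" by (intro eq_matI) auto
  finally show ?thesis .
qed

lemma Z_Mo_upper:
  assumes R: "R \<in> carrier_mat k q"
  shows "fro2 (R * Z Mo) \<le> (1 + \<eta>) * real n * fro2 R"
proof -
  note H = H_props[OF full_Mo']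
  note [simp] = H(6,7) carrier_matD[OF R]
  have "fro2 (R * Z Mo) = fro2 (R * U * (1\<^sub>m n - H Mo))" by (simp add: Z_Mo mat_assoc)
  also have "\<dots> \<le> fro2 (R * U)" by (rule fro2_proj_le[OF proj_complement[OF H(2-4)]]) simp
  also have "\<dots> \<le> (1 + \<eta>) * real n * fro2 R" by (rule gram_bounds(2)[OF R])
  finally show ?thesis .
qed

lemma Sigma_eq:
  assumes "full M"
  shows "Sigma_hat Y X M = (A0 * Z M) * transpose_mat (A0 * Z M)" "Sigma_hat Y X M \<in> carrier_mat q q"
proof -
  note H = H_props[OF assms]
  note [simp] = H(6,7) Z_dims[OF assms]
  note I = proj_complement[OF H(2-4)]
  note [simp] = carrier_matD[OF I(1)]
  have AZ: "A0 * Z M = Y * (1\<^sub>m n - H M)" by (simp add: Y_eq' Z_def mat_assoc)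
  have "(A0 * Z M) * transpose_mat (A0 * Z M) = Y * ((1\<^sub>m n - H M) * (1\<^sub>m n - H M)) * transpose_mat Y"
    unfolding AZ by (simp add: mat_trans_mult I(2) mat_assoc)
  thus "Sigma_hat Y X M = (A0 * Z M) * transpose_mat (A0 * Z M)"
    by (simp add: I(3) Sigma_hat_def H_def[symmetric])
  thus "Sigma_hat Y X M \<in> carrier_mat q q" by (intro carrier_matI) auto
qed

lemma Sigma_pos_def:
  assumes "full M" "real (card M) \<le> mx"
  shows "pos_def_mat (Sigma_hat Y X M)"
  unfolding pos_def_iff[OF Sigma_eq(2)[OF assms(1)]]
proof (intro conjI ballI impI)
  note [simp] = Z_dims[OF assms(1)]
  show "transpose_mat (Sigma_hat Y X M) = Sigma_hat Y X M"
    unfolding Sigma_eq(1)[OF assms(1)] by (subst mat_trans_mult) auto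
  fix R :: "real mat" assume R: "R \<in> carrier_mat 1 q" "R \<noteq> 0\<^sub>m 1 q"
  note [simp] = carrier_matD[OF R(1)]
  have RA: "R * A0 \<in> carrier_mat 1 q" by (intro carrier_matI) auto
  have "fip (R * Sigma_hat Y X M) R = fip (R * (A0 * Z M) * transpose_mat (A0 * Z M)) R"
    unfolding Sigma_eq(1)[OF assms(1)] by (simp add: mat_assoc)
  also have "\<dots> = fro2 (R * (A0 * Z M))" unfolding fro2_fip by (subst fip_mult_right_adjoint) auto
  also have "\<dots> = fro2 (R * A0 * Z M)" by (simp add: mat_assoc)
  also have "\<dots> \<ge> lo * fro2 (R * A0)" by (rule Z_lower[OF assms RA])
  finally have ge: "lo * fro2 (R * A0) \<le> fip (R * Sigma_hat Y X M) R" .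
  have "R * A0 \<noteq> 0\<^sub>m 1 q"
  proof
    assume "R * A0 = 0\<^sub>m 1 q"
    hence "R * (A0 * Ai) = 0\<^sub>m 1 q * Ai" by (simp add: mat_assoc[symmetric])
    thus False using R(2) Ai(1) by (simp add: Ai(2) mat_mult_one)
  qed
  hence "fro2 (R * A0) \<noteq> 0" by (subst fro2_0_iff) simp
  hence "fro2 (R * A0) > 0" using fro2_nonneg[of "R * A0"] by linarith
  hence "0 < lo * fro2 (R * A0)" using lo_pos by simp
  thus "0 < fip (R * Sigma_hat Y X M) R" using ge by simp
qed

definition "W M = inv_sqrt (Sigma_hat Y X M)"

lemma W_props:
  assumes "full M" "real (card M) \<le> mx"
  shows "W M \<in> carrier_mat q q" "transpose_mat (W M) = W M" "dim_row (W M) = q" "dim_col (W M) = q"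
  using pos_def_inv_sqrt[OF Sigma_eq(2) Sigma_pos_def] assms by (auto simp: W_def)

lemma W_le:
  assumes "full M" "real (card M) \<le> mx" "A \<in> carrier_mat q k"
  shows "lo * fro2 (W M * A) \<le> fro2 (Ai * A)"
proof (rule fro2_inv_sqrt_le[OF A0(1) Ai(6,1,2) Z_dims(3)[OF assms(1)] W_props(1,2)[OF assms(1,2)] _ lo_pos(1) _ assms(3)])
  show "W M * W M * (A0 * Z M * transpose_mat (A0 * Z M)) = 1\<^sub>m q"
    using pos_def_inv_sqrt(4)[OF Sigma_eq(2)[OF assms(1)] Sigma_pos_def[OF assms(1,2)]]
    by (simp add: W_def Sigma_eq(1)[OF assms(1), symmetric])
  show "lo * fro2 R \<le> fro2 (R * Z M)" if "R \<in> carrier_mat k q" for R by (rule Z_lower[OF assms(1,2) that])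
qed

text \<open>The upper bound on the residual rests on \<open>Mo\<close> removing the whole signal. It
  is what transfers (C4) to the norm used by the h-function.\<close>

lemma W_Mo_ge:
  assumes "A \<in> carrier_mat q k"
  shows "fro2 (Ai * A) \<le> (1 + \<eta>) * real n * fro2 (W Mo * A)"
proof (rule fro2_inv_sqrt_ge[OF A0(1) Ai(6,1,3,4) Z_dims(3)[OF full_Mo'] W_props(1,2)[OF full_Mo' mx(1)] _ _ _ assms])
  show "A0 * Z Mo * transpose_mat (A0 * Z Mo) * (W Mo * W Mo) = 1\<^sub>m q"
    using pos_def_inv_sqrt(5)[OF Sigma_eq(2)[OF full_Mo'] Sigma_pos_def[OF full_Mo' mx(1)]]
    by (simp add: W_def Sigma_eq(1)[OF full_Mo', symmetric])
  show "(1 + \<eta>) * real n > 0" using \<eta> n_pos by simp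
  show "fro2 (R * Z Mo) \<le> (1 + \<eta>) * real n * fro2 R" if "R \<in> carrier_mat k q" for R by (rule Z_Mo_upper[OF that])
qed

text \<open>(C5) is stated in the plain Frobenius norm, with the smallest eigenvalue as factor; this
  passes to the whitened norm.\<close>

lemma Ai_lam:
  assumes "A \<in> carrier_mat q k"
  shows "lam_min (A0 * transpose_mat A0) * fro2 (Ai * A) \<le> fro2 A"
proof -
  note [simp] = carrier_matD[OF assms]
  have "lam_min (A0 * transpose_mat A0) * fro2 (transpose_mat (Ai * A)) \<le> fro2 (transpose_mat (Ai * A) * A0)"
    by (rule lam_min_bound[OF A0(1) Ai(6) q, of _ k]) (auto intro!: carrier_matI)
  also have "transpose_mat (Ai * A) * A0 = transpose_mat (A0 * (Ai * A))"
    by (simp add: mat_trans_mult[of A0 "Ai * A"] Ai(6))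
  also have "A0 * (Ai * A) = A" by (simp add: mat_assoc[symmetric] Ai(2) mat_one_mult)
  finally show ?thesis by simp
qed

lemma noise_le:
  assumes "full M" "real (card M) \<le> mx"
  shows "fro2 (U * H M) \<le> \<eta> * real n"
proof -
  have Mp: "M \<subseteq> {0..<p}" using assms by (simp add: full_def)
  have le: "real (card M) \<le> 2 * mx" using assms(2) by linarith
  obtain P where P: "P \<in> carrier_mat n n" "transpose_mat P = P" "P * P = P" "rows_sub X M * P = rows_sub X M"
    "\<And>k R. R \<in> carrier_mat k q \<Longrightarrow> fro2 (R * U * P) \<le> \<eta> * real n * fro2 R" "fro2 (U * P) \<le> \<eta> * real n"
    by (rule joint_projection[OF Mp le]) (rule that)
  note H = H_props[OF assms(1)]
  note [simp] = H(6,7) carrier_matD[OF P(1)]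
  have "P * H M = H M"
    using arg_cong[OF H_mult[OF assms(1) P(1,4)], of transpose_mat] by (simp add: mat_trans_mult P(2) H(3))
  hence "fro2 (U * H M) = fro2 (U * P * H M)" by (simp add: mat_assoc)
  also have "\<dots> \<le> fro2 (U * P)" by (rule fro2_proj_le[OF H(2-4)]) simp
  finally show ?thesis using P(6) by simp
qed

lemma BhX:
  assumes "full M"
  shows "B_hat Y X M * rows_sub X M = Y * H M" "B_hat Y X M \<in> carrier_mat q (card M)"
proof -
  have Mp: "M \<subseteq> {0..<p}" and d: "det (rows_sub X M * transpose_mat (rows_sub X M)) \<noteq> 0" using assms by (auto simp: full_def)
  note r = rows_sub_dims[OF X Mp]
  have "rows_sub X M * transpose_mat (rows_sub X M) \<in> carrier_mat (card M) (card M)" using r by auto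
  note G = mat_inv_props[OF this d]
  note [simp] = r(2,3) carrier_matD[OF G(1)]
  show "B_hat Y X M * rows_sub X M = Y * H M" unfolding B_hat_def H_props(1)[OF assms] by (simp add: mat_assoc)
  show "B_hat Y X M \<in> carrier_mat q (card M)" unfolding B_hat_def by (intro carrier_matI) auto
qed

lemma embed_H:
  assumes "full L" "E \<in> carrier_mat q n"
  shows "\<exists>B \<in> carrier_mat q p. nz_cols B \<le> card L \<and> B * X = E * H L"
proof -
  have Lp: "L \<subseteq> {0..<p}" and d: "det (rows_sub X L * transpose_mat (rows_sub X L)) \<noteq> 0" using assms by (auto simp: full_def)
  note r = rows_sub_dims[OF X Lp]
  have "rows_sub X L * transpose_mat (rows_sub X L) \<in> carrier_mat (card L) (card L)" using r by auto
  note G = mat_inv_props[OF this d]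
  note [simp] = r(2,3) carrier_matD[OF G(1)] carrier_matD[OF assms(2)]
  let ?E = "E * transpose_mat (rows_sub X L) * mat_inv (rows_sub X L * transpose_mat (rows_sub X L))"
  have "?E \<in> carrier_mat q (card L)" by (intro carrier_matI) auto
  moreover have "?E * rows_sub X L = E * H L" unfolding H_props(1)[OF assms(1)] by (simp add: mat_assoc)
  ultimately show ?thesis using embed_columns[OF X Lp, of ?E q] by auto
qed

lemma sqrt_le_mult_sqrt: "x \<le> c\<^sup>2 * \<epsilon> \<Longrightarrow> c \<ge> 0 \<Longrightarrow> sqrt x \<le> c * sqrt \<epsilon>"
  using \<epsilon> real_sqrt_le_mono[of x "c\<^sup>2 * \<epsilon>"] by (simp add: real_sqrt_mult)

lemma mult_sqrt_le: "c\<^sup>2 * \<epsilon> \<le> x \<Longrightarrow> c \<ge> 0 \<Longrightarrow> c * sqrt \<epsilon> \<le> sqrt x"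
  using \<epsilon> real_sqrt_le_mono[of "c\<^sup>2 * \<epsilon>" x] by (simp add: real_sqrt_mult)

text \<open>With \<open>lo \<ge> 3/4 * n\<close> and \<open>\<eta> \<le> \<epsilon> / 100\<close>
  the squared norm is at most \<open>\<epsilon> / 75\<close>, below the required
  \<open>\<epsilon> / 25\<close>.\<close>

lemma fluctuation_le:
  assumes "full M" "real (card M) \<le> mx" "D \<in> carrier_mat n n" "fro2 (U * D) \<le> \<eta> * real n"
  shows "sqrt (fro2 (W M * (A0 * (U * D)))) \<le> 1/5 * sqrt \<epsilon>"
proof (rule sqrt_le_mult_sqrt)
  note [simp] = carrier_matD[OF assms(3)]
  have "A0 * (U * D) \<in> carrier_mat q n" by (intro carrier_matI) auto
  from W_le[OF assms(1,2) this]
  have "lo * fro2 (W M * (A0 * (U * D))) \<le> fro2 (U * D)"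
    by (simp add: mat_assoc[of Ai A0, symmetric] Ai(3) mat_one_mult)
  also have "\<dots> \<le> \<eta> * real n" by (rule assms(4))
  also have "\<dots> \<le> \<epsilon> / 100 * real n" using \<eta> by (intro mult_right_mono) auto
  finally have "lo * fro2 (W M * (A0 * (U * D))) \<le> \<epsilon> / 100 * real n" .
  moreover have "3/4 * real n * fro2 (W M * (A0 * (U * D))) \<le> lo * fro2 (W M * (A0 * (U * D)))"
    using lo_pos by (intro mult_right_mono) auto
  ultimately have "3/4 * fro2 (W M * (A0 * (U * D))) * real n \<le> \<epsilon> / 100 * real n" by (simp add: mult_ac)
  hence "3/4 * fro2 (W M * (A0 * (U * D))) \<le> \<epsilon> / 100" using n_pos by simp
  thus "fro2 (W M * (A0 * (U * D))) \<le> (1/5)\<^sup>2 * \<epsilon>" using \<epsilon> by (simp add: power2_eq_square)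
qed simp

text \<open>The competitor is the fit of \<open>Y\<close> on \<open>L\<close>, the model
  \<open>M\<close> without the column \<open>j\<close> from (C5). With \<open>D = H M - H L\<close>
  the distance to it splits into the deviation of \<open>B\<close> from \<open>B_hat\<close>, the
  signal \<open>C0 * D\<close> and the noise \<open>A0 * (U * D)\<close>. In units of
  \<open>sqrt \<epsilon>\<close> they are at most 1/2 (tail radius \<open>\<epsilon> / 4\<close>),
  2/5 (from 4/27 \<open>\<le>\<close> 4/25) and 1/5. The square of their sum 11/10 is 121/100, less
  than the threshold 2.\<close>

lemma h_zero:
  assumes M: "full M" "real (card M) \<le> mx" "\<not> M \<subseteq> Mo" and B: "B \<in> carrier_mat q (card M)"
    and T: "fro2 (W M * (B - B_hat Y X M) * rows_sub X M) < \<epsilon> / 4"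
  shows "h_eps \<epsilon> Y X M B = 0"
proof -
  have Mp: "M \<subseteq> {0..<p}" using M by (simp add: full_def)
  have fin: "finite M" using Mp finite_subset by blast
  have ne: "M \<noteq> {}" using M(3) by auto
  let ?f = "\<lambda>j. fro2 (C0 * (H M - H (M - {j})))"
  have "Min (?f ` M) \<in> ?f ` M" using fin ne by (intro Min_in) auto
  then obtain j where j: "j \<in> M" "Min (?f ` M) = ?f j" by auto
  let ?lam = "lam_min (A0 * transpose_mat A0)"
  have nM: "real n - real (card M) > 0" using M(2) mx by simp
  have c5: "9 / (?lam * (real n - real (card M))) * ?f j < \<epsilon>"
    using C5[OF Mp M(3,2)] unfolding j(2)[symmetric] by (simp add: C0_def H_def)
  define L where "L = M - {j}"
  have L: "full L" "L \<subseteq> M" using full_sub[OF M(1), of L] by (auto simp: L_def)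
  have cardL: "card L = card M - 1" using j fin by (simp add: L_def)
  define D where "D = H M - H L"
  note HM = H_props[OF M(1)] and HL = H_props[OF L(1)]
  note r = rows_sub_dims[OF X Mp]
  note Bh = BhX[OF M(1)]
  note [simp] = HM(6,7) HL(6,7) r(2,3) carrier_matD[OF B] carrier_matD[OF Bh(2)] W_props(3,4)[OF M(1,2)]
  have D: "D \<in> carrier_mat n n" unfolding D_def by (intro carrier_matI) auto
  note [simp] = carrier_matD[OF D]
  have UD: "fro2 (U * D) \<le> \<eta> * real n"
  proof -
    have "U * D = U * H M * (1\<^sub>m n - H L)"
      by (simp add: D_def mat_mult_minus mat_mult_one mat_assoc H_mult_H'[OF M(1) L(2)])
    hence "fro2 (U * D) = fro2 (U * H M * (1\<^sub>m n - H L))" by simp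
    also have "\<dots> \<le> fro2 (U * H M)" by (rule fro2_proj_le[OF proj_complement[OF HL(2-4)]]) simp
    also have "\<dots> \<le> \<eta> * real n" by (rule noise_le[OF M(1,2)])
    finally show ?thesis .
  qed
  have s2: "sqrt (fro2 (W M * (C0 * D))) \<le> 2/5 * sqrt \<epsilon>"
  proof (rule sqrt_le_mult_sqrt)
    have CD: "C0 * D \<in> carrier_mat q n" by (intro carrier_matI) auto
    have "?lam * (lo * fro2 (W M * (C0 * D))) \<le> ?lam * fro2 (Ai * (C0 * D))"
      using W_le[OF M(1,2) CD] lam by (intro mult_left_mono) auto
    also have "\<dots> \<le> fro2 (C0 * D)" by (rule Ai_lam[OF CD])
    also have "\<dots> \<le> \<epsilon> / 9 * (?lam * (real n - real (card M)))"
      using c5 nM lam by (simp add: D_def L_def divide_less_eq mult_ac)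
    also have "\<dots> = ?lam * (\<epsilon> / 9 * (real n - real (card M)))" by simp
    finally have "lo * fro2 (W M * (C0 * D)) \<le> \<epsilon> / 9 * (real n - real (card M))" using lam by (simp only: mult_le_cancel_left_pos)
    also have "\<dots> \<le> \<epsilon> / 9 * real n" using \<epsilon> by (intro mult_left_mono) auto
    finally have "lo * fro2 (W M * (C0 * D)) \<le> \<epsilon> / 9 * real n" .
    moreover have "3/4 * real n * fro2 (W M * (C0 * D)) \<le> lo * fro2 (W M * (C0 * D))"
      using lo_pos by (intro mult_right_mono) auto
    ultimately have "3/4 * fro2 (W M * (C0 * D)) * real n \<le> \<epsilon> / 9 * real n" by (simp add: mult_ac)
    hence "3/4 * fro2 (W M * (C0 * D)) \<le> \<epsilon> / 9" using n_pos by simp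
    thus "fro2 (W M * (C0 * D)) \<le> (2/5)\<^sup>2 * \<epsilon>" using \<epsilon> by (simp add: power2_eq_square)
  qed simp
  have s1: "sqrt (fro2 (W M * ((B - B_hat Y X M) * rows_sub X M))) \<le> 1/2 * sqrt \<epsilon>"
    by (rule sqrt_le_mult_sqrt) (use T in \<open>auto simp: mat_assoc power2_eq_square\<close>)
  have s3: "sqrt (fro2 (W M * (A0 * (U * D)))) \<le> 1/5 * sqrt \<epsilon>" by (rule fluctuation_le[OF M(1,2) D UD])
  have Yc: "Y \<in> carrier_mat q n" by (intro carrier_matI) auto
  obtain B' where B': "B' \<in> carrier_mat q p" "nz_cols B' \<le> card L" "B' * X = Y * H L" using embed_H[OF L(1) Yc] by blast
  have decomp: "B * rows_sub X M - B' * X = (B - B_hat Y X M) * rows_sub X M + (C0 * D + A0 * (U * D))"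
  proof -
    have "C0 * D + A0 * (U * D) = Y * D" by (simp add: Y_eq mat_add_mult mat_assoc)
    also have "\<dots> = Y * H M - Y * H L" by (simp add: D_def mat_mult_minus)
    finally have "(B - B_hat Y X M) * rows_sub X M + (C0 * D + A0 * (U * D)) = (B * rows_sub X M - Y * H M) + (Y * H M - Y * H L)"
      by (simp add: mat_minus_mult Bh(1))
    also have "\<dots> = B * rows_sub X M - Y * H L" by (intro eq_matI) auto
    finally show ?thesis by (simp add: B'(3))
  qed
  have "sqrt (fro2 (W M * (B * rows_sub X M - B' * X))) = sqrt (fro2 (W M * ((B - B_hat Y X M) * rows_sub X M) + (W M * (C0 * D) + W M * (A0 * (U * D)))))"
    unfolding decomp by (simp add: mat_mult_add)
  also have "\<dots> \<le> sqrt (fro2 (W M * ((B - B_hat Y X M) * rows_sub X M))) + sqrt (fro2 (W M * (C0 * D) + W M * (A0 * (U * D))))"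
    by (rule fro2_add_le) auto
  also have "sqrt (fro2 (W M * (C0 * D) + W M * (A0 * (U * D)))) \<le> sqrt (fro2 (W M * (C0 * D))) + sqrt (fro2 (W M * (A0 * (U * D))))"
    by (rule fro2_add_le) auto
  finally have "sqrt (fro2 (W M * (B * rows_sub X M - B' * X))) \<le> 11/10 * sqrt \<epsilon>" using s1 s2 s3 by simp
  hence "(sqrt (fro2 (W M * (B * rows_sub X M - B' * X))))\<^sup>2 \<le> (11/10 * sqrt \<epsilon>)\<^sup>2" by (intro power_mono) auto
  hence "fro2 (W M * (B * rows_sub X M - B' * X)) \<le> 121/100 * \<epsilon>" using \<epsilon> by (simp add: power_mult_distrib power2_eq_square)
  moreover have "min_sparse_fit (W M) (B * rows_sub X M) X (card M - 1) \<le> fro2 (W M * (B * rows_sub X M - B' * X))"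
    by (rule min_sparse_fit_le) (use B' cardL in auto)
  ultimately have "min_sparse_fit (W M) (B * rows_sub X M) X (card M - 1) < 2 * \<epsilon>" using \<epsilon> by simp
  thus ?thesis by (simp add: h_eps_def W_def)
qed

text \<open>The constant 36 of (C4) drops to 18 because \<open>n - card Mo\<close> is at least
  \<open>n / 2\<close>.\<close>

lemma signal:
  assumes "B' \<in> carrier_mat q p" "nz_cols B' \<le> card Mo - 1"
  shows "18 * real q * \<epsilon> * real n \<le> fro2 (Ai * (C0 - B' * X))"
proof -
  have nM: "real n / 2 \<le> real n - real (card Mo)" "real n - real (card Mo) > 0" using mx by auto
  have "\<epsilon> < 1 / (36 * real q * (real n - real (card Mo))) * min_sparse_fit Ai C0 X (card Mo - 1)"
    using C4 by (simp add: Ai(5) C0_def)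
  hence "\<epsilon> * (36 * real q * (real n - real (card Mo))) < min_sparse_fit Ai C0 X (card Mo - 1)"
    using q nM by (simp add: less_divide_eq)
  also have "\<dots> \<le> fro2 (Ai * (C0 - B' * X))" by (rule min_sparse_fit_le) (use assms in auto)
  finally have 1: "\<epsilon> * (36 * real q * (real n - real (card Mo))) < fro2 (Ai * (C0 - B' * X))" .
  have "18 * real q * \<epsilon> * real n = \<epsilon> * (36 * real q * (real n / 2))" by simp
  also have "\<dots> \<le> \<epsilon> * (36 * real q * (real n - real (card Mo)))"
    using \<epsilon> nM by (intro mult_left_mono) auto
  finally show ?thesis using 1 by linarith
qed

text \<open>For an empty \<open>Mo\<close> the signal is 0 and \<open>card Mo - 1\<close> is again
  0, so the zero competitor would contradict (C4).\<close>

lemma Mo_nonempty: "Mo \<noteq> {}"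
proof
  assume e: "Mo = {}"
  have "18 * real q * \<epsilon> * real n \<le> fro2 (Ai * (C0 - 0\<^sub>m q p * X))"
    by (rule signal) (auto simp: nz_cols_def cong: conj_cong)
  also have "C0 - 0\<^sub>m q p * X = 0\<^sub>m q n"
  proof (intro eq_matI)
    fix i j assume "i < dim_row (0\<^sub>m q n :: real mat)" "j < dim_col (0\<^sub>m q n :: real mat)"
    hence ij: "i < q" "j < n" by auto
    have c: "card Mo = 0" by (simp add: e)
    have "C0 $$ (i,j) = (\<Sum>k<card Mo. B0 $$ (i,k) * rows_sub X Mo $$ (k,j))"
      unfolding C0_def using ij rows_sub_dims[OF X Mo] by (subst mult_entry) auto
    hence "C0 $$ (i,j) = 0" by (simp only: c lessThan_0 sum.empty)
    moreover have "(0\<^sub>m q p * X) $$ (i,j) = 0" using ij by (subst mult_entry) auto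
    ultimately show "(C0 - 0\<^sub>m q p * X) $$ (i,j) = (0\<^sub>m q n :: real mat) $$ (i,j)"
      using ij by (subst index_minus_mat) auto
  qed auto
  also have "fro2 (Ai * 0\<^sub>m q n) = 0" by (simp add: fro2_def scalar_prod_def)
  finally have "18 * real q * \<epsilon> * real n \<le> 0" .
  moreover have "18 * real q * \<epsilon> * real n > 0" using q \<epsilon> n_pos by simp
  ultimately show False by simp
qed

text \<open>In units of \<open>sqrt \<epsilon>\<close>: the factor 18 divided by
  \<open>1 + \<eta> \<le> 9/8\<close> leaves a signal of at least 4, and the deviation of
  \<open>B\<close> and the noise remove at most 1/2 + 1/5. More than 2 remains, whereas the
  threshold is the square root of 2.\<close>

lemma h_one:
  assumes B: "B \<in> carrier_mat q (card Mo)"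
    and T: "fro2 (W Mo * (B - B_hat Y X Mo) * rows_sub X Mo) < \<epsilon> / 4"
  shows "h_eps \<epsilon> Y X Mo B = 1"
proof -
  note HM = H_props[OF full_Mo']
  note r = rows_sub_dims[OF X Mo]
  note Bh = BhX[OF full_Mo']
  note [simp] = HM(6,7) r(2,3) carrier_matD[OF B] carrier_matD[OF Bh(2)] W_props(3,4)[OF full_Mo' mx(1)]
  have s1: "sqrt (fro2 (W Mo * ((B - B_hat Y X Mo) * rows_sub X Mo))) \<le> 1/2 * sqrt \<epsilon>"
    by (rule sqrt_le_mult_sqrt) (use T in \<open>auto simp: mat_assoc power2_eq_square\<close>)
  have s3: "sqrt (fro2 (W Mo * (A0 * (U * H Mo)))) \<le> 1/5 * sqrt \<epsilon>"
    by (rule fluctuation_le[OF full_Mo' mx(1) HM(2) noise_le[OF full_Mo' mx(1)]])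
  have "2 * \<epsilon> \<le> fro2 (W Mo * (B * rows_sub X Mo - B' * X))"
    if B': "B' \<in> carrier_mat q p" "nz_cols B' \<le> card Mo - 1" for B'
  proof -
    note [simp] = carrier_matD[OF B'(1)]
    have CB: "C0 - B' * X \<in> carrier_mat q n" by (intro carrier_matI) auto
    have "16 * \<epsilon> * real n * (9/8) \<le> 18 * real q * \<epsilon> * real n"
      using q \<epsilon> n_pos by simp
    also have "\<dots> \<le> fro2 (Ai * (C0 - B' * X))" by (rule signal[OF B'])
    also have "\<dots> \<le> (1 + \<eta>) * real n * fro2 (W Mo * (C0 - B' * X))" by (rule W_Mo_ge[OF CB])
    also have "\<dots> \<le> 9/8 * real n * fro2 (W Mo * (C0 - B' * X))" using \<eta> by (intro mult_right_mono) auto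
    finally have "(9/8 * real n) * (16 * \<epsilon>) \<le> (9/8 * real n) * fro2 (W Mo * (C0 - B' * X))" by (simp add: mult_ac)
    hence "16 * \<epsilon> \<le> fro2 (W Mo * (C0 - B' * X))" using n_pos by (subst (asm) mult_le_cancel_left_pos) auto
    hence s2: "4 * sqrt \<epsilon> \<le> sqrt (fro2 (W Mo * (C0 - B' * X)))" by (intro mult_sqrt_le) auto
    have decomp: "B * rows_sub X Mo - B' * X = (C0 - B' * X) + ((B - B_hat Y X Mo) * rows_sub X Mo + A0 * (U * H Mo))"
    proof -
      have "Y * H Mo = C0 + A0 * (U * H Mo)" using C_mult(2)[OF HM(2,5)] by (simp add: Y_eq mat_add_mult mat_assoc)
      hence "(B - B_hat Y X Mo) * rows_sub X Mo + A0 * (U * H Mo) = (B * rows_sub X Mo - (C0 + A0 * (U * H Mo))) + A0 * (U * H Mo)"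
        by (simp add: mat_minus_mult Bh(1))
      also have "\<dots> = B * rows_sub X Mo - C0" by (intro eq_matI) auto
      finally have "(C0 - B' * X) + ((B - B_hat Y X Mo) * rows_sub X Mo + A0 * (U * H Mo)) = (C0 - B' * X) + (B * rows_sub X Mo - C0)" by simp
      also have "\<dots> = B * rows_sub X Mo - B' * X" by (intro eq_matI) auto
      finally show ?thesis by simp
    qed
    have "sqrt (fro2 (W Mo * ((B - B_hat Y X Mo) * rows_sub X Mo) + W Mo * (A0 * (U * H Mo)))) \<le> 1/2 * sqrt \<epsilon> + 1/5 * sqrt \<epsilon>"
      by (rule order.trans[OF fro2_add_le add_mono[OF s1 s3]]) auto
    moreover have "sqrt (fro2 (W Mo * (B * rows_sub X Mo - B' * X))) \<ge>
       sqrt (fro2 (W Mo * (C0 - B' * X))) - sqrt (fro2 (W Mo * ((B - B_hat Y X Mo) * rows_sub X Mo) + W Mo * (A0 * (U * H Mo))))"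
    proof -
      have "W Mo * (B * rows_sub X Mo - B' * X) = W Mo * (C0 - B' * X) + (W Mo * ((B - B_hat Y X Mo) * rows_sub X Mo) + W Mo * (A0 * (U * H Mo)))"
        unfolding decomp by (simp add: mat_mult_add)
      thus ?thesis using fro2_add_ge[of "W Mo * (C0 - B' * X)"] by simp
    qed
    ultimately have "2 * sqrt \<epsilon> \<le> sqrt (fro2 (W Mo * (B * rows_sub X Mo - B' * X)))"
      using s2 real_sqrt_gt_zero[OF \<epsilon>] by linarith
    hence "(2 * sqrt \<epsilon>)\<^sup>2 \<le> (sqrt (fro2 (W Mo * (B * rows_sub X Mo - B' * X))))\<^sup>2" using \<epsilon> by (intro power_mono) auto
    thus ?thesis using \<epsilon> by (simp add: power_mult_distrib)
  qed
  hence "2 * \<epsilon> \<le> min_sparse_fit (W Mo) (B * rows_sub X Mo) X (card Mo - 1)"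
    unfolding min_sparse_fit_ge_iff by auto
  moreover have "real (card Mo) < real n - real q" using mx by simp
  ultimately show ?thesis by (simp add: h_eps_def W_def)
qed

definition "v = (det A0)\<^sup>2"
text \<open>Common lower bound for the determinants of all full models of size at most
  \<open>mx\<close>, used as reference scale; it does not depend on the sample beyond its
  size.\<close>

definition "a = v * lo ^ q"

lemma v_pos: "v > 0" using pos_def_det[OF A0] by (simp add: v_def)
lemma a_pos: "a > 0" using v_pos lo_pos by (simp add: a_def)

lemma det_Sigma: "full M \<Longrightarrow> det (Sigma_hat Y X M) = v * det (Z M * transpose_mat (Z M))"
proof -
  assume M: "full M"
  note [simp] = Z_dims[OF M]
  have ZZ: "Z M * transpose_mat (Z M) \<in> carrier_mat q q" by (intro carrier_matI) auto
  have "Sigma_hat Y X M = A0 * (Z M * transpose_mat (Z M)) * A0"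
    unfolding Sigma_eq(1)[OF M] by (simp add: mat_trans_mult Ai(6) mat_assoc)
  also have "det \<dots> = det A0 * det (Z M * transpose_mat (Z M)) * det A0"
    using A0(1) ZZ by (simp add: det_mult[of _ q])
  finally show ?thesis by (simp add: v_def power2_eq_square)
qed

lemma det_Sigma_ge:
  assumes "full M" "real (card M) \<le> mx"
  shows "a \<le> det (Sigma_hat Y X M)"
proof -
  have "fro2 (1\<^sub>m q * Z M) \<ge> lo * fro2 (1\<^sub>m q)" by (rule Z_lower[OF assms one_carrier_mat])
  moreover have "fro2 (1\<^sub>m q) = real q"
    by (simp add: fro2_def if_distrib[where f="\<lambda>x. x ^ _"] cong: if_cong)
  ultimately have "det (Z M * transpose_mat (Z M)) \<ge> lo ^ q * (1 + 0)"
    using assms lo_pos by (intro det_gram_ge[OF Z_dims(3)] Z_lower) (auto simp: mat_one_mult)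
  thus ?thesis using v_pos by (simp add: det_Sigma[OF assms(1)] a_def)
qed

lemma det_Sigma_Mo_le: "det (Sigma_hat Y X Mo) \<le> a * ((1 + \<eta>) / (1 - 2 * \<eta>)) ^ q"
proof -
  have "det (Z Mo * transpose_mat (Z Mo)) \<le> ((1 + \<eta>) * real n) ^ q"
    by (intro det_gram_le[OF Z_dims(3)[OF full_Mo']] Z_Mo_upper)
  also have "(1 + \<eta>) * real n = lo * ((1 + \<eta>) / (1 - 2 * \<eta>))" using \<eta> by (simp add: lo_def)
  finally have "v * det (Z Mo * transpose_mat (Z Mo)) \<le> v * (lo * ((1 + \<eta>) / (1 - 2 * \<eta>))) ^ q"
    using v_pos by simp
  thus ?thesis by (simp only: det_Sigma[OF full_Mo'] a_def power_mult_distrib mult.assoc)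
qed

text \<open>Split \<open>Z M\<close> by \<open>H Mo\<close>. The part orthogonal to the rows of
  \<open>Mo\<close> equals \<open>Z Mo\<close> and already has trace at least \<open>lo * q\<close>;
  the part inside carries the signal that \<open>M\<close> misses. This excess of trace raises the
  determinant through \<open>det_gram_ge\<close>.\<close>

lemma det_Sigma_sub_ge:
  assumes "M \<subset> Mo"
  shows "a * (1 + 16 * \<epsilon>) \<le> det (Sigma_hat Y X M)"
proof -
  have M: "full M" using full_sub[OF full_Mo'] assms by blast
  have finMo: "finite Mo" using Mo finite_subset by blast
  have cM: "card M < card Mo" using assms finMo by (rule psubset_card_mono[rotated])
  hence mM: "real (card M) \<le> mx" using mx(1) by linarith
  note HM = H_props[OF M] and HP = H_props[OF full_Mo']
  have MP: "H M * H Mo = H M" using H_mult_H[OF full_Mo'] assms by blast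
  note [simp] = HM(6,7) HP(6,7) Z_dims[OF M]
  define D where "D = H Mo - H M"
  have [simp]: "dim_row D = n" "dim_col D = n" by (auto simp: D_def)
  have ZP: "Z M * H Mo = C * (1\<^sub>m n - H M) + U * D"
  proof -
    have "(1\<^sub>m n - H M) * H Mo = D" by (simp add: mat_minus_mult mat_one_mult MP D_def)
    hence "Z M * H Mo = C * D + U * D" by (simp add: Z_def mat_assoc mat_add_mult)
    also have "C * D = C * (1\<^sub>m n - H M)"
      by (simp add: D_def mat_mult_minus mat_mult_one C_mult(1)[OF HP(2,5)])
    finally show ?thesis .
  qed
  have cs: "18 * real q * \<epsilon> * real n \<le> fro2 (C * (1\<^sub>m n - H M))"
  proof -
    have "C0 \<in> carrier_mat q n" by (intro carrier_matI) auto
    from embed_H[OF M this] obtain B' where B': "B' \<in> carrier_mat q p" "nz_cols B' \<le> card M" "B' * X = C0 * H M" by blast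
    have "18 * real q * \<epsilon> * real n \<le> fro2 (Ai * (C0 - B' * X))" by (rule signal[OF B'(1)]) (use B'(2) cM in simp)
    also have "Ai * (C0 - B' * X) = C * (1\<^sub>m n - H M)"
      unfolding B'(3) by (simp add: C_def mat_mult_minus mat_mult_one mat_assoc)
    finally show ?thesis .
  qed
  have ud: "fro2 (U * D) \<le> \<eta> * real n"
  proof -
    have PM: "H Mo * H M = H M" using H_mult_H'[OF full_Mo'] assms by blast
    have "U * D = U * H Mo * (1\<^sub>m n - H M)"
      by (simp add: D_def mat_mult_minus mat_mult_one mat_assoc PM)
    hence "fro2 (U * D) = fro2 (U * H Mo * (1\<^sub>m n - H M))" by simp
    also have "\<dots> \<le> fro2 (U * H Mo)" by (rule fro2_proj_le[OF proj_complement[OF HM(2-4)]]) simp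
    also have "\<dots> \<le> \<eta> * real n" by (rule noise_le[OF full_Mo' mx(1)])
    finally show ?thesis .
  qed
  define w where "w = sqrt (real q * \<epsilon> * real n)"
  have w: "w > 0" "w\<^sup>2 = real q * \<epsilon> * real n" using q \<epsilon> n_pos by (auto simp: w_def)
  \<comment> \<open>The square of 42/10 is 17.64, below 18. After subtracting the noise, at most
    \<open>w / 10\<close>, more than \<open>4 * w\<close> is left, whence the 16.\<close>
  have "42/10 * w \<le> sqrt (fro2 (C * (1\<^sub>m n - H M)))"
  proof (rule real_le_rsqrt)
    have "(42/10 * w)\<^sup>2 = 1764/100 * (real q * \<epsilon> * real n)" by (simp add: power_mult_distrib w(2) power_divide)
    also have "\<dots> \<le> 18 * (real q * \<epsilon> * real n)" using q \<epsilon> n_pos by (intro mult_right_mono) auto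
    finally show "(42/10 * w)\<^sup>2 \<le> fro2 (C * (1\<^sub>m n - H M))" using cs by (simp add: mult.assoc)
  qed
  moreover have "sqrt (fro2 (U * D)) \<le> 1/10 * w"
  proof (rule real_le_lsqrt)
    have "\<eta> * real n \<le> (1/10)\<^sup>2 * (\<epsilon> * real n)" using \<eta> n_pos by (simp add: power2_eq_square)
    also have "\<dots> \<le> (1/10)\<^sup>2 * (real q * (\<epsilon> * real n))" using q \<epsilon> n_pos by (intro mult_left_mono) auto
    also have "\<dots> = (1/10 * w)\<^sup>2" by (simp add: power_mult_distrib power_divide w(2))
    finally show "fro2 (U * D) \<le> (1/10 * w)\<^sup>2" using ud by simp
  qed (use w in auto)
  moreover have "sqrt (fro2 (Z M * H Mo)) \<ge> sqrt (fro2 (C * (1\<^sub>m n - H M))) - sqrt (fro2 (U * D))"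
    unfolding ZP by (rule fro2_add_ge) auto
  ultimately have "4 * w \<le> sqrt (fro2 (Z M * H Mo))" using w by simp
  hence "(4 * w)\<^sup>2 \<le> (sqrt (fro2 (Z M * H Mo)))\<^sup>2" using w by (intro power_mono) auto
  hence f1: "16 * real q * \<epsilon> * real n \<le> fro2 (Z M * H Mo)" by (simp add: power_mult_distrib w(2))
  have f2: "lo * real q \<le> fro2 (Z M * (1\<^sub>m n - H Mo))"
  proof -
    have "lo * fro2 (1\<^sub>m q) \<le> fro2 (1\<^sub>m q * Z Mo)" by (rule Z_lower[OF full_Mo' mx(1) one_carrier_mat])
    moreover have "fro2 (1\<^sub>m q) = real q"
      by (simp add: fro2_def if_distrib[where f="\<lambda>x. x ^ _"] cong: if_cong)
    moreover have "Z M * (1\<^sub>m n - H Mo) = Z Mo" unfolding Z_Mo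
      using assms Mo by (intro Z_complement[OF M HP(2) _ HP(5)] rows_sub_mult_eqI[OF X _ _ Mo HP(2,5)]) auto
    ultimately show ?thesis using Z_dims[OF full_Mo'] by (simp add: mat_one_mult)
  qed
  have "lo \<le> real n" using \<eta> n_pos by (simp add: lo_def)
  hence "lo * (16 * \<epsilon>) \<le> real n * (16 * \<epsilon>)" using \<epsilon> by (intro mult_right_mono) auto
  also have "\<dots> \<le> real q * (real n * (16 * \<epsilon>))" using q \<epsilon> n_pos by simp
  finally have "lo * (real q + 16 * \<epsilon>) \<le> lo * real q + 16 * real q * \<epsilon> * real n" by (simp add: algebra_simps)
  also have "\<dots> \<le> fro2 (Z M)"
    using f1 f2 fro2_pythagoras[OF HP(2-4), of "Z M"] by simp
  finally have "det (Z M * transpose_mat (Z M)) \<ge> lo ^ q * (1 + 16 * \<epsilon>)"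
    using lo_pos \<epsilon> by (intro det_gram_ge[OF Z_dims(3)[OF M]] Z_lower[OF M mM]) auto
  hence "v * (lo ^ q * (1 + 16 * \<epsilon>)) \<le> v * det (Z M * transpose_mat (Z M))" using v_pos by simp
  thus ?thesis by (simp only: det_Sigma[OF M] a_def mult.assoc)
qed

end

section \<open>Powers of unknown sign and the number of candidate models\<close>

lemma powr_le_max:
  fixes a :: real
  assumes "a > 0" "\<bar>x\<bar> \<le> y"
  shows "a powr x \<le> (max a (1/a)) powr y"
proof -
  have one: "max a (1/a) \<ge> 1" using assms(1) by (cases "a \<ge> 1") (auto simp: le_max_iff_disj)
  have "a powr x \<le> (max a (1/a)) powr \<bar>x\<bar>"
  proof (cases "x \<ge> 0")
    case True
    thus ?thesis using assms(1) by (auto intro!: powr_mono2)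
  next
    case False
    hence "a powr x = (1/a) powr \<bar>x\<bar>" using assms(1) by (simp add: powr_divide powr_minus_divide)
    also have "\<dots> \<le> (max a (1/a)) powr \<bar>x\<bar>" using assms(1) by (intro powr_mono2) auto
    finally show ?thesis .
  qed
  also have "\<dots> \<le> (max a (1/a)) powr y" by (rule powr_mono[OF assms(2) one])
  finally show ?thesis .
qed

lemma finite_small_subsets: "finite {M. M \<subseteq> {0..<p::nat} \<and> real (card M) \<le> mx}"
  by (rule finite_subset[of _ "Pow {0..<p}"]) auto

text \<open>A set of at most \<open>k\<close> elements is the image of a function on
  \<open>{..<k}\<close> padded with the value \<open>p\<close>, which lies outside the range and is
  removed again. Hence the base \<open>p + 1\<close>.\<close>

lemma card_small_subsets:
  assumes "mx \<ge> 0"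
  shows "real (card {M. M \<subseteq> {0..<p::nat} \<and> real (card M) \<le> mx}) \<le> real (p + 1) powr mx"
proof -
  define k where "k = nat \<lfloor>mx\<rfloor>"
  have "{M. M \<subseteq> {0..<p} \<and> real (card M) \<le> mx} \<subseteq> (\<lambda>f. f ` {..<k} - {p}) ` (PiE {..<k} (\<lambda>_. {0..p}))"
  proof
    fix M assume "M \<in> {M. M \<subseteq> {0..<p} \<and> real (card M) \<le> mx}"
    hence M: "M \<subseteq> {0..<p}" "real (card M) \<le> mx" by auto
    hence fin: "finite M" using finite_subset by blast
    have ck: "card M \<le> k" using M(2) assms by (simp add: k_def le_nat_floor)
    obtain h where h: "bij_betw h {0..<card M} M" using ex_bij_betw_nat_finite[OF fin] by blast
    define f where "f = (\<lambda>i\<in>{..<k}. if i < card M then h i else p)"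
    have hM: "h ` {0..<card M} = M" using h by (simp add: bij_betw_def)
    hence "f \<in> PiE {..<k} (\<lambda>_. {0..p})" using M(1) by (fastforce simp: f_def)
    moreover have "f ` {..<k} - {p} = M"
    proof (intro equalityI subsetI)
      fix x assume "x \<in> f ` {..<k} - {p}"
      thus "x \<in> M" using hM by (auto simp: f_def split: if_splits)
    next
      fix x assume x: "x \<in> M"
      hence "x \<in> h ` {0..<card M}" using hM by simp
      then obtain i where i: "i < card M" "x = h i" by auto
      hence "f i = x" "i < k" using ck by (auto simp: f_def)
      moreover have "x \<noteq> p" using x M(1) by auto
      ultimately show "x \<in> f ` {..<k} - {p}" by blast
    qed
    ultimately show "M \<in> (\<lambda>f. f ` {..<k} - {p}) ` (PiE {..<k} (\<lambda>_. {0..p}))" by blast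
  qed
  hence "card {M. M \<subseteq> {0..<p} \<and> real (card M) \<le> mx} \<le> card (PiE {..<k} (\<lambda>_. {0..p}))"
    by (rule surj_card_le[rotated]) (intro finite_PiE, auto)
  also have "\<dots> = (p + 1) ^ k" by (simp add: card_PiE)
  finally have "real (card {M. M \<subseteq> {0..<p} \<and> real (card M) \<le> mx}) \<le> real ((p + 1) ^ k)" by (simp only: of_nat_le_iff)
  also have "\<dots> = real (p + 1) powr real k" by (subst powr_realpow) auto
  also have "\<dots> \<le> real (p + 1) powr mx" using assms by (intro powr_mono) (auto simp: k_def)
  finally show ?thesis .
qed

section \<open>Comparison of model weights on the good event\<close>

context gf_sample
begin

definition "E M = gf_expect Y X M (h_eps \<epsilon> Y X M)"

text \<open>One factor per source of loss: 2 for the expectation at \<open>Mo\<close> being only at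
  least 1/2, then the gamma functions, the powers of \<open>pi\<close>, the change of exponent of
  the scale \<open>a\<close>, and the volume factor of the density tail. The exponent
  \<open>n / 4\<close> is the net rate \<open>n / 2 - n / 4\<close>.\<close>

definition "err = 2 * (real n powr (mx + 1)) ^ q * pi powr (real q * mx) * (max a (1/a)) powr mx * 2 powr (real q * mx) * \<rho> powr (- (real n / 4))"

lemma Y_carrier: "Y \<in> carrier_mat q n" by (intro carrier_matI) auto

lemma card_nat_bound: "real (card M) \<le> mx \<Longrightarrow> n \<ge> 2 * q * card M"
proof -
  assume "real (card M) \<le> mx"
  hence "2 * real q * real (card M) \<le> 2 * real q * mx" by (intro mult_left_mono) auto
  hence "real (2 * q * card M) \<le> real n" using mx(4) by simp
  thus ?thesis by (simp only: of_nat_le_iff)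
qed

lemma gf_bounds:
  assumes "full M" "real (card M) \<le> mx" "M \<noteq> {}"
  shows "0 \<le> E M" "E M \<le> 1"
    "(\<And>B. B \<in> carrier_mat q (card M) \<Longrightarrow> fro2 (W M * (B - B_hat Y X M) * rows_sub X M) < \<epsilon>/4 \<Longrightarrow> h_eps \<epsilon> Y X M B = 0)
      \<Longrightarrow> E M \<le> 2 powr (real q * mx) * \<rho> powr (- (real n / 2))"
    "(\<And>B. B \<in> carrier_mat q (card M) \<Longrightarrow> fro2 (W M * (B - B_hat Y X M) * rows_sub X M) < \<epsilon>/4 \<Longrightarrow> h_eps \<epsilon> Y X M B = 1)
      \<Longrightarrow> E M \<ge> 1 - 2 powr (real q * mx) * \<rho> powr (- (real n / 2))"
proof -
  have M: "M \<subseteq> {0..<p}" and d: "det (rows_sub X M * transpose_mat (rows_sub X M)) \<noteq> 0" using assms by (auto simp: full_def)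
  have e4: "\<epsilon> / 4 > 0" using \<epsilon> by simp
  note b = gf_expect_bounds[OF Y_carrier X M assms(3) q card_nat_bound[OF assms(2)] Sigma_eq(2)[OF assms(1)] Sigma_pos_def[OF assms(1,2)] d e4,
     of \<epsilon>, folded E_def W_def]
  have K: "2 ^ (q * card M) * ((1 + (\<epsilon>/4) / real q) / (1 + (\<epsilon>/4) / (4 * real q))) powr (- (real n / 2)) \<le> 2 powr (real q * mx) * \<rho> powr (- (real n / 2))"
  proof (rule mult_mono)
    have "(2::real) ^ (q * card M) = 2 powr (real (q * card M))" by (rule powr_realpow[symmetric]) simp
    also have "\<dots> \<le> 2 powr (real q * mx)" using assms(2) by (intro powr_mono) (auto intro: mult_left_mono)
    finally show "(2::real) ^ (q * card M) \<le> 2 powr (real q * mx)" .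
    show "((1 + (\<epsilon>/4) / real q) / (1 + (\<epsilon>/4) / (4 * real q))) powr (- (real n / 2)) \<le> \<rho> powr (- (real n / 2))"
      using \<rho>(1,2) by (intro powr_mono2') auto
  qed auto
  show "0 \<le> E M" "E M \<le> 1" by (rule b(1), rule b(2))
  show "E M \<le> 2 powr (real q * mx) * \<rho> powr (- (real n / 2))"
    if "\<And>B. B \<in> carrier_mat q (card M) \<Longrightarrow> fro2 (W M * (B - B_hat Y X M) * rows_sub X M) < \<epsilon>/4 \<Longrightarrow> h_eps \<epsilon> Y X M B = 0"
    using b(3)[OF that] K by simp
  show "E M \<ge> 1 - 2 powr (real q * mx) * \<rho> powr (- (real n / 2))"
    if "\<And>B. B \<in> carrier_mat q (card M) \<Longrightarrow> fro2 (W M * (B - B_hat Y X M) * rows_sub X M) < \<epsilon>/4 \<Longrightarrow> h_eps \<epsilon> Y X M B = 1"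
    using b(4)[OF that] K by simp
qed

lemma E_Mo: "E Mo \<ge> 1/2"
  using gf_bounds(4)[OF full_Mo' mx(1) Mo_nonempty h_one] small by simp

lemma E_empty: "E {} = 0"
  unfolding E_def by (rule gf_expect_empty[OF Y_carrier X \<epsilon>])

lemma r_eq:
  assumes "M \<subseteq> {0..<p}" "real (card M) \<le> mx"
  shows "r_eps \<epsilon> Y X M = (if full M then mgamma q ((real n - real (card M)) / 2) * pi powr (real q * real (card M) / 2)
        * det (Sigma_hat Y X M) powr (- ((real n - real (card M) - real q) / 2)) * E M else 0)"
proof -
  have "real (card M) < real n - real q" using assms(2) mx n_pos by linarith
  moreover have "vec_space.rank (card M) (rows_sub X M) = card M \<longleftrightarrow> full M"
    using rank_full_iff[OF rows_sub_dims(1)[OF X assms(1)]] assms(1) by (simp add: full_def)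
  ultimately show ?thesis by (simp add: r_eps_def Let_def E_def)
qed

lemma E_nonneg: "full M \<Longrightarrow> real (card M) \<le> mx \<Longrightarrow> E M \<ge> 0"
  using gf_bounds(1) E_empty by (cases "M = {}") auto

lemma mgamma_pos': "real (card M) \<le> mx \<Longrightarrow> mgamma q ((real n - real (card M)) / 2) > 0"
  using mx n_pos by (intro mgamma_pos) (simp add: field_simps)

lemma r_nonneg: "M \<subseteq> {0..<p} \<Longrightarrow> real (card M) \<le> mx \<Longrightarrow> r_eps \<epsilon> Y X M \<ge> 0"
  using E_nonneg[of M] mgamma_pos'[of M] by (simp add: r_eq)

lemma det_Mo_pos: "det (Sigma_hat Y X Mo) > 0"
  using det_Sigma_ge[OF full_Mo' mx(1)] a_pos by simp

lemma r_Mo_pos: "r_eps \<epsilon> Y X Mo > 0"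
  using E_Mo mgamma_pos'[OF mx(1)] det_Mo_pos full_Mo' by (simp add: r_eq[OF Mo mx(1)])

text \<open>One bound for both kinds of wrong model. Outside \<open>Mo\<close> the expectation
  supplies the small factor. For a proper subset the determinant does: its exponent is at least
  \<open>n / 4\<close>, and \<open>\<rho>\<^sup>2 \<le> 1 + 16 * \<epsilon>\<close> turns that into
  \<open>\<rho> powr (- (n / 2))\<close>.\<close>

lemma det_tail:
  assumes M: "full M" "real (card M) \<le> mx" "M \<noteq> Mo"
  defines "e \<equiv> (real n - real (card M) - real q) / 2"
  shows "det (Sigma_hat Y X M) powr (- e) * E M \<le> a powr (- e) * (2 powr (real q * mx) * \<rho> powr (- (real n / 2)))"
proof -
  have e: "e \<ge> real n / 4" using M(2) mx by (simp add: e_def)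
  hence e0: "e \<ge> 0" using n_pos by simp
  have tp: "1 \<le> (2::real) powr (real q * mx)" using mx(1) by (intro ge_one_powr_ge_zero) auto
  note E0 = E_nonneg[OF M(1,2)]
  show ?thesis
  proof (cases "M \<subseteq> Mo")
    case False
    hence ne: "M \<noteq> {}" by auto
    have "E M \<le> 2 powr (real q * mx) * \<rho> powr (- (real n / 2))"
      by (rule gf_bounds(3)[OF M(1,2) ne h_zero[OF M(1,2) False]])
    moreover have "det (Sigma_hat Y X M) powr (- e) \<le> a powr (- e)"
      using det_Sigma_ge[OF M(1,2)] a_pos e0 by (intro powr_mono2') auto
    ultimately show ?thesis using E0 by (intro mult_mono) auto
  next
    case True
    hence sub: "M \<subset> Mo" using M(3) by blast
    have E1: "E M \<le> 1" using gf_bounds(2)[OF M(1,2)] E_empty by (cases "M = {}") auto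
    have "det (Sigma_hat Y X M) powr (- e) * E M \<le> det (Sigma_hat Y X M) powr (- e) * 1"
      using E1 by (intro mult_left_mono) auto
    also have "\<dots> \<le> (a * (1 + 16 * \<epsilon>)) powr (- e)"
      using det_Sigma_sub_ge[OF sub] a_pos e0 \<epsilon> by (auto intro!: powr_mono2' mult_pos_pos add_pos_pos)
    also have "\<dots> = a powr (- e) * (1 + 16 * \<epsilon>) powr (- e)" by (rule powr_mult)
    also have "(1 + 16 * \<epsilon>) powr (- e) \<le> (1 + 16 * \<epsilon>) powr (- (real n / 4))" using e \<epsilon> by (intro powr_mono) auto
    also have "(1 + 16 * \<epsilon>) powr (- (real n / 4)) \<le> (\<rho>\<^sup>2) powr (- (real n / 4))" using \<rho>(1,3) by (intro powr_mono2') auto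
    also have "(\<rho>\<^sup>2) powr (- (real n / 4)) = \<rho> powr (- (real n / 2))"
      using \<rho>(1) by (simp add: powr_powr flip: powr_numeral)
    also have "a powr (- e) * \<rho> powr (- (real n / 2)) \<le> a powr (- e) * (2 powr (real q * mx) * \<rho> powr (- (real n / 2)))"
      using mult_right_mono[OF tp, of "\<rho> powr (- (real n / 2))"] by (intro mult_left_mono) auto
    finally show ?thesis by (simp add: mult_left_mono)
  qed
qed

text \<open>Returns from the scale \<open>a\<close> to the determinant of \<open>Mo\<close>. The two
  differ by a factor of at most \<open>\<kappa>\<close>, raised to a power of at most
  \<open>n / 2\<close>; \<open>\<kappa>\<^sup>2 \<le> \<rho>\<close> limits the cost to
  \<open>\<rho> powr (n / 4)\<close>.\<close>

lemma a_powr_le: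
  assumes "real (card M) \<le> mx"
  shows "a powr (- ((real n - real (card M) - real q) / 2)) \<le>
    (max a (1/a)) powr mx * (det (Sigma_hat Y X Mo) powr (- ((real n - real (card Mo) - real q) / 2)) * \<rho> powr (real n / 4))"
proof -
  define e where "e = (real n - real (card Mo) - real q) / 2"
  define \<kappa> where "\<kappa> = ((1 + \<eta>) / (1 - 2 * \<eta>)) ^ q"
  have e: "0 \<le> e" "e \<le> real n / 2" using mx n_pos by (auto simp: e_def)
  have \<kappa>: "\<kappa> \<ge> 1" unfolding \<kappa>_def using \<eta> by (intro one_le_power) (simp add: le_divide_eq)
  have split: "- ((real n - real (card M) - real q) / 2) = (real (card M) - real (card Mo)) / 2 + - e"
    by (simp add: e_def field_simps)
  have "a powr (- ((real n - real (card M) - real q) / 2)) = a powr ((real (card M) - real (card Mo)) / 2) * a powr (- e)"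
    unfolding split by (rule powr_add)
  also have "\<dots> \<le> (max a (1/a)) powr mx * (det (Sigma_hat Y X Mo) powr (- e) * \<rho> powr (real n / 4))"
  proof (rule mult_mono)
    \<comment> \<open>The exponent may have either sign and \<open>a\<close> may lie on either side
      of 1, hence the maximum with the reciprocal.\<close>
    show "a powr ((real (card M) - real (card Mo)) / 2) \<le> (max a (1/a)) powr mx"
      using assms mx(1) by (intro powr_le_max[OF a_pos]) (auto simp: abs_le_iff)
    have "(a * \<kappa>) powr (- e) \<le> det (Sigma_hat Y X Mo) powr (- e)"
      using det_Sigma_Mo_le det_Mo_pos e by (intro powr_mono2') (auto simp: \<kappa>_def)
    hence "(a powr (- e) * \<kappa> powr (- e)) * \<kappa> powr e \<le> det (Sigma_hat Y X Mo) powr (- e) * \<kappa> powr e"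
      using a_pos \<kappa> by (intro mult_right_mono) (auto simp: powr_mult)
    moreover have "\<kappa> powr (- e) * \<kappa> powr e = 1" using \<kappa> by (simp add: powr_add[symmetric])
    ultimately have "a powr (- e) \<le> det (Sigma_hat Y X Mo) powr (- e) * \<kappa> powr e" by (simp add: mult.assoc)
    also have "\<kappa> powr e \<le> \<kappa> powr (real n / 2)" using e \<kappa> by (intro powr_mono) auto
    also have "\<kappa> powr (real n / 2) = (\<kappa>\<^sup>2) powr (real n / 4)" using \<kappa> by (simp add: powr_powr flip: powr_numeral)
    also have "(\<kappa>\<^sup>2) powr (real n / 4) \<le> \<rho> powr (real n / 4)" using \<rho>(4) by (intro powr_mono2) (auto simp: \<kappa>_def)
    finally show "a powr (- e) \<le> det (Sigma_hat Y X Mo) powr (- e) * \<rho> powr (real n / 4)" by (simp add: mult_left_mono)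
  qed auto
  finally show ?thesis by (simp add: e_def)
qed

lemma err_nonneg: "err \<ge> 0" by (simp add: err_def)

lemma r_ratio:
  assumes M: "M \<subseteq> {0..<p}" "real (card M) \<le> mx" "M \<noteq> Mo"
  shows "r_eps \<epsilon> Y X M \<le> err * r_eps \<epsilon> Y X Mo"
proof (cases "full M")
  case False
  thus ?thesis using err_nonneg r_Mo_pos by (simp add: r_eq[OF M(1,2)] less_imp_le)
next
  case True
  define g where "g = (\<lambda>M :: nat set. mgamma q ((real n - real (card M)) / 2))"
  define D where "D = (\<lambda>M. det (Sigma_hat Y X M) powr (- ((real n - real (card M) - real q) / 2)))"
  define N where "N = (real n powr (mx + 1)) ^ q"
  define A where "A = (max a (1/a)) powr mx"
  define t where "t = (2::real) powr (real q * mx)"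
  have rM: "r_eps \<epsilon> Y X M = (g M * pi powr (real q * real (card M) / 2)) * (D M * E M)"
    using True by (simp add: r_eq[OF M(1,2)] g_def D_def mult.assoc)
  have rMo: "r_eps \<epsilon> Y X Mo = g Mo * pi powr (real q * real (card Mo) / 2) * D Mo * E Mo"
    using full_Mo' by (simp add: r_eq[OF Mo mx(1)] g_def D_def)
  have g: "0 < g M" "0 < g Mo" "g M \<le> N * g Mo"
    using mgamma_pos'[OF M(2)] mgamma_pos'[OF mx(1)] mgamma_shift_le[OF M(2) mx(1,2,3)] by (auto simp: g_def N_def)
  have p1: "pi powr (real q * real (card M) / 2) \<le> pi powr (real q * mx) * pi powr (real q * real (card Mo) / 2)"
  proof -
    have "real q * real (card M) \<le> real q * mx" using M(2) by (intro mult_left_mono) auto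
    moreover have "0 \<le> real q * mx" using mx(1) by (intro mult_nonneg_nonneg) auto
    moreover have "0 \<le> real q * real (card Mo)" by simp
    ultimately have "real q * real (card M) / 2 \<le> real q * mx + real q * real (card Mo) / 2" by linarith
    thus ?thesis unfolding powr_add[symmetric] using pi_ge_two by (intro powr_mono) auto
  qed
  have d1: "D M * E M \<le> a powr (- ((real n - real (card M) - real q) / 2)) * (t * \<rho> powr (- (real n / 2)))"
    unfolding D_def t_def by (rule det_tail[OF True M(2,3)])
  also have "\<dots> \<le> (A * (D Mo * \<rho> powr (real n / 4))) * (t * \<rho> powr (- (real n / 2)))"
    unfolding A_def D_def t_def by (intro mult_right_mono a_powr_le[OF M(2)]) auto
  also have "\<dots> = A * D Mo * t * (\<rho> powr (real n / 4) * \<rho> powr (- (real n / 2)))" by (simp add: mult_ac)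
  also have "\<rho> powr (real n / 4) * \<rho> powr (- (real n / 2)) = \<rho> powr (- (real n / 4))"
    by (simp add: powr_add[symmetric])
  finally have d2: "D M * E M \<le> A * D Mo * t * \<rho> powr (- (real n / 4))" .
  have "r_eps \<epsilon> Y X M \<le> (N * g Mo * (pi powr (real q * mx) * pi powr (real q * real (card Mo) / 2))) * (A * D Mo * t * \<rho> powr (- (real n / 4)))"
  proof -
    have gp: "g M * pi powr (real q * real (card M) / 2) \<le> N * g Mo * (pi powr (real q * mx) * pi powr (real q * real (card Mo) / 2))"
      using g p1 by (intro mult_mono) (auto simp: N_def)
    show ?thesis unfolding rM using g E_nonneg[OF True M(2)]
      by (intro mult_mono[OF gp d2]) (auto simp: N_def D_def)
  qed
  also have "\<dots> \<le> (N * g Mo * (pi powr (real q * mx) * pi powr (real q * real (card Mo) / 2))) * (A * D Mo * t * \<rho> powr (- (real n / 4))) * (2 * E Mo)"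
  proof -
    have "0 \<le> (N * g Mo * (pi powr (real q * mx) * pi powr (real q * real (card Mo) / 2))) * (A * D Mo * t * \<rho> powr (- (real n / 4)))" (is "0 \<le> ?x")
      using g by (simp add: N_def D_def A_def t_def)
    hence "?x * 1 \<le> ?x * (2 * E Mo)" using E_Mo by (intro mult_left_mono) auto
    thus ?thesis by simp
  qed
  also have "\<dots> = err * r_eps \<epsilon> Y X Mo"
    unfolding rMo err_def N_def A_def t_def by (simp add: mult_ac)
  finally show ?thesis .
qed

lemma ratio_deviation:
  "\<bar>r_eps \<epsilon> Y X Mo / (\<Sum>M \<in> {M. M \<subseteq> {0..<p} \<and> real (card M) \<le> mx}. r_eps \<epsilon> Y X M) - 1\<bar> \<le> real (p + 1) powr mx * err"
proof -
  let ?C = "{M. M \<subseteq> {0..<p} \<and> real (card M) \<le> mx}"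
  note fin = finite_small_subsets[of p mx]
  define rest where "rest = (\<Sum>M \<in> ?C - {Mo}. r_eps \<epsilon> Y X M)"
  have Mo_in: "Mo \<in> ?C" using Mo mx(1) by simp
  have sum: "(\<Sum>M \<in> ?C. r_eps \<epsilon> Y X M) = r_eps \<epsilon> Y X Mo + rest"
    unfolding rest_def by (rule sum.remove[OF fin Mo_in])
  have rest0: "rest \<ge> 0" unfolding rest_def by (intro sum_nonneg r_nonneg) auto
  have "rest \<le> (\<Sum>M \<in> ?C - {Mo}. err * r_eps \<epsilon> Y X Mo)" unfolding rest_def by (intro sum_mono r_ratio) auto
  also have "\<dots> = real (card (?C - {Mo})) * (err * r_eps \<epsilon> Y X Mo)" by simp
  also have "\<dots> \<le> real (p + 1) powr mx * (err * r_eps \<epsilon> Y X Mo)"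
  proof (rule mult_right_mono)
    have "real (card (?C - {Mo})) \<le> real (card ?C)" using fin by (intro of_nat_mono card_mono) auto
    also have "\<dots> \<le> real (p + 1) powr mx" using mx(1) by (intro card_small_subsets) linarith
    finally show "real (card (?C - {Mo})) \<le> real (p + 1) powr mx" .
  qed (use err_nonneg r_Mo_pos in simp)
  finally have le: "rest \<le> (real (p + 1) powr mx * err) * r_eps \<epsilon> Y X Mo" by (simp add: mult.assoc)
  have "r_eps \<epsilon> Y X Mo / (r_eps \<epsilon> Y X Mo + rest) - 1 = - (rest / (r_eps \<epsilon> Y X Mo + rest))"
    using r_Mo_pos rest0 by (simp add: field_simps)
  hence "\<bar>r_eps \<epsilon> Y X Mo / (r_eps \<epsilon> Y X Mo + rest) - 1\<bar> = rest / (r_eps \<epsilon> Y X Mo + rest)"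
    using r_Mo_pos rest0 by simp
  also have "\<dots> \<le> rest / r_eps \<epsilon> Y X Mo" using r_Mo_pos rest0 by (intro divide_left_mono) auto
  also have "\<dots> \<le> real (p + 1) powr mx * err" using le r_Mo_pos by (simp add: pos_divide_le_eq)
  finally show ?thesis by (simp add: sum)
qed

end

section \<open>Asymptotics\<close>

text \<open>Error bounds are written as \<open>exp (h n)\<close>, so that only the coefficient of
  the linear term of \<open>h\<close> decides about convergence.\<close>

lemma exp_tendsto_0_if_rate:
  fixes h :: "nat \<Rightarrow> real"
  assumes "(\<lambda>n. h n / real n) \<longlonglongrightarrow> c" "c < 0"
  shows "(\<lambda>n. exp (h n)) \<longlonglongrightarrow> 0"
proof -
  have "filterlim (\<lambda>n. h n / real n * real n) at_bot sequentially"
    by (rule filterlim_tendsto_neg_mult_at_bot[OF assms filterlim_real_sequentially])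
  moreover have "eventually (\<lambda>n. h n / real n * real n = h n) sequentially"
    using eventually_gt_at_top[of 0] by eventually_elim simp
  ultimately have "filterlim h at_bot sequentially"
    by (subst (asm) filterlim_cong[OF refl refl]) auto
  thus ?thesis by (rule filterlim_compose[OF exp_at_bot])
qed

context
  fixes \<alpha> :: real and p :: "nat \<Rightarrow> nat"
  assumes \<alpha>: "0 < \<alpha>" "\<alpha> < 1"
    and p: "(\<lambda>n. ln (real (p n))) \<in> o(\<lambda>n. real n powr (1 - \<alpha>))"
begin

lemma powr_over_n: "(\<lambda>n. real n powr \<alpha> / real n) \<longlonglongrightarrow> 0"
  using \<alpha> by real_asymp

lemma powr_ln_over_n: "(\<lambda>n. real n powr \<alpha> * ln (real n) / real n) \<longlonglongrightarrow> 0"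
  using \<alpha> by real_asymp

lemma ln_over_n: "(\<lambda>n. ln (real n) / real n) \<longlonglongrightarrow> 0" by real_asymp

lemma one_over_n: "(\<lambda>n. 1 / real n) \<longlonglongrightarrow> 0" by real_asymp

lemma ln_p_over_n: "(\<lambda>n. real n powr \<alpha> * ln (real (p n + 1)) / real n) \<longlonglongrightarrow> 0"
proof (rule tendsto_sandwich[OF _ _ tendsto_const])
  have "(\<lambda>n. ln (real (p n)) / real n powr (1 - \<alpha>)) \<longlonglongrightarrow> 0" by (rule smalloD_tendsto[OF p])
  from tendsto_add[OF tendsto_mult_right[OF powr_over_n, of "ln 2"] this]
  show "(\<lambda>n. real n powr \<alpha> / real n * ln 2 + ln (real (p n)) / real n powr (1 - \<alpha>)) \<longlonglongrightarrow> 0" by simp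
  show "eventually (\<lambda>n. 0 \<le> real n powr \<alpha> * ln (real (p n + 1)) / real n) sequentially"
    by (intro always_eventually allI divide_nonneg_nonneg mult_nonneg_nonneg ln_ge_zero) auto
  show "eventually (\<lambda>n. real n powr \<alpha> * ln (real (p n + 1)) / real n \<le> real n powr \<alpha> / real n * ln 2 + ln (real (p n)) / real n powr (1 - \<alpha>)) sequentially"
    using eventually_gt_at_top[of 0]
  proof eventually_elim
    case (elim n)
    have "ln (real (p n + 1)) \<le> ln 2 + ln (real (p n))"
    \<comment> \<open>For \<open>p n = 0\<close> the right-hand side is \<open>ln 2\<close>, because
      \<open>ln 0\<close> is 0; otherwise \<open>p n + 1 \<le> 2 * p n\<close>.\<close>
    proof (cases "p n = 0")
      case False
      hence "ln (real (p n + 1)) \<le> ln (2 * real (p n))" by simp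
      thus ?thesis using False by (simp add: ln_mult)
    qed simp
    hence "real n powr \<alpha> / real n * ln (real (p n + 1)) \<le> real n powr \<alpha> / real n * (ln 2 + ln (real (p n)))"
      by (intro mult_left_mono) auto
    also have "\<dots> = real n powr \<alpha> / real n * ln 2 + real n powr \<alpha> / real n * ln (real (p n))"
      by (rule distrib_left)
    also have "real n powr \<alpha> / real n * ln (real (p n)) = ln (real (p n)) / real n powr (1 - \<alpha>)"
      using elim by (simp add: powr_diff)
    finally show ?case by simp
  qed
qed

text \<open>The reference scale of the comparison is \<open>c * n ^ q\<close> with constant
  \<open>c\<close>. Its logarithm grows like \<open>ln n\<close>, so the term with
  \<open>ln \<rho>\<close> is the only one of linear order in the exponent.\<close>

lemma comparison_error_tendsto_0:
  fixes q :: nat and a :: "nat \<Rightarrow> real" and c \<rho> :: real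
  assumes \<rho>: "\<rho> > 1" and c: "c > 0"
  shows "(\<lambda>n. real (p n + 1) powr (real n powr \<alpha>) *
    (2 * (real n powr (real n powr \<alpha> + 1)) ^ q * pi powr (real q * real n powr \<alpha>)
      * (max (c * real n ^ q) (1 / (c * real n ^ q))) powr (real n powr \<alpha>) * 2 powr (real q * real n powr \<alpha>) * \<rho> powr (- (real n / 4)))) \<longlonglongrightarrow> 0"
    (is "?G \<longlonglongrightarrow> 0")
proof -
  define m where "m = (\<lambda>n. real n powr \<alpha>)"
  define h where "h = (\<lambda>n. m n * ln (real (p n + 1)) + ln 2 + real q * ((m n + 1) * ln (real n)) + real q * m n * ln pi
     + m n * (\<bar>ln c\<bar> + real q * ln (real n)) + real q * m n * ln 2 - real n / 4 * ln \<rho>)"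
  have lim: "(\<lambda>n. h n / real n) \<longlonglongrightarrow> - (ln \<rho> / 4)"
  proof (rule Lim_transform_eventually)
    have "(\<lambda>n. m n * ln (real (p n + 1)) / real n + ln 2 * (1 / real n) + real q * (m n * ln (real n) / real n + ln (real n) / real n)
      + (real q * ln pi + \<bar>ln c\<bar> + real q * ln 2) * (m n / real n) + real q * (m n * ln (real n) / real n) - ln \<rho> / 4)
      \<longlonglongrightarrow> 0 + ln 2 * 0 + real q * (0 + 0) + (real q * ln pi + \<bar>ln c\<bar> + real q * ln 2) * 0 + real q * 0 - ln \<rho> / 4"
      unfolding m_def
      by (intro tendsto_diff tendsto_add tendsto_mult tendsto_const ln_p_over_n one_over_n powr_ln_over_n ln_over_n powr_over_n)
    thus "(\<lambda>n. m n * ln (real (p n + 1)) / real n + ln 2 * (1 / real n) + real q * (m n * ln (real n) / real n + ln (real n) / real n)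
      + (real q * ln pi + \<bar>ln c\<bar> + real q * ln 2) * (m n / real n) + real q * (m n * ln (real n) / real n) - ln \<rho> / 4)
      \<longlonglongrightarrow> - (ln \<rho> / 4)" by simp
    show "eventually (\<lambda>n. m n * ln (real (p n + 1)) / real n + ln 2 * (1 / real n) + real q * (m n * ln (real n) / real n + ln (real n) / real n)
      + (real q * ln pi + \<bar>ln c\<bar> + real q * ln 2) * (m n / real n) + real q * (m n * ln (real n) / real n) - ln \<rho> / 4 = h n / real n) sequentially"
      using eventually_gt_at_top[of 0] by eventually_elim (simp add: h_def field_simps)
  qed
  have exp0: "(\<lambda>n. exp (h n)) \<longlonglongrightarrow> 0" by (rule exp_tendsto_0_if_rate[OF lim]) (use \<rho> in simp)
  show ?thesis
  proof (rule tendsto_sandwich[OF _ _ tendsto_const exp0])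
    show "eventually (\<lambda>n. 0 \<le> ?G n) sequentially"
      by (intro always_eventually allI mult_nonneg_nonneg) auto
    show "eventually (\<lambda>n. ?G n \<le> exp (h n)) sequentially"
      using eventually_gt_at_top[of 0]
    proof eventually_elim
      case (elim n)
      hence n: "real n > 0" "ln (real n) \<ge> 0" by auto
      have m0: "m n \<ge> 0" by (simp add: m_def)
      define a where "a = c * real n ^ q"
      have a: "a > 0" using c n by (simp add: a_def)
      have lna: "ln (max a (1/a)) = \<bar>ln a\<bar>"
      proof (cases "a \<ge> 1")
        case True
        hence "max a (1/a) = a" using a by (intro max_absorb1) (simp add: divide_le_eq order.trans[of 1 a "a * a"])
        thus ?thesis using True by simp
      next
        case False
        hence "1 \<le> 1/a" using a by simp
        hence "max a (1/a) = 1/a" using False by (intro max_absorb2) linarith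
        thus ?thesis using False a by (simp add: ln_div)
      qed
      have "ln a = ln c + real q * ln (real n)" using c n by (simp add: a_def ln_mult ln_realpow)
      hence lna_le: "\<bar>ln a\<bar> \<le> \<bar>ln c\<bar> + real q * ln (real n)" using mult_nonneg_nonneg[OF of_nat_0_le_iff n(2), of q] by linarith
      have maxpos: "max a (1/a) > 0" using a by (simp add: less_max_iff_disj)
      have "?G n = exp (m n * ln (real (p n + 1)) + ln 2 + real q * ((m n + 1) * ln (real n)) + real q * m n * ln pi
     + m n * ln (max a (1/a)) + real q * m n * ln 2 - real n / 4 * ln \<rho>)"
      proof -
        have e: "real (p n + 1) powr m n = exp (m n * ln (real (p n + 1)))"
          "(real n powr (m n + 1)) ^ q = exp (real q * ((m n + 1) * ln (real n)))"
          "pi powr (real q * m n) = exp (real q * m n * ln pi)"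
          "(max a (1/a)) powr m n = exp (m n * ln (max a (1/a)))"
          "2 powr (real q * m n) = exp (real q * m n * ln 2)"
          "\<rho> powr (- (real n / 4)) = exp (- (real n / 4 * ln \<rho>))" "(2::real) = exp (ln 2)"
          using n maxpos \<rho> by (simp_all add: powr_def exp_of_nat_mult)
        have mn: "real n powr \<alpha> = m n" by (simp add: m_def)
        show ?thesis
          unfolding mn a_def[symmetric] e(1-6)
          by (subst (1) e(7)) (simp only: exp_add[symmetric], rule arg_cong[of _ _ exp], simp)
      qed
      also have "\<dots> \<le> exp (h n)"
        unfolding h_def lna using lna_le m0 by (simp add: mult_left_mono)
      finally show ?case .
    qed
  qed
qed

lemma noise_error_tendsto_0:
  fixes q :: nat and \<eta> :: real
  assumes \<eta>: "\<eta> > 0" and q: "q \<ge> 1"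
  shows "(\<lambda>n. (real q)\<^sup>2 * (2 * real n / (\<eta> * real n / real q)\<^sup>2) +
     real (p n + 1) powr (2 * real n powr \<alpha>) * (exp (- (\<eta> * real n) / 4) * sqrt 2 powr (real q * (2 * real n powr \<alpha>)))) \<longlonglongrightarrow> 0"
proof -
  define m where "m = (\<lambda>n. real n powr \<alpha>)"
  define h where "h = (\<lambda>n. 2 * (m n * ln (real (p n + 1))) - \<eta> / 4 * real n + 2 * real q * ln (sqrt 2) * m n)"
  have lim: "(\<lambda>n. h n / real n) \<longlonglongrightarrow> - (\<eta> / 4)"
  proof (rule Lim_transform_eventually)
    have "(\<lambda>n. 2 * (m n * ln (real (p n + 1)) / real n) - \<eta> / 4 + 2 * real q * ln (sqrt 2) * (m n / real n))
      \<longlonglongrightarrow> 2 * 0 - \<eta> / 4 + 2 * real q * ln (sqrt 2) * 0"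
      unfolding m_def by (intro tendsto_diff tendsto_add tendsto_mult tendsto_const ln_p_over_n powr_over_n)
    thus "(\<lambda>n. 2 * (m n * ln (real (p n + 1)) / real n) - \<eta> / 4 + 2 * real q * ln (sqrt 2) * (m n / real n)) \<longlonglongrightarrow> - (\<eta> / 4)" by simp
    show "eventually (\<lambda>n. 2 * (m n * ln (real (p n + 1)) / real n) - \<eta> / 4 + 2 * real q * ln (sqrt 2) * (m n / real n) = h n / real n) sequentially"
      using eventually_gt_at_top[of 0] by eventually_elim (simp add: h_def add_divide_distrib diff_divide_distrib)
  qed
  have exp0: "(\<lambda>n. exp (h n)) \<longlonglongrightarrow> 0" by (rule exp_tendsto_0_if_rate[OF lim]) (use \<eta> in simp)
  have "(\<lambda>n. 2 * (real q)^4 / \<eta>\<^sup>2 * (1 / real n) + exp (h n)) \<longlonglongrightarrow> 2 * (real q)^4 / \<eta>\<^sup>2 * 0 + 0"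
    by (intro tendsto_add tendsto_mult tendsto_const one_over_n exp0)
  hence lim2: "(\<lambda>n. 2 * (real q)^4 / \<eta>\<^sup>2 * (1 / real n) + exp (h n)) \<longlonglongrightarrow> 0" by simp
  show ?thesis
  proof (rule Lim_transform_eventually[OF lim2])
    show "eventually (\<lambda>n. 2 * (real q)^4 / \<eta>\<^sup>2 * (1 / real n) + exp (h n) =
      (real q)\<^sup>2 * (2 * real n / (\<eta> * real n / real q)\<^sup>2) +
     real (p n + 1) powr (2 * real n powr \<alpha>) * (exp (- (\<eta> * real n) / 4) * sqrt 2 powr (real q * (2 * real n powr \<alpha>)))) sequentially"
      using eventually_gt_at_top[of 0]
    proof eventually_elim
      case (elim n)
      have "2 * (real q)^4 / \<eta>\<^sup>2 * (1 / real n) = (real q)\<^sup>2 * (2 * real n / (\<eta> * real n / real q)\<^sup>2)"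
      proof -
        have "(real q)\<^sup>2 * (2 * real n / (\<eta> * real n / real q)\<^sup>2) = 2 * (real q)^4 / \<eta>\<^sup>2 * (real n / (real n)\<^sup>2)"
          by (simp add: power_divide power_mult_distrib power4_eq_xxxx power2_eq_square mult_ac)
        also have "real n / (real n)\<^sup>2 = 1 / real n" by (simp add: power2_eq_square)
        finally show ?thesis by simp
      qed
      moreover have "exp (h n) = real (p n + 1) powr (2 * real n powr \<alpha>) * (exp (- (\<eta> * real n) / 4) * sqrt 2 powr (real q * (2 * real n powr \<alpha>)))"
      proof -
        have "h n = 2 * m n * ln (real (p n + 1)) + (- (\<eta> * real n) / 4 + real q * (2 * m n) * ln (sqrt 2))"
          by (simp add: h_def)
        hence "exp (h n) = exp (2 * m n * ln (real (p n + 1))) * (exp (- (\<eta> * real n) / 4) * exp (real q * (2 * m n) * ln (sqrt 2)))"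
          by (simp only: exp_add)
        thus ?thesis by (simp add: powr_def m_def)
      qed
      ultimately show ?case by simp
    qed
  qed
qed

lemma concentration_error_tendsto_0:
  fixes q :: nat and \<rho> :: real
  assumes \<rho>: "\<rho> > 1"
  shows "(\<lambda>n. 2 powr (real q * real n powr \<alpha>) * \<rho> powr (- (real n / 2))) \<longlonglongrightarrow> 0"
proof -
  define h where "h = (\<lambda>n. real q * ln 2 * real n powr \<alpha> - ln \<rho> / 2 * real n)"
  have lim: "(\<lambda>n. h n / real n) \<longlonglongrightarrow> - (ln \<rho> / 2)"
  proof (rule Lim_transform_eventually)
    have "(\<lambda>n. real q * ln 2 * (real n powr \<alpha> / real n) - ln \<rho> / 2) \<longlonglongrightarrow> real q * ln 2 * 0 - ln \<rho> / 2"
      by (intro tendsto_diff tendsto_mult tendsto_const powr_over_n)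
    thus "(\<lambda>n. real q * ln 2 * (real n powr \<alpha> / real n) - ln \<rho> / 2) \<longlonglongrightarrow> - (ln \<rho> / 2)" by simp
    show "eventually (\<lambda>n. real q * ln 2 * (real n powr \<alpha> / real n) - ln \<rho> / 2 = h n / real n) sequentially"
      using eventually_gt_at_top[of 0] by eventually_elim (simp add: h_def field_simps)
  qed
  have "(\<lambda>n. exp (h n)) \<longlonglongrightarrow> 0" by (rule exp_tendsto_0_if_rate[OF lim]) (use \<rho> in simp)
  moreover have "exp (h n) = 2 powr (real q * real n powr \<alpha>) * \<rho> powr (- (real n / 2))" for n
  proof -
    have "h n = real q * real n powr \<alpha> * ln 2 + - (real n / 2) * ln \<rho>" by (simp add: h_def)
    hence "exp (h n) = exp (real q * real n powr \<alpha> * ln 2) * exp (- (real n / 2) * ln \<rho>)" by (simp only: exp_add)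
    thus ?thesis using \<rho> by (simp add: powr_def[of 2] powr_def[of \<rho>])
  qed
  ultimately show ?thesis by simp
qed

end

section \<open>Choice of the constants and the limit\<close>

lemma rate_constants:
  fixes \<epsilon> :: real and q :: nat
  assumes "\<epsilon> > 0" "q \<ge> 1"
  obtains \<rho> \<eta> :: real where "\<rho> > 1" "\<rho> \<le> (1 + (\<epsilon>/4) / q) / (1 + (\<epsilon>/4) / (4 * q))" "\<rho>\<^sup>2 \<le> 1 + 16 * \<epsilon>"
    "0 < \<eta>" "\<eta> \<le> 1/8" "\<eta> \<le> \<epsilon> / 100" "(((1 + \<eta>) / (1 - 2 * \<eta>)) ^ q)\<^sup>2 \<le> \<rho>"
proof -
  define \<rho> where "\<rho> = min ((1 + (\<epsilon>/4) / q) / (1 + (\<epsilon>/4) / (4 * q))) (sqrt (1 + 16 * \<epsilon>))"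
  have "1 + (\<epsilon>/4) / (4 * real q) > 0" using assms by (simp add: add_pos_nonneg)
  moreover have "(\<epsilon>/4) / (4 * real q) < (\<epsilon>/4) / q" using assms by (intro divide_strict_left_mono) auto
  ultimately have "(1 + (\<epsilon>/4) / real q) / (1 + (\<epsilon>/4) / (4 * q)) > 1" by (subst less_divide_eq) auto
  hence \<rho>1: "\<rho> > 1" using assms by (simp add: \<rho>_def)
  have "\<rho>\<^sup>2 \<le> (sqrt (1 + 16 * \<epsilon>))\<^sup>2" using \<rho>1 by (intro power_mono) (auto simp: \<rho>_def)
  hence \<rho>2: "\<rho>\<^sup>2 \<le> 1 + 16 * \<epsilon>" using assms by simp
  \<comment> \<open>As the noise tolerance tends to 0 the determinant spread tends to 1, which lies
    strictly below the already fixed \<open>\<rho>\<close>.\<close>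
  have "((\<lambda>\<eta>::real. (((1 + \<eta>) / (1 - 2 * \<eta>)) ^ q)\<^sup>2) \<longlongrightarrow> (((1 + 0) / (1 - 2 * 0)) ^ q)\<^sup>2) (at_right 0)"
    by (intro tendsto_intros) auto
  hence "((\<lambda>\<eta>::real. (((1 + \<eta>) / (1 - 2 * \<eta>)) ^ q)\<^sup>2) \<longlongrightarrow> 1) (at_right 0)" by simp
  hence 1: "eventually (\<lambda>\<eta>. (((1 + \<eta>) / (1 - 2 * \<eta>)) ^ q)\<^sup>2 < \<rho>) (at_right (0::real))"
    using \<rho>1 by (rule order_tendstoD(2))
  have 2: "eventually (\<lambda>\<eta>::real. 0 < \<eta>) (at_right 0)" by (simp add: eventually_at_right_less)
  have 3: "eventually (\<lambda>\<eta>::real. \<eta> < min (1/8) (\<epsilon>/100)) (at_right 0)"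
    using assms by (intro order_tendstoD(2)[OF tendsto_ident_at]) auto
  obtain \<eta> where "(((1 + \<eta>) / (1 - 2 * \<eta>)) ^ q)\<^sup>2 < \<rho>" "0 < \<eta>" "\<eta> < min (1/8) (\<epsilon>/100)"
    using eventually_happens'[OF _ eventually_conj[OF 1 eventually_conj[OF 2 3]]] by auto
  thus ?thesis using that[of \<rho> \<eta>] \<rho>1 \<rho>2 by (auto simp: \<rho>_def)
qed

text \<open>Convergence in probability is expressed by measurable sets \<open>A n\<close> that cover
  the deviation events and have vanishing probability, that is, as convergence in outer
  probability.\<close>

theorem theorem4:
  fixes q :: nat and \<alpha> \<epsilon> :: real
    and p :: "nat \<Rightarrow> nat" and X :: "nat \<Rightarrow> real mat"
    and Mo :: "nat \<Rightarrow> nat set" and B0 :: "nat \<Rightarrow> real mat" and A0 :: "real mat"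
  assumes model:
      "\<forall>n. X n \<in> carrier_mat (p n) n"
      "\<forall>n. Mo n \<subseteq> {0..<p n}"
      "\<forall>n. B0 n \<in> carrier_mat q (card (Mo n))"
      "A0 \<in> carrier_mat q q" "pos_def_mat A0"
    and C1: "q \<ge> 1" "0 < lam_min (A0 * transpose_mat A0)"
            "lam_min (A0 * transpose_mat A0) \<le> lam_max (A0 * transpose_mat A0)"
    and C2: "0 < \<alpha>" "\<alpha> < 1"
            "(\<lambda>n. ln (real (p n))) \<in> o(\<lambda>n. real n powr (1 - \<alpha>))"
    and C3: "eventually (\<lambda>n. det (rows_sub (X n) (Mo n) * transpose_mat (rows_sub (X n) (Mo n))) \<noteq> 0)
               sequentially"
    and eps: "\<epsilon> > 0"
    and C4: "eventually (\<lambda>n. real (card (Mo n)) < real n powr \<alpha> \<and>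
               1 / (36 * real q * (real n - real (card (Mo n))))
               * min_sparse_fit (inv_sqrt (A0 * transpose_mat A0))
                   (B0 n * rows_sub (X n) (Mo n)) (X n) (card (Mo n) - 1) > \<epsilon>) sequentially"
    and C5: "eventually (\<lambda>n. \<forall>M. M \<subseteq> {0..<p n} \<and> \<not> M \<subseteq> Mo n \<and> real (card M) \<le> real n powr \<alpha> \<longrightarrow>
               9 / (lam_min (A0 * transpose_mat A0) * (real n - real (card M)))
               * Min ((\<lambda>j. fro2 (B0 n * rows_sub (X n) (Mo n)
                          * (H_proj (X n) M - H_proj (X n) (M - {j})))) ` M) < \<epsilon>) sequentially"
  shows "\<forall>\<delta>>0. \<exists>A. (\<forall>n. A n \<in> sets (gauss_mat_measure q n) \<and>
            {u \<in> space (gauss_mat_measure q n).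
               \<bar>r_eps \<epsilon> (resp (X n) (B0 n) (Mo n) A0 u) (X n) (Mo n)
                / (\<Sum>M \<in> {M. M \<subseteq> {0..<p n} \<and> real (card M) \<le> real n powr \<alpha>}.
                     r_eps \<epsilon> (resp (X n) (B0 n) (Mo n) A0 u) (X n) M) - 1\<bar> > \<delta>} \<subseteq> A n)
          \<and> (\<lambda>n. measure (gauss_mat_measure q n) (A n)) \<longlonglongrightarrow> 0"
proof (intro allI impI)
  fix \<delta> :: real assume \<delta>: "\<delta> > 0"
  let ?dev = "\<lambda>n u. \<bar>r_eps \<epsilon> (resp (X n) (B0 n) (Mo n) A0 u) (X n) (Mo n)
                / (\<Sum>M \<in> {M. M \<subseteq> {0..<p n} \<and> real (card M) \<le> real n powr \<alpha>}.
                     r_eps \<epsilon> (resp (X n) (B0 n) (Mo n) A0 u) (X n) M) - 1\<bar>"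
  obtain \<rho> \<eta> where \<rho>: "\<rho> > 1" "\<rho> \<le> (1 + (\<epsilon>/4) / q) / (1 + (\<epsilon>/4) / (4 * q))" "\<rho>\<^sup>2 \<le> 1 + 16 * \<epsilon>"
    and \<eta>: "0 < \<eta>" "\<eta> \<le> 1/8" "\<eta> \<le> \<epsilon> / 100" "(((1 + \<eta>) / (1 - 2 * \<eta>)) ^ q)\<^sup>2 \<le> \<rho>"
    using rate_constants[OF eps C1(1)] by blast
  define mx where "mx = (\<lambda>n. real n powr \<alpha>)"
  define c where "c = (det A0)\<^sup>2 * (1 - 2 * \<eta>) ^ q"
  have c: "c > 0" using pos_def_det[OF model(4,5)] \<eta> by (simp add: c_def)
  define err where "err = (\<lambda>n. real (p n + 1) powr mx n *
    (2 * (real n powr (mx n + 1)) ^ q * pi powr (real q * mx n)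
      * (max (c * real n ^ q) (1 / (c * real n ^ q))) powr (mx n) * 2 powr (real q * mx n) * \<rho> powr (- (real n / 4))))"
  have err: "err \<longlonglongrightarrow> 0"
    unfolding err_def mx_def by (rule comparison_error_tendsto_0[OF C2 \<rho>(1) c])
  define good where "good = (\<lambda>n. real (card (Mo n)) \<le> mx n \<and> mx n + real q \<le> real n / 2 \<and> real n \<ge> 8 \<and> 2 * real q * mx n \<le> real n
     \<and> 2 powr (real q * mx n) * \<rho> powr (- (real n / 2)) \<le> 1/2 \<and> err n \<le> \<delta>
     \<and> det (rows_sub (X n) (Mo n) * transpose_mat (rows_sub (X n) (Mo n))) \<noteq> 0
     \<and> 1 / (36 * real q * (real n - real (card (Mo n))))
               * min_sparse_fit (inv_sqrt (A0 * transpose_mat A0))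
                   (B0 n * rows_sub (X n) (Mo n)) (X n) (card (Mo n) - 1) > \<epsilon>
     \<and> (\<forall>M. M \<subseteq> {0..<p n} \<and> \<not> M \<subseteq> Mo n \<and> real (card M) \<le> mx n \<longrightarrow>
               9 / (lam_min (A0 * transpose_mat A0) * (real n - real (card M)))
               * Min ((\<lambda>j. fro2 (B0 n * rows_sub (X n) (Mo n)
                          * (H_proj (X n) M - H_proj (X n) (M - {j})))) ` M) < \<epsilon>))"
  have good: "eventually good sequentially"
  proof -
    \<comment> \<open>The bound 1/4, together with \<open>4 * q \<le> n\<close>, gives
      \<open>mx n + q \<le> n / 2\<close>; the other bound gives
      \<open>2 * q * mx n \<le> n\<close>.\<close>
    have "eventually (\<lambda>n. mx n / real n < min (1/4) (1 / (2 * real q))) sequentially"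
      unfolding mx_def using C1(1) by (intro order_tendstoD(2)[OF powr_over_n[OF C2]]) auto
    moreover have "eventually (\<lambda>n. n \<ge> 8 + 4 * q) sequentially" by (rule eventually_ge_at_top)
    moreover have "eventually (\<lambda>n. 2 powr (real q * mx n) * \<rho> powr (- (real n / 2)) < 1/2) sequentially"
      unfolding mx_def by (intro order_tendstoD(2)[OF concentration_error_tendsto_0[OF C2 \<rho>(1)]]) auto
    moreover have "eventually (\<lambda>n. err n < \<delta>) sequentially" by (rule order_tendstoD(2)[OF err \<delta>])
    ultimately show ?thesis using C3 C4 C5
    proof eventually_elim
      case (elim n)
      have n: "real n > 0" "real n \<ge> 8" "4 * real q \<le> real n" using elim(2) by linarith+
      have "mx n / real n < 1/4" "mx n / real n < 1 / (2 * real q)" using elim(1) by auto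
      hence "mx n < real n / 4" "mx n * (2 * real q) < real n" using n C1(1) by (simp_all add: field_simps)
      thus ?case unfolding good_def using elim n by (simp add: mx_def mult.commute mult.left_commute)
    qed
  qed
  define F where "F = (\<lambda>n. {K. K \<subseteq> {0..<p n} \<and> real (card K) \<le> 2 * mx n})"
  \<comment> \<open>The factors are fixed before any sample \<open>u\<close> is considered, because
    the Gaussian tail bound concerns deterministic matrices.\<close>
  have "\<forall>n K. \<exists>Q. K \<subseteq> {0..<p n} \<longrightarrow> Q \<in> carrier_mat n (card K) \<and> rows_sub (X n) K * (Q * transpose_mat Q) = rows_sub (X n) K \<and>
    (Q * transpose_mat Q) * (Q * transpose_mat Q) = Q * transpose_mat Q \<and>
    (\<forall>m. \<forall>g \<in> carrier_mat m (card K). fro2 (g * transpose_mat Q) \<le> fro2 g)"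
    using row_space_factor[OF rows_sub_dims(1)] model(1) by meson
  then obtain Q where Q: "\<And>n K. K \<subseteq> {0..<p n} \<Longrightarrow> Q n K \<in> carrier_mat n (card K)"
    "\<And>n K. K \<subseteq> {0..<p n} \<Longrightarrow> rows_sub (X n) K * (Q n K * transpose_mat (Q n K)) = rows_sub (X n) K"
    "\<And>n K. K \<subseteq> {0..<p n} \<Longrightarrow> (Q n K * transpose_mat (Q n K)) * (Q n K * transpose_mat (Q n K)) = Q n K * transpose_mat (Q n K)"
    "\<And>n K m g. K \<subseteq> {0..<p n} \<Longrightarrow> g \<in> carrier_mat m (card K) \<Longrightarrow> fro2 (g * transpose_mat (Q n K)) \<le> fro2 g"
    by metis
  define bad where "bad = (\<lambda>n. {u \<in> space (gauss_mat_measure q n).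
     (\<exists>i<q. \<exists>i'<q. \<eta> * real n / real q < \<bar>(\<Sum>j<n. u (i,j) * u (i',j)) - of_bool (i = i') * real n\<bar>) \<or> (\<exists>K\<in>F n. \<eta> * real n < fro2 (mat q n u * Q n K))})"
  have bad: "bad n \<in> sets (gauss_mat_measure q n)"
    "measure (gauss_mat_measure q n) (bad n) \<le> (real q)\<^sup>2 * (2 * real n / (\<eta> * real n / real q)\<^sup>2) +
     real (p n + 1) powr (2 * real n powr \<alpha>) * (exp (- (\<eta> * real n) / 4) * sqrt 2 powr (real q * (2 * real n powr \<alpha>)))"
    if n: "real n \<ge> 8" for n
  proof -
    have fin: "finite (F n)" unfolding F_def by (rule finite_small_subsets)
    have s: "\<eta> * real n / real q > 0" using n \<eta> C1(1) by simp
    have b: "bad n \<in> sets (gauss_mat_measure q n)" "measure (gauss_mat_measure q n) (bad n) \<le> (real q)\<^sup>2 * (2 * real n / (\<eta> * real n / real q)\<^sup>2) +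
      real (card (F n)) * (exp (- (\<eta> * real n) / 4) * sqrt 2 powr (real q * (2 * mx n)))"
      unfolding bad_def
      by (rule gauss_bad_event[OF fin _ _ _ s, where k = card and kmax = "2 * mx n"]; use Q in \<open>auto simp: F_def\<close>)+
    show "bad n \<in> sets (gauss_mat_measure q n)" by (rule b(1))
    have "real (card (F n)) \<le> real (p n + 1) powr (2 * mx n)"
      unfolding F_def by (rule card_small_subsets) (simp add: mx_def)
    hence le: "real (card (F n)) * (exp (- (\<eta> * real n) / 4) * sqrt 2 powr (real q * (2 * mx n))) \<le>
      real (p n + 1) powr (2 * mx n) * (exp (- (\<eta> * real n) / 4) * sqrt 2 powr (real q * (2 * mx n)))"
      by (intro mult_right_mono) auto
    show "measure (gauss_mat_measure q n) (bad n) \<le> (real q)\<^sup>2 * (2 * real n / (\<eta> * real n / real q)\<^sup>2) +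
     real (p n + 1) powr (2 * real n powr \<alpha>) * (exp (- (\<eta> * real n) / 4) * sqrt 2 powr (real q * (2 * real n powr \<alpha>)))"
      using order.trans[OF b(2) add_left_mono[OF le]] unfolding mx_def .
  qed
  have dev: "?dev n u \<le> \<delta>"
    if g: "good n" and u: "u \<in> space (gauss_mat_measure q n)" "u \<notin> bad n" for n u
  proof -
    interpret S: gf_sample q "p n" n "X n" "B0 n" A0 "Mo n" u \<eta> \<epsilon> "mx n" \<rho>
    proof
      show "\<exists>k. \<exists>Q \<in> carrier_mat n k. rows_sub (X n) K * (Q * transpose_mat Q) = rows_sub (X n) K \<and>
         (Q * transpose_mat Q) * (Q * transpose_mat Q) = Q * transpose_mat Q \<and>
         fro2 (mat q n u * Q) \<le> \<eta> * real n" if K: "K \<subseteq> {0..<p n}" "real (card K) \<le> 2 * mx n" for K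
      proof (intro exI[of _ "card K"] bexI[of _ "Q n K"] conjI Q K(1))
        have "K \<in> F n" using K by (simp add: F_def)
        thus "fro2 (mat q n u * Q n K) \<le> \<eta> * real n" using u by (auto simp: bad_def not_less)
      qed
      show "\<bar>(\<Sum>j<n. u (i,j) * u (i',j)) - of_bool (i = i') * real n\<bar> \<le> \<eta> * real n / real q" if "i < q" "i' < q" for i i'
        using u that unfolding bad_def by (metis (mono_tags, lifting) mem_Collect_eq not_less)
    qed (use model C1 eps \<eta> \<rho> g in \<open>auto simp: good_def\<close>)
    \<comment> \<open>The reference scale is free of \<open>u\<close>, so the error on the good
      event is the deterministic sequence \<open>err\<close>.\<close>
    have a: "S.a = c * real n ^ q"
      by (simp add: S.a_def S.v_def S.lo_def c_def power_mult_distrib mult.assoc)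
    have "real (p n + 1) powr mx n * S.err = err n" unfolding S.err_def err_def a by simp
    thus ?thesis using S.ratio_deviation g by (simp add: S.Y_def good_def mx_def)
  qed
  \<comment> \<open>The sample sizes at which some asymptotic condition fails are covered by the
    whole space; they do not affect the limit.\<close>
  define A where "A = (\<lambda>n. if good n then bad n else space (gauss_mat_measure q n))"
  have "\<forall>n. A n \<in> sets (gauss_mat_measure q n) \<and>
 {u \<in> space (gauss_mat_measure q n). ?dev n u > \<delta>} \<subseteq> A n"
  proof
    fix n
    show "A n \<in> sets (gauss_mat_measure q n) \<and>
 {u \<in> space (gauss_mat_measure q n). ?dev n u > \<delta>} \<subseteq> A n"
    proof (cases "good n")
      case True
      hence "real n \<ge> 8" by (simp add: good_def)
      hence "bad n \<in> sets (gauss_mat_measure q n)" by (rule bad(1))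
      thus ?thesis using True dev[OF True] by (auto simp: A_def not_less[symmetric])
    next
      case False
      thus ?thesis by (auto simp: A_def)
    qed
  qed
  moreover have "(\<lambda>n. measure (gauss_mat_measure q n) (A n)) \<longlonglongrightarrow> 0"
  proof (rule tendsto_sandwich[OF _ _ tendsto_const noise_error_tendsto_0[OF C2 \<eta>(1) C1(1)]])
    show "eventually (\<lambda>n. 0 \<le> measure (gauss_mat_measure q n) (A n)) sequentially" by simp
    show "eventually (\<lambda>n. measure (gauss_mat_measure q n) (A n) \<le> (real q)\<^sup>2 * (2 * real n / (\<eta> * real n / real q)\<^sup>2) +
     real (p n + 1) powr (2 * real n powr \<alpha>) * (exp (- (\<eta> * real n) / 4) * sqrt 2 powr (real q * (2 * real n powr \<alpha>)))) sequentially"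
      using good
    proof eventually_elim
      case (elim n)
      hence "real n \<ge> 8" by (simp add: good_def)
      from bad(2)[OF this] show ?case using elim by (simp add: A_def)
    qed
  qed
  ultimately show "\<exists>A. (\<forall>n. A n \<in> sets (gauss_mat_measure q n) \<and>
 {u \<in> space (gauss_mat_measure q n). ?dev n u > \<delta>} \<subseteq> A n)
          \<and> (\<lambda>n. measure (gauss_mat_measure q n) (A n)) \<longlonglongrightarrow> 0"
    by blast
qed

end
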